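(* Let $a_0,r_0,M,\eta>0$, $\nu\ne0$, and $a_0>|\nu|M$. Set $$\kappa=\frac{\nu^2}{r_0},\qquad\delta=\sqrt{a_0^2-2\kappa\eta},\qquad\overline P=\frac{a_0-\delta}{\kappa},$$ and assume $a_0^2>2\kappa\eta$ and $|\nu|\overline P/r_0<M$. On $Q=(0,T)\times(0,\pi)$ consider $$u_\tau=\max_{|\alpha|\le M}\Big\{(a_0+\nu\alpha)u_{xx}+\Big(\eta-\frac{r_0}2\alpha^2\Big)\sin x\Big\},\qquad u|_{\partial_pQ}=0.\qquad( * )$$ For every finite $T>0$, Howard iteration for $( * )$ from $u^0=0$ converges in $X_2$ to the unique strong solution $u_*$ of $( * )$ and satisfies $$\|u_*-u^{n+1}\|_{X_2}\le C_T\|u_*-u^n\|_{X_2}^{\,2},\qquad n\ge0,$$ where one may take $$C_T=\frac{\kappa T^{3/2}}{\sqrt{2\pi}}\left(\frac{a_0+3}{\delta}+1\right).$$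
   Context: $\partial_pQ$ is the initial and lateral boundary of $Q$. $X_2=W^{1,2}(0,T;L^2(0,\pi))\cap L^2(0,T;W^{2,2}(0,\pi))$ with the norm $\|w\|_{X_2}=\|w\|_{L^2(Q)}+\|w_x\|_{L^2(Q)}+\|w_{xx}\|_{L^2(Q)}+\|w_\tau\|_{L^2(Q)}$, and $X_2^0=\{w\in X_2:w\in L^2(0,T;W^{1,2}_0(0,\pi)),\ w(0)=0\}$. A strong solution of $( * )$ is a function in $X_2^0$ satisfying the equation a.e. in $Q$. Howard iteration for $( * )$: given $u^n$, let $\alpha_n(\tau,x)\in[-M,M]$ be a measurable maximizer over $|\alpha|\le M$ of $(a_0+\nu\alpha)u^n_{xx}(\tau,x)+(\eta-\frac{r_0}2\alpha^2)\sin x$, and let $u^{n+1}\in X_2^0$ be the unique solution of $u^{n+1}_\tau=(a_0+\nu\alpha_n)u^{n+1}_{xx}+(\eta-\frac{r_0}2\alpha_n^2)\sin x$ a.e. in $Q$. *)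

theory Defs
  imports "HOL-Analysis.Analysis"
begin

text \<open>
  Functions on \<open>Q = (0,T) \<times> (0,\<pi>)\<close> are total functions of the pair \<open>(\<tau>, x)\<close>. Elements of \<open>L\<^sup>2\<close> are
  represented by functions, and equality of classes is equality almost everywhere.
\<close>

definition Q :: "real \<Rightarrow> (real \<times> real) set" where
  "Q T = {0<..<T} \<times> {0<..<pi}"

definition L2_on :: "'a::euclidean_space set \<Rightarrow> ('a \<Rightarrow> real) set" where
  "L2_on S = {f. f \<in> borel_measurable (lebesgue_on S) \<and> integrable (lebesgue_on S) (\<lambda>z. (f z)\<^sup>2)}"

definition L2_norm :: "'a::euclidean_space set \<Rightarrow> ('a \<Rightarrow> real) \<Rightarrow> real" where
  "L2_norm S f = sqrt (\<integral>z. (f z)\<^sup>2 \<partial>lebesgue_on S)"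

definition test_fun :: "real \<Rightarrow> real \<Rightarrow> (real \<Rightarrow> real) set" where
  "test_fun a b = {\<phi>. (\<forall>n t. (deriv ^^ n) \<phi> field_differentiable at t) \<and>
     (\<exists>K. compact K \<and> K \<subseteq> {a<..<b} \<and> (\<forall>t. t \<notin> K \<longrightarrow> \<phi> t = 0))}"

definition weak_deriv :: "real \<Rightarrow> real \<Rightarrow> (real \<Rightarrow> real) \<Rightarrow> (real \<Rightarrow> real) \<Rightarrow> bool" where
  "weak_deriv a b f g \<longleftrightarrow> f \<in> L2_on {a<..<b} \<and> g \<in> L2_on {a<..<b} \<and>
     (\<forall>\<phi>\<in>test_fun a b. (\<integral>t. f t * deriv \<phi> t \<partial>lebesgue_on {a<..<b})
                        = - (\<integral>t. g t * \<phi> t \<partial>lebesgue_on {a<..<b}))"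

text \<open>The closure of the test functions in the norm of \<open>W\<^sup>1\<^sup>,\<^sup>2(a,b)\<close>.\<close>

definition W12_0 :: "real \<Rightarrow> real \<Rightarrow> (real \<Rightarrow> real) set" where
  "W12_0 a b = {f. \<exists>g. weak_deriv a b f g \<and>
     (\<forall>\<epsilon>>0. \<exists>\<phi>\<in>test_fun a b. L2_norm {a<..<b} (\<lambda>x. \<phi> x - f x) < \<epsilon> \<and>
                              L2_norm {a<..<b} (\<lambda>x. deriv \<phi> x - g x) < \<epsilon>)}"

text \<open>
  Bochner spaces are written out through the identification of \<open>L\<^sup>2(0,T; L\<^sup>2(0,\<pi>))\<close> with \<open>L\<^sup>2(Q)\<close>.
  The spatial derivative is the weak derivative of the slice \<open>w(\<tau>,\<cdot>)\<close> for almost every \<open>\<tau>\<close>.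
  The time derivative is the weak derivative of the \<open>L\<^sup>2(0,\<pi>)\<close>-valued function \<open>\<tau> \<mapsto> w(\<tau>,\<cdot>)\<close>: the
  defining identity between two Bochner integrals is an equality in \<open>L\<^sup>2(0,\<pi>)\<close>, that is, for almost
  every \<open>x\<close>, and the exceptional null set may depend on the test function.
\<close>

definition is_Dx :: "real \<Rightarrow> (real \<times> real \<Rightarrow> real) \<Rightarrow> (real \<times> real \<Rightarrow> real) \<Rightarrow> bool" where
  "is_Dx T w g \<longleftrightarrow> g \<in> L2_on (Q T) \<and>
     (AE \<tau> in lebesgue_on {0<..<T}. weak_deriv 0 pi (\<lambda>x. w (\<tau>, x)) (\<lambda>x. g (\<tau>, x)))"

definition is_Dtau :: "real \<Rightarrow> (real \<times> real \<Rightarrow> real) \<Rightarrow> (real \<times> real \<Rightarrow> real) \<Rightarrow> bool" where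
  "is_Dtau T w g \<longleftrightarrow> g \<in> L2_on (Q T) \<and>
     (\<forall>\<phi>\<in>test_fun 0 T. AE x in lebesgue_on {0<..<pi}.
        (\<integral>\<tau>. w (\<tau>, x) * deriv \<phi> \<tau> \<partial>lebesgue_on {0<..<T})
        = - (\<integral>\<tau>. g (\<tau>, x) * \<phi> \<tau> \<partial>lebesgue_on {0<..<T}))"

text \<open>The derivatives are determined up to null sets of \<open>Q\<close>; the operators pick a representative.\<close>

definition Dx :: "real \<Rightarrow> (real \<times> real \<Rightarrow> real) \<Rightarrow> real \<times> real \<Rightarrow> real" where
  "Dx T w = (SOME g. is_Dx T w g)"

definition Dxx :: "real \<Rightarrow> (real \<times> real \<Rightarrow> real) \<Rightarrow> real \<times> real \<Rightarrow> real" where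
  "Dxx T w = Dx T (Dx T w)"

definition Dtau :: "real \<Rightarrow> (real \<times> real \<Rightarrow> real) \<Rightarrow> real \<times> real \<Rightarrow> real" where
  "Dtau T w = (SOME g. is_Dtau T w g)"

definition X2 :: "real \<Rightarrow> (real \<times> real \<Rightarrow> real) set" where
  "X2 T = {w \<in> L2_on (Q T). (\<exists>g. is_Dtau T w g) \<and> (\<exists>g h. is_Dx T w g \<and> is_Dx T g h)}"

definition X2_norm :: "real \<Rightarrow> (real \<times> real \<Rightarrow> real) \<Rightarrow> real" where
  "X2_norm T w = L2_norm (Q T) w + L2_norm (Q T) (Dx T w) + L2_norm (Q T) (Dxx T w)
                 + L2_norm (Q T) (Dtau T w)"

text \<open>
  \<open>w(0) = 0\<close> refers to the representative of \<open>w\<close> in \<open>C([0,T]; L\<^sup>2(0,\<pi>))\<close>, here \<open>W\<close>.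
\<close>

definition zero_initial :: "real \<Rightarrow> (real \<times> real \<Rightarrow> real) \<Rightarrow> bool" where
  "zero_initial T w \<longleftrightarrow> (\<exists>W :: real \<Rightarrow> real \<Rightarrow> real.
     (\<forall>t\<in>{0..T}. W t \<in> L2_on {0<..<pi}) \<and>
     (\<forall>t\<in>{0..T}. ((\<lambda>s. L2_norm {0<..<pi} (\<lambda>x. W s x - W t x)) \<longlongrightarrow> 0) (at t within {0..T})) \<and>
     (AE t in lebesgue_on {0<..<T}. AE x in lebesgue_on {0<..<pi}. W t x = w (t, x)) \<and>
     (AE x in lebesgue_on {0<..<pi}. W 0 x = 0))"

definition X2_0 :: "real \<Rightarrow> (real \<times> real \<Rightarrow> real) set" where
  "X2_0 T = {w \<in> X2 T.
     (AE \<tau> in lebesgue_on {0<..<T}. (\<lambda>x. w (\<tau>, x)) \<in> W12_0 0 pi) \<and> zero_initial T w}"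

definition hamiltonian :: "real \<Rightarrow> real \<Rightarrow> real \<Rightarrow> real \<Rightarrow> real \<Rightarrow> real \<Rightarrow> real \<Rightarrow> real" where
  "hamiltonian a\<^sub>0 \<nu> r\<^sub>0 \<eta> p x \<alpha> = (a\<^sub>0 + \<nu> * \<alpha>) * p + (\<eta> - r\<^sub>0 / 2 * \<alpha>\<^sup>2) * sin x"

text \<open>For \<open>M \<ge> 0\<close> the supremum over \<open>[-M,M]\<close> is a maximum.\<close>

lemma hamiltonian_Sup_attained:
  assumes "0 \<le> M"
  shows "\<exists>\<alpha>\<in>{-M..M}. hamiltonian a\<^sub>0 \<nu> r\<^sub>0 \<eta> p x \<alpha> = (SUP \<beta>\<in>{-M..M}. hamiltonian a\<^sub>0 \<nu> r\<^sub>0 \<eta> p x \<beta>) \<and>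
           (\<forall>\<beta>\<in>{-M..M}. hamiltonian a\<^sub>0 \<nu> r\<^sub>0 \<eta> p x \<beta> \<le> hamiltonian a\<^sub>0 \<nu> r\<^sub>0 \<eta> p x \<alpha>)"
proof -
  have "continuous_on {-M..M} (hamiltonian a\<^sub>0 \<nu> r\<^sub>0 \<eta> p x)"
    unfolding hamiltonian_def by (intro continuous_intros)
  then obtain \<alpha> where \<alpha>: "\<alpha> \<in> {-M..M}"
    "\<forall>\<beta>\<in>{-M..M}. hamiltonian a\<^sub>0 \<nu> r\<^sub>0 \<eta> p x \<beta> \<le> hamiltonian a\<^sub>0 \<nu> r\<^sub>0 \<eta> p x \<alpha>"
    using continuous_attains_sup[of "{-M..M}" "hamiltonian a\<^sub>0 \<nu> r\<^sub>0 \<eta> p x"] assms by auto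
  then have "(SUP \<beta>\<in>{-M..M}. hamiltonian a\<^sub>0 \<nu> r\<^sub>0 \<eta> p x \<beta>) = hamiltonian a\<^sub>0 \<nu> r\<^sub>0 \<eta> p x \<alpha>"
    by (intro cSup_eq_maximum) auto
  with \<alpha> show ?thesis by auto
qed

definition strong_solution ::
    "real \<Rightarrow> real \<Rightarrow> real \<Rightarrow> real \<Rightarrow> real \<Rightarrow> real \<Rightarrow> (real \<times> real \<Rightarrow> real) \<Rightarrow> bool" where
  "strong_solution a\<^sub>0 \<nu> r\<^sub>0 \<eta> M T u \<longleftrightarrow> u \<in> X2_0 T \<and>
     (AE z in lebesgue_on (Q T).
        Dtau T u z = (SUP \<alpha>\<in>{-M..M}. hamiltonian a\<^sub>0 \<nu> r\<^sub>0 \<eta> (Dxx T u z) (snd z) \<alpha>))"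

definition measurable_maximizer ::
    "real \<Rightarrow> real \<Rightarrow> real \<Rightarrow> real \<Rightarrow> real \<Rightarrow> real \<Rightarrow> (real \<times> real \<Rightarrow> real) \<Rightarrow> (real \<times> real \<Rightarrow> real) \<Rightarrow> bool"
  where
  "measurable_maximizer a\<^sub>0 \<nu> r\<^sub>0 \<eta> M T u \<alpha> \<longleftrightarrow> \<alpha> \<in> borel_measurable (lebesgue_on (Q T)) \<and>
     (AE z in lebesgue_on (Q T).
        is_arg_max (hamiltonian a\<^sub>0 \<nu> r\<^sub>0 \<eta> (Dxx T u z) (snd z)) (\<lambda>\<beta>. \<bar>\<beta>\<bar> \<le> M) (\<alpha> z))"

definition linear_solution ::
    "real \<Rightarrow> real \<Rightarrow> real \<Rightarrow> real \<Rightarrow> real \<Rightarrow> (real \<times> real \<Rightarrow> real) \<Rightarrow> (real \<times> real \<Rightarrow> real) \<Rightarrow> bool"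
  where
  "linear_solution a\<^sub>0 \<nu> r\<^sub>0 \<eta> T \<alpha> v \<longleftrightarrow> v \<in> X2_0 T \<and>
     (AE z in lebesgue_on (Q T). Dtau T v z = hamiltonian a\<^sub>0 \<nu> r\<^sub>0 \<eta> (Dxx T v z) (snd z) (\<alpha> z))"

definition howard_iteration ::
    "real \<Rightarrow> real \<Rightarrow> real \<Rightarrow> real \<Rightarrow> real \<Rightarrow> real \<Rightarrow> (nat \<Rightarrow> real \<times> real \<Rightarrow> real)
      \<Rightarrow> (nat \<Rightarrow> real \<times> real \<Rightarrow> real) \<Rightarrow> bool" where
  "howard_iteration a\<^sub>0 \<nu> r\<^sub>0 \<eta> M T \<alpha> u \<longleftrightarrow>
     (\<forall>n. measurable_maximizer a\<^sub>0 \<nu> r\<^sub>0 \<eta> M T (u n) (\<alpha> n) \<and>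
          linear_solution a\<^sub>0 \<nu> r\<^sub>0 \<eta> T (\<alpha> n) (u (Suc n)))"

end

theory Submission
  imports Defs
begin

text \<open>
  Both the solution and the iterates are multiples of \<open>sin x\<close>. For \<open>u = y(\<tau>) sin x\<close> the Hamiltonian is
  \<open>sin x\<close> times a strictly concave quadratic polynomial in \<open>\<alpha>\<close> with maximum at \<open>\<alpha> = - \<nu> y / r\<^sub>0\<close>
  (\<open>hamiltonian_complete_square\<close>). As long as \<open>0 \<le> y \<le> P\<close> this point satisfies the constraint, and the
  equation becomes the Riccati equation \<open>q' = \<eta> - a\<^sub>0 q + (\<kappa>/2) q\<^sup>2\<close>, whose solution with \<open>q(0) = 0\<close> is explicit
  and increases to the smaller root \<open>P\<close> of the right-hand side. One step of Howard iteration is one Newton step for this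
  equation, \<open>p\<^sub>n\<^sub>+\<^sub>1' = - (a\<^sub>0 - \<kappa> p\<^sub>n) p\<^sub>n\<^sub>+\<^sub>1 + \<eta> - (\<kappa>/2) p\<^sub>n\<^sup>2\<close>. Hence the error \<open>e\<^sub>n = q - p\<^sub>n\<close> solves
  \<open>e\<^sub>n\<^sub>+\<^sub>1' + (a\<^sub>0 - \<kappa> p\<^sub>n) e\<^sub>n\<^sub>+\<^sub>1 = (\<kappa>/2) e\<^sub>n\<^sup>2\<close>. By comparison \<open>0 \<le> p\<^sub>n \<le> q \<le> P\<close>, so that the
  coefficient lies in \<open>[\<delta>, a\<^sub>0]\<close>.

  The quadratic estimate (\<open>X_quadratic\<close>) follows from two facts: \<open>\<parallel>e\<parallel> \<le> \<parallel>f\<parallel> / \<delta>\<close> and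
  \<open>\<parallel>e'\<parallel> \<le> (1 + a\<^sub>0 / \<delta>) \<parallel>f\<parallel>\<close> for the linear equation with right-hand side \<open>f\<close>, and
  \<open>\<parallel>e\<^sup>2\<parallel> \<le> T\<^bsup>3/2\<^esup> \<parallel>e'\<parallel>\<^sup>2\<close>; the norm of \<open>e(\<tau>) sin x\<close> in \<open>X\<^sub>2\<close> is
  \<open>sqrt (\<pi>/2) (3 \<parallel>e\<parallel> + \<parallel>e'\<parallel>)\<close>. Convergence itself comes from the pointwise bound
  \<open>e\<^sub>n(t) \<le> P (\<kappa> P t / 2)\<^sup>n / n!\<close> (\<open>err_pointwise\<close>).

  What remains is uniqueness in \<open>X\<^sub>2\<^sup>0\<close>, for the nonlinear equation and for the linear ones: the iterates in
  the statement are arbitrary solutions, and they must be identified with the explicit ones. The difference \<open>w\<close> of two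
  solutions satisfies \<open>w\<^sub>\<tau>\<^sup>2 \<le> L w\<^sub>\<tau> w\<^sub>x\<^sub>x\<close> almost everywhere, since the right-hand sides are nondecreasing and
  Lipschitz in \<open>u\<^sub>x\<^sub>x\<close>. It therefore suffices to show \<open>\<integral>\<integral> w\<^sub>\<tau> w\<^sub>x\<^sub>x \<le> 0\<close> (\<open>energy_inequality\<close>). Integration by parts
  in \<open>x\<close> is available between any two times \<open>\<tau>\<close>, \<open>\<tau>'\<close>, directly from the definition of \<open>W\<^sub>0\<^sup>1\<^sup>,\<^sup>2\<close>:
  \<open>\<integral> w(\<tau>') w\<^sub>x\<^sub>x(\<tau>) = - \<integral> w\<^sub>x(\<tau>') w\<^sub>x(\<tau>)\<close>. After extension by zero in time, the Cauchy-Schwarz inequality gives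
  \<open>\<integral>\<integral> (w(\<tau>) - w(\<tau> - s)) w\<^sub>x\<^sub>x(\<tau>) \<le> 0\<close> for all \<open>s > 0\<close>. Since \<open>w(\<tau>)\<close> is the integral of \<open>w\<^sub>\<tau>\<close> from \<open>0\<close> to \<open>\<tau>\<close>
  (\<open>zero_initial_time_primitive\<close>), division by \<open>s\<close> and the continuity of translations in \<open>L\<^sup>2\<close> yield the claim.
\<close>

section \<open>Square-integrable functions\<close>

text \<open>Square integrability with respect to an arbitrary measure; on a set \<open>S\<close> it is membership in \<open>L2_on S\<close>.\<close>

definition sq_int :: "'a measure \<Rightarrow> ('a \<Rightarrow> real) \<Rightarrow> bool" where
  "sq_int M f \<longleftrightarrow> f \<in> borel_measurable M \<and> integrable M (\<lambda>x. (f x)\<^sup>2)"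

lemma sq_intD: "sq_int M f \<Longrightarrow> f \<in> borel_measurable M" "sq_int M f \<Longrightarrow> integrable M (\<lambda>x. (f x)\<^sup>2)"
  by (auto simp: sq_int_def)

lemma L2_on_iff: "f \<in> L2_on S \<longleftrightarrow> sq_int (lebesgue_on S) f"
  by (simp add: L2_on_def sq_int_def)

lemma sq_int_mult:
  assumes "sq_int M f" "sq_int M g"
  shows "integrable M (\<lambda>x. f x * g x)"
proof (rule Bochner_Integration.integrable_bound)
  show "integrable M (\<lambda>x. (f x)\<^sup>2 + (g x)\<^sup>2)"
    using assms by (auto simp: sq_int_def)
  have "\<bar>a * b\<bar> \<le> \<bar>a\<^sup>2 + b\<^sup>2\<bar>" for a b :: real
  proof -
    have "0 \<le> (\<bar>a\<bar> - \<bar>b\<bar>)\<^sup>2" by simp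
    then have "2 * (\<bar>a\<bar> * \<bar>b\<bar>) \<le> a\<^sup>2 + b\<^sup>2" by (simp add: power2_diff)
    moreover have "0 \<le> \<bar>a\<bar> * \<bar>b\<bar>" by simp
    ultimately have "\<bar>a\<bar> * \<bar>b\<bar> \<le> a\<^sup>2 + b\<^sup>2" by linarith
    then show ?thesis by (simp add: abs_mult)
  qed
  then show "AE x in M. norm (f x * g x) \<le> norm ((f x)\<^sup>2 + (g x)\<^sup>2)"
    by simp
qed (use assms in \<open>auto simp: sq_int_def\<close>)

lemma sq_int_cmult: "sq_int M f \<Longrightarrow> sq_int M (\<lambda>x. c * f x)"
  by (auto simp: sq_int_def power_mult_distrib)

lemma sq_int_add:
  assumes "sq_int M f" "sq_int M g"
  shows "sq_int M (\<lambda>x. f x + g x)"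
  using sq_int_mult[OF assms] assms
  by (auto simp: sq_int_def power2_sum mult.assoc)

lemma sq_int_diff:
  assumes "sq_int M f" "sq_int M g"
  shows "sq_int M (\<lambda>x. f x - g x)"
  using sq_int_add[OF assms(1) sq_int_cmult[OF assms(2), of "-1"]] by simp

lemma sq_int_AE_cong:
  assumes "sq_int M f" "g \<in> borel_measurable M" "AE x in M. f x = g x"
  shows "sq_int M g"
proof -
  have "integrable M (\<lambda>x. (g x)\<^sup>2)"
    by (rule integrable_cong_AE_imp[OF sq_intD(2)[OF assms(1)]]) (use assms in auto)
  then show ?thesis using assms by (simp add: sq_int_def)
qed

lemma sq_int_finite_measure:
  assumes "finite_measure M" "f \<in> borel_measurable M" "\<And>x. x \<in> space M \<Longrightarrow> \<bar>f x\<bar> \<le> B"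
  shows "sq_int M f"
proof -
  interpret finite_measure M by fact
  have "integrable M (\<lambda>x. (f x)\<^sup>2)"
  proof (rule integrable_const_bound[where B = "B\<^sup>2"])
    have "(f x)\<^sup>2 \<le> B\<^sup>2" if "x \<in> space M" for x
      using power_mono[OF assms(3)[OF that], of 2] by simp
    then show "AE x in M. norm ((f x)\<^sup>2) \<le> B\<^sup>2" by simp
  qed (use assms in simp)
  then show ?thesis using assms by (simp add: sq_int_def)
qed

lemma Cauchy_Schwarz_integral:
  assumes "sq_int M f" "sq_int M g"
  shows "(\<integral>x. f x * g x \<partial>M)\<^sup>2 \<le> (\<integral>x. (f x)\<^sup>2 \<partial>M) * (\<integral>x. (g x)\<^sup>2 \<partial>M)"
proof -
  let ?A = "\<integral>x. (f x)\<^sup>2 \<partial>M" and ?B = "\<integral>x. f x * g x \<partial>M" and ?C = "\<integral>x. (g x)\<^sup>2 \<partial>M"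
  have q: "0 \<le> ?A - 2 * l * ?B + l\<^sup>2 * ?C" for l
  proof -
    have "0 \<le> (\<integral>x. (f x - l * g x)\<^sup>2 \<partial>M)" by simp
    also have "\<dots> = (\<integral>x. (f x)\<^sup>2 - 2 * l * (f x * g x) + l\<^sup>2 * (g x)\<^sup>2 \<partial>M)"
      by (simp add: power2_diff power_mult_distrib algebra_simps)
    also have "\<dots> = ?A - 2 * l * ?B + l\<^sup>2 * ?C"
      using sq_int_mult[OF assms] assms[THEN sq_intD(2)] by simp
    finally show ?thesis .
  qed
  show ?thesis
  proof (cases "?C = 0")
    case True
    have "?B = 0"
    proof (rule ccontr)
      assume "?B \<noteq> 0"
      then show False using q[of "(?A + 1) / (2 * ?B)"] True by simp
    qed
    then show ?thesis using True by simp
  next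
    case False
    then have C: "?C > 0" by (simp add: less_le)
    have "0 \<le> ?A - 2 * (?B / ?C) * ?B + (?B / ?C)\<^sup>2 * ?C" by (rule q)
    also have "\<dots> = ?A - ?B\<^sup>2 / ?C" using C by (simp add: field_simps power2_eq_square)
    finally show ?thesis using C by (simp add: field_simps)
  qed
qed

lemma Cauchy_Schwarz_sqrt:
  assumes "sq_int M f" "sq_int M g"
  shows "\<bar>\<integral>x. f x * g x \<partial>M\<bar> \<le> sqrt (\<integral>x. (f x)\<^sup>2 \<partial>M) * sqrt (\<integral>x. (g x)\<^sup>2 \<partial>M)"
  using Cauchy_Schwarz_integral[OF assms]
  by (metis real_sqrt_abs real_sqrt_le_iff real_sqrt_mult)

lemma Minkowski_integral:
  assumes "sq_int M f" "sq_int M g"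
  shows "sqrt (\<integral>x. (f x + g x)\<^sup>2 \<partial>M) \<le> sqrt (\<integral>x. (f x)\<^sup>2 \<partial>M) + sqrt (\<integral>x. (g x)\<^sup>2 \<partial>M)"
proof (rule real_le_lsqrt)
  have "(\<integral>x. (f x + g x)\<^sup>2 \<partial>M) = (\<integral>x. (f x)\<^sup>2 + 2 * (f x * g x) + (g x)\<^sup>2 \<partial>M)"
    by (simp add: power2_sum algebra_simps)
  also have "\<dots> = (\<integral>x. (f x)\<^sup>2 \<partial>M) + 2 * (\<integral>x. f x * g x \<partial>M) + (\<integral>x. (g x)\<^sup>2 \<partial>M)"
    using sq_int_mult[OF assms] assms[THEN sq_intD(2)] by simp
  finally show "(\<integral>x. (f x + g x)\<^sup>2 \<partial>M) \<le> (sqrt (\<integral>x. (f x)\<^sup>2 \<partial>M) + sqrt (\<integral>x. (g x)\<^sup>2 \<partial>M))\<^sup>2"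
    using Cauchy_Schwarz_sqrt[OF assms] by (simp add: power2_sum)
qed simp

section \<open>Borel representatives\<close>

text \<open>
  \<open>f'\<close> is Borel measurable on the whole space, vanishes outside \<open>S\<close> and agrees with \<open>f\<close> almost everywhere in
  \<open>S\<close>. Integrals over \<open>S\<close> become integrals over the whole space, and slices of a Borel representative are
  measurable without exception, so that Fubini's theorem for \<open>lborel\<close> applies.
\<close>

definition borel_rep :: "'a::euclidean_space set \<Rightarrow> ('a \<Rightarrow> real) \<Rightarrow> ('a \<Rightarrow> real) \<Rightarrow> bool" where
  "borel_rep S f f' \<longleftrightarrow> f' \<in> borel_measurable borel \<and> (\<forall>x. x \<notin> S \<longrightarrow> f' x = 0) \<and>
     (AE x in lebesgue_on S. f x = f' x)"

lemma borel_repD: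
  assumes "borel_rep S f f'"
  shows "f' \<in> borel_measurable borel" "\<And>x. x \<notin> S \<Longrightarrow> f' x = 0" "AE x in lebesgue_on S. f x = f' x"
  using assms by (auto simp: borel_rep_def)

lemma AE_lebesgue_on_iff:
  assumes "S \<in> sets borel"
  shows "(AE x in lebesgue_on S. P x) \<longleftrightarrow> (AE x in lborel. x \<in> S \<longrightarrow> P x)"
  using assms by (simp add: AE_restrict_space_iff AE_completion_iff)

lemma ex_borel_rep:
  assumes S: "S \<in> sets borel" and f: "f \<in> borel_measurable (lebesgue_on S)"
  shows "\<exists>f'. borel_rep S f f'"
proof -
  have "(\<lambda>x. if x \<in> S then f x else 0) \<in> borel_measurable lebesgue"
    by (rule borel_measurable_if_I) (use f S in auto)
  then obtain g where g: "g \<in> borel_measurable lborel" "AE x in lborel. (if x \<in> S then f x else 0) = g x"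
    using completion_ex_borel_measurable_real[of "\<lambda>x. if x \<in> S then f x else 0" lborel] by blast
  have "borel_rep S f (\<lambda>x. indicator S x * g x)"
    unfolding borel_rep_def AE_lebesgue_on_iff[OF S]
    using g S by auto
  then show ?thesis by blast
qed

lemma borel_measurable_lebesgue_on_AE:
  fixes f g :: "'a::euclidean_space \<Rightarrow> real"
  assumes S: "S \<in> sets borel" and f: "f \<in> borel_measurable (lebesgue_on S)"
    and "AE x in lebesgue_on S. f x = g x"
  shows "g \<in> borel_measurable (lebesgue_on S)"
proof -
  have "(\<lambda>x. if x \<in> S then f x else 0) \<in> borel_measurable lebesgue"
    by (rule borel_measurable_if_I) (use f S in auto)
  moreover have "AE x in lebesgue. (if x \<in> S then f x else 0) = (if x \<in> S then g x else 0)"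
    using assms(3) S by (simp add: AE_restrict_space_iff if_distrib cong: if_cong)
  ultimately have "(\<lambda>x. if x \<in> S then g x else 0) \<in> borel_measurable lebesgue"
    by (rule borel_measurable_AE)
  then show ?thesis
    by (rule borel_measurable_if_D)
qed

lemma borel_measurable_imp_lebesgue_on:
  "f \<in> borel_measurable borel \<Longrightarrow> f \<in> borel_measurable (lebesgue_on S)"
  by (simp add: measurable_completion measurable_restrict_space1)

lemma borel_rep_measurable:
  assumes S: "S \<in> sets borel" and r: "borel_rep S f f'"
  shows "f \<in> borel_measurable (lebesgue_on S)"
  by (rule borel_measurable_lebesgue_on_AE[OF S borel_measurable_imp_lebesgue_on[OF borel_repD(1)[OF r]]])
    (use borel_repD(3)[OF r] in \<open>auto elim: eventually_mono\<close>)

lemma lebesgue_on_transfer: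
  fixes f' :: "'a::euclidean_space \<Rightarrow> real"
  assumes S: "S \<in> sets borel" and f': "f' \<in> borel_measurable borel" and z: "\<And>x. x \<notin> S \<Longrightarrow> f' x = 0"
  shows "integrable (lebesgue_on S) f' \<longleftrightarrow> integrable lborel f'"
    and "(\<integral>x. f' x \<partial>lebesgue_on S) = (\<integral>x. f' x \<partial>lborel)"
proof -
  have eq: "(\<lambda>x. indicator S x *\<^sub>R f' x) = f'" using z by (auto simp: fun_eq_iff indicator_def)
  have S': "S \<inter> space lebesgue \<in> sets lebesgue" using S by simp
  show "integrable (lebesgue_on S) f' \<longleftrightarrow> integrable lborel f'"
    using integrable_restrict_space[OF S', of f'] f' unfolding eq by (simp add: integrable_completion)
  show "(\<integral>x. f' x \<partial>lebesgue_on S) = (\<integral>x. f' x \<partial>lborel)"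
    using integral_restrict_space[OF S', of f'] f' unfolding eq by (simp add: integral_completion)
qed

lemma borel_rep_integral:
  assumes S: "S \<in> sets borel" and r: "borel_rep S f f'"
  shows "integrable (lebesgue_on S) f \<longleftrightarrow> integrable lborel f'"
    and "(\<integral>x. f x \<partial>lebesgue_on S) = (\<integral>x. f' x \<partial>lborel)"
proof -
  note m = borel_rep_measurable[OF S r] borel_measurable_imp_lebesgue_on[OF borel_repD(1)[OF r], of S]
  note t = lebesgue_on_transfer[OF S borel_repD(1,2)[OF r], simplified]
  show "integrable (lebesgue_on S) f \<longleftrightarrow> integrable lborel f'"
    using integrable_cong_AE[OF m borel_repD(3)[OF r]] t(1) by simp
  show "(\<integral>x. f x \<partial>lebesgue_on S) = (\<integral>x. f' x \<partial>lborel)"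
    using integral_cong_AE[OF m borel_repD(3)[OF r]] t(2) by simp
qed

lemma borel_rep_comp2:
  assumes "borel_rep S f f'" "borel_rep S g g'" "F \<in> borel_measurable (borel \<Otimes>\<^sub>M borel)" "F (0, 0) = 0"
  shows "borel_rep S (\<lambda>x. F (f x, g x)) (\<lambda>x. F (f' x, g' x))"
  unfolding borel_rep_def
proof (intro conjI allI impI)
  have "(\<lambda>x. (f' x, g' x)) \<in> borel \<rightarrow>\<^sub>M borel \<Otimes>\<^sub>M borel"
    using borel_repD(1)[OF assms(1)] borel_repD(1)[OF assms(2)] by measurable
  from measurable_compose[OF this assms(3)]
  show "(\<lambda>x. F (f' x, g' x)) \<in> borel_measurable borel" .
  show "AE x in lebesgue_on S. F (f x, g x) = F (f' x, g' x)"
    using borel_repD(3)[OF assms(1)] borel_repD(3)[OF assms(2)] by (auto elim: eventually_elim2)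
qed (use assms in \<open>auto simp: borel_rep_def\<close>)

lemma borel_rep_mult:
  "borel_rep S f f' \<Longrightarrow> borel_rep S g g' \<Longrightarrow> borel_rep S (\<lambda>x. f x * g x) (\<lambda>x. f' x * g' x)"
  using borel_rep_comp2[of S f f' g g' "\<lambda>(a, b). a * b"] by simp

lemma borel_rep_power2:
  "borel_rep S f f' \<Longrightarrow> borel_rep S (\<lambda>x. (f x)\<^sup>2) (\<lambda>x. (f' x)\<^sup>2)"
  using borel_rep_mult[of S f f' f f'] by (simp add: power2_eq_square)

lemma borel_rep_mult_fun:
  assumes "borel_rep S f f'" "\<phi> \<in> borel_measurable borel"
  shows "borel_rep S (\<lambda>x. f x * \<phi> x) (\<lambda>x. f' x * \<phi> x)"
  using assms by (auto simp: borel_rep_def elim: eventually_mono)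

lemma borel_rep_sq_int:
  assumes S: "S \<in> sets borel" and r: "borel_rep S f f'"
  shows "sq_int (lebesgue_on S) f \<longleftrightarrow> sq_int lborel f'"
  using borel_rep_measurable[OF S r] borel_repD(1)[OF r] borel_rep_integral(1)[OF S borel_rep_power2[OF r]]
  by (simp add: sq_int_def)

lemma borel_rep_indicator:
  "S \<in> sets borel \<Longrightarrow> f \<in> borel_measurable borel \<Longrightarrow> borel_rep S f (\<lambda>x. indicator S x * f x)"
  by (auto simp: borel_rep_def AE_lebesgue_on_iff indicator_def)

section \<open>Slices of the parabolic cylinder\<close>

lemma Q_borel [measurable, simp]: "Q T \<in> sets borel"
  unfolding Q_def by (intro borel_open open_Times) auto

lemma AE_Q_slices:
  assumes "AE z in lebesgue_on (Q T). P z"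
  shows "AE t in lebesgue_on {0<..<T}. AE x in lebesgue_on {0<..<pi}. P (t, x)"
    and "AE x in lebesgue_on {0<..<pi}. AE t in lebesgue_on {0<..<T}. P (t, x)"
proof -
  have *: "AE z in lborel \<Otimes>\<^sub>M lborel. z \<in> Q T \<longrightarrow> P z"
    using assms unfolding lborel_prod by (simp add: AE_lebesgue_on_iff)
  from lborel_pair.AE_pair[OF this]
  show "AE t in lebesgue_on {0<..<T}. AE x in lebesgue_on {0<..<pi}. P (t, x)"
    by (simp add: AE_lebesgue_on_iff Q_def) (auto elim!: eventually_mono)
  obtain N where N: "N \<in> null_sets (lborel \<Otimes>\<^sub>M lborel)" "{z. \<not> (z \<in> Q T \<longrightarrow> P z)} \<subseteq> N"
    using * by (auto simp: eventually_ae_filter space_pair_measure)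
  have NP: "P (t, x)" if "(t, x) \<notin> N" "(t, x) \<in> Q T" for t x
    using N(2) that by blast
  have "AE z in lborel \<Otimes>\<^sub>M lborel. z \<notin> N" using N(1) by (rule AE_not_in)
  then have "AE t in lborel. AE x in lborel. (t, x) \<notin> N" by (rule lborel_pair.AE_pair)
  moreover have "{z \<in> space (lborel \<Otimes>\<^sub>M lborel). (fst z, snd z) \<notin> N} \<in> sets (lborel \<Otimes>\<^sub>M lborel)"
  proof -
    have "{z \<in> space (lborel \<Otimes>\<^sub>M lborel). (fst z, snd z) \<notin> N} = space (lborel \<Otimes>\<^sub>M lborel) - N"
      by auto
    then show ?thesis using sets.compl_sets[OF null_setsD2[OF N(1)]] by argo
  qed
  ultimately have "AE x in lborel. AE t in lborel. (t, x) \<notin> N"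
    by (rule lborel_pair.AE_commute[THEN iffD1, rotated])
  then show "AE x in lebesgue_on {0<..<pi}. AE t in lebesgue_on {0<..<T}. P (t, x)"
    by (simp add: AE_lebesgue_on_iff) (auto elim!: eventually_mono intro!: NP simp: Q_def)
qed

lemma borel_rep_slices:
  assumes "borel_rep (Q T) f f'"
  shows "AE t in lebesgue_on {0<..<T}. borel_rep {0<..<pi} (\<lambda>x. f (t, x)) (\<lambda>x. f' (t, x))"
    and "AE x in lebesgue_on {0<..<pi}. borel_rep {0<..<T} (\<lambda>t. f (t, x)) (\<lambda>t. f' (t, x))"
proof -
  have [measurable]: "f' \<in> borel_measurable (borel \<Otimes>\<^sub>M borel)"
    using borel_repD(1)[OF assms] by (simp add: borel_prod)
  show "AE t in lebesgue_on {0<..<T}. borel_rep {0<..<pi} (\<lambda>x. f (t, x)) (\<lambda>x. f' (t, x))"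
    using AE_Q_slices(1)[OF borel_repD(3)[OF assms]]
    by (rule eventually_mono) (use borel_repD(2)[OF assms] in \<open>auto simp: borel_rep_def Q_def\<close>)
  show "AE x in lebesgue_on {0<..<pi}. borel_rep {0<..<T} (\<lambda>t. f (t, x)) (\<lambda>t. f' (t, x))"
    using AE_Q_slices(2)[OF borel_repD(3)[OF assms]]
    by (rule eventually_mono) (use borel_repD(2)[OF assms] in \<open>auto simp: borel_rep_def Q_def\<close>)
qed

text \<open>
  The converse of \<open>AE_Q_slices\<close> needs a measurable exceptional set and is therefore stated for the equality of two
  measurable functions.
\<close>

lemma AE_Q_eqI:
  fixes f g :: "real \<times> real \<Rightarrow> real"
  assumes f: "f \<in> borel_measurable (lebesgue_on (Q T))" and g: "g \<in> borel_measurable (lebesgue_on (Q T))"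
    and "(AE t in lebesgue_on {0<..<T}. AE x in lebesgue_on {0<..<pi}. f (t, x) = g (t, x)) \<or>
         (AE x in lebesgue_on {0<..<pi}. AE t in lebesgue_on {0<..<T}. f (t, x) = g (t, x))"
  shows "AE z in lebesgue_on (Q T). f z = g z"
proof -
  obtain f' where r1: "borel_rep (Q T) f f'"
    using ex_borel_rep[OF Q_borel f] by (elim exE)
  obtain g' where r2: "borel_rep (Q T) g g'"
    using ex_borel_rep[OF Q_borel g] by (elim exE)
  note r = r1 r2
  have [measurable]: "f' \<in> borel_measurable (borel \<Otimes>\<^sub>M borel)" "g' \<in> borel_measurable (borel \<Otimes>\<^sub>M borel)"
    using r[THEN borel_repD(1)] by (simp_all add: borel_prod)
  have S: "{z \<in> space (lborel \<Otimes>\<^sub>M lborel). f' (fst z, snd z) = g' (fst z, snd z)} \<in> sets (lborel \<Otimes>\<^sub>M lborel)"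
    by measurable
  have z: "f' (t, x) = 0" "g' (t, x) = 0" if "t \<notin> {0<..<T} \<or> x \<notin> {0<..<pi}" for t x
    using that r[THEN borel_repD(2), of "(t, x)"] by (auto simp: Q_def)
  have "AE t in lborel. AE x in lborel. f' (t, x) = g' (t, x)"
    using assms(3)
  proof
    assume "AE t in lebesgue_on {0<..<T}. AE x in lebesgue_on {0<..<pi}. f (t, x) = g (t, x)"
    with borel_rep_slices(1)[OF r(1)] borel_rep_slices(1)[OF r(2)]
    have "AE t in lebesgue_on {0<..<T}. AE x in lebesgue_on {0<..<pi}. f' (t, x) = g' (t, x)"
      by eventually_elim (auto simp: borel_rep_def elim: eventually_elim2)
    then have "AE t in lborel. t \<in> {0<..<T} \<longrightarrow> (AE x in lborel. x \<in> {0<..<pi} \<longrightarrow> f' (t, x) = g' (t, x))"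
      by (simp add: AE_lebesgue_on_iff)
    then show ?thesis
    proof eventually_elim
      case (elim t)
      have "AE x in lborel. t \<in> {0<..<T} \<and> x \<in> {0<..<pi} \<longrightarrow> f' (t, x) = g' (t, x)"
        using elim by (cases "t \<in> {0<..<T}") auto
      then show ?case by eventually_elim (use z in metis)
    qed
  next
    assume "AE x in lebesgue_on {0<..<pi}. AE t in lebesgue_on {0<..<T}. f (t, x) = g (t, x)"
    with borel_rep_slices(2)[OF r(1)] borel_rep_slices(2)[OF r(2)]
    have "AE x in lebesgue_on {0<..<pi}. AE t in lebesgue_on {0<..<T}. f' (t, x) = g' (t, x)"
      by eventually_elim (auto simp: borel_rep_def elim: eventually_elim2)
    then have "AE x in lborel. x \<in> {0<..<pi} \<longrightarrow> (AE t in lborel. t \<in> {0<..<T} \<longrightarrow> f' (t, x) = g' (t, x))"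
      by (simp add: AE_lebesgue_on_iff)
    then have "AE x in lborel. AE t in lborel. f' (t, x) = g' (t, x)"
    proof eventually_elim
      case (elim x)
      have "AE t in lborel. t \<in> {0<..<T} \<and> x \<in> {0<..<pi} \<longrightarrow> f' (t, x) = g' (t, x)"
        using elim by (cases "x \<in> {0<..<pi}") auto
      then show ?case by eventually_elim (use z in metis)
    qed
    then show ?thesis
      by (rule lborel_pair.AE_commute[OF S, THEN iffD2])
  qed
  then have "AE z in lborel. f' z = g' z"
    using lborel_pair.AE_pair_iff[OF S] unfolding lborel_prod by simp
  then have "AE z in lebesgue_on (Q T). f' z = g' z"
    unfolding AE_lebesgue_on_iff[OF Q_borel] by eventually_elim simp
  with r[THEN borel_repD(3)] show ?thesis by eventually_elim simp
qed

lemma sq_int_slices: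
  fixes f :: "real \<times> real \<Rightarrow> real"
  assumes "sq_int lborel f"
  shows "AE t in lborel. sq_int lborel (\<lambda>x. f (t, x))" "AE x in lborel. sq_int lborel (\<lambda>t. f (t, x))"
proof -
  have [measurable]: "f \<in> borel_measurable (borel \<Otimes>\<^sub>M borel)"
    using sq_intD(1)[OF assms] by (simp add: borel_prod)
  have i: "integrable (lborel \<Otimes>\<^sub>M lborel) (\<lambda>(t, x). (f (t, x))\<^sup>2)"
    using sq_intD(2)[OF assms] unfolding lborel_prod by (simp add: case_prod_beta')
  show "AE t in lborel. sq_int lborel (\<lambda>x. f (t, x))"
    using lborel_pair.AE_integrable_fst[OF i] by (simp add: sq_int_def)
  show "AE x in lborel. sq_int lborel (\<lambda>t. f (t, x))"
    using lborel_pair.AE_integrable_snd[OF i] by (simp add: sq_int_def)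
qed

section \<open>Continuity of translations\<close>

lemma integral_translation:
  fixes f :: "'a::euclidean_space \<Rightarrow> real"
  assumes "f \<in> borel_measurable borel"
  shows "(\<integral>z. f (z - c) \<partial>lborel) = (\<integral>z. f z \<partial>lborel)"
    and "integrable lborel (\<lambda>z. f (z - c)) \<longleftrightarrow> integrable lborel f"
proof -
  have m: "(+) (- c) \<in> borel_measurable lborel" by simp
  have e: "f ((+) (- c) z) = f (z - c)" for z by (simp add: add.commute)
  show "(\<integral>z. f (z - c) \<partial>lborel) = (\<integral>z. f z \<partial>lborel)"
    using integral_distr[of "(+) (- c)" lborel borel f] assms by (simp add: lborel_distr_plus e)
  show "integrable lborel (\<lambda>z. f (z - c)) \<longleftrightarrow> integrable lborel f"
    using integrable_distr_eq[of "(+) (- c)" lborel borel f] assms by (simp add: lborel_distr_plus e)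
qed

lemma sq_int_translation:
  fixes f :: "'a::euclidean_space \<Rightarrow> real"
  assumes "sq_int lborel f"
  shows "sq_int lborel (\<lambda>z. f (z - c))"
proof -
  have [measurable]: "f \<in> borel_measurable borel" using sq_intD(1)[OF assms] by simp
  have "(\<lambda>z. (f z)\<^sup>2) \<in> borel_measurable borel" by measurable
  then show ?thesis
    using integral_translation(2)[of "\<lambda>z. (f z)\<^sup>2" c] sq_intD(2)[OF assms] by (simp add: sq_int_def)
qed

text \<open>
  For a compact set the positive part of the difference of the indicators tends to zero pointwise, and
  the difference has integral zero.
\<close>

lemma translation_tendsto_compact:
  fixes K :: "'a::euclidean_space set"
  assumes K: "compact K" and c: "c \<longlonglongrightarrow> 0"
  shows "(\<lambda>n. \<integral>z. \<bar>indicat_real K (z - c n) - indicat_real K z\<bar> \<partial>lborel) \<longlonglongrightarrow> 0"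
proof -
  have [measurable]: "K \<in> sets borel" using K by (simp add: borel_compact)
  have iK: "integrable lborel (indicat_real K)"
    using emeasure_bounded_finite[OF compact_imp_bounded[OF K]] by (simp add: less_top)
  have iKc: "integrable lborel (\<lambda>z. indicat_real K (z - a))" for a
    using integral_translation(2)[of "indicat_real K"] iK by simp
  obtain B where B: "\<And>n. norm (c n) \<le> B"
    using c convergent_imp_Bseq[of c] by (auto simp: convergent_def Bseq_def)
  let ?L = "(\<Union>x\<in>K. cball x B)"
  have L: "?L = (\<Union>x\<in>K. \<Union>y\<in>cball 0 B. {x + y})"
  proof (intro set_eqI iffI)
    fix z assume "z \<in> ?L"
    then obtain x where "x \<in> K" "norm (z - x) \<le> B" by (auto simp: dist_norm norm_minus_commute)
    then show "z \<in> (\<Union>x\<in>K. \<Union>y\<in>cball 0 B. {x + y})"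
      by (intro UN_I[of x] UN_I[of "z - x"]) auto
  qed (force simp: dist_norm)
  have cL: "compact (\<Union>x\<in>K. \<Union>y\<in>cball 0 B. {x + y})"
    using compact_sums'[OF K compact_cball[of 0 B]] by simp
  define p where "p n z = max 0 (indicat_real K (z - c n) - indicat_real K z)" for n z
  have "(\<lambda>n. \<integral>z. p n z \<partial>lborel) \<longlonglongrightarrow> (\<integral>z. 0 \<partial>(lborel :: 'a measure))"
  proof (rule integral_dominated_convergence)
    show "integrable lborel (indicat_real ?L)"
      using emeasure_bounded_finite[OF compact_imp_bounded[OF cL]] cL
      by (simp add: L less_top borel_compact)
    show "AE z in lborel. (\<lambda>n. p n z) \<longlonglongrightarrow> 0"
    proof (rule AE_I2)
      fix z :: 'a
      show "(\<lambda>n. p n z) \<longlonglongrightarrow> 0"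
      proof (cases "z \<in> K")
        case True
        then show ?thesis by (simp add: p_def indicator_def)
      next
        case False
        have "(\<lambda>n. z - c n) \<longlonglongrightarrow> z - 0" using c by (intro tendsto_intros)
        then have "eventually (\<lambda>n. z - c n \<in> - K) sequentially"
          using False compact_imp_closed[OF K] by (intro topological_tendstoD) auto
        then show ?thesis
          by (intro tendsto_eventually) (auto elim!: eventually_mono simp: p_def)
      qed
    qed
    show "AE z in lborel. norm (p n z) \<le> indicat_real ?L z" for n
    proof (rule AE_I2)
      fix z
      have "z \<in> ?L" if "z - c n \<in> K"
        using that B[of n] by (intro UN_I[of "z - c n"]) (auto simp: dist_norm norm_minus_commute)
      then show "norm (p n z) \<le> indicat_real ?L z"
        by (auto simp: p_def indicator_def)
    qed
  qed (simp_all add: p_def)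
  moreover have "(\<integral>z. \<bar>indicat_real K (z - c n) - indicat_real K z\<bar> \<partial>lborel) = 2 * (\<integral>z. p n z \<partial>lborel)" for n
  proof -
    have ip: "integrable lborel (p n)"
      unfolding p_def using iK iKc by (intro integrable_max) auto
    have "(\<integral>z. \<bar>indicat_real K (z - c n) - indicat_real K z\<bar> \<partial>lborel)
        = (\<integral>z. 2 * p n z - (indicat_real K (z - c n) - indicat_real K z) \<partial>lborel)"
      by (intro Bochner_Integration.integral_cong) (auto simp: p_def indicator_def)
    also have "\<dots> = 2 * (\<integral>z. p n z \<partial>lborel) - ((\<integral>z. indicat_real K (z - c n) \<partial>lborel) - (\<integral>z. indicat_real K z \<partial>lborel))"
      using ip iK iKc by simp
    also have "\<dots> = 2 * (\<integral>z. p n z \<partial>lborel)"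
      using integral_translation(1)[of "indicat_real K" "c n"] by simp
    finally show ?thesis .
  qed
  ultimately show ?thesis
    using tendsto_mult_right_zero[of "\<lambda>n. \<integral>z. p n z \<partial>lborel" sequentially 2] by simp
qed

text \<open>The set of functions with continuous translations is closed in \<open>L\<^sup>1\<close>.\<close>

lemma translation_tendsto_approx:
  fixes f :: "'a::euclidean_space \<Rightarrow> real"
  assumes f: "integrable lborel f"
    and approx: "\<And>e. e > 0 \<Longrightarrow> \<exists>g. integrable lborel g \<and> (\<integral>z. \<bar>f z - g z\<bar> \<partial>lborel) < e \<and>
                   (\<lambda>n. \<integral>z. \<bar>g (z - c n) - g z\<bar> \<partial>lborel) \<longlonglongrightarrow> 0"
  shows "(\<lambda>n. \<integral>z. \<bar>f (z - c n) - f z\<bar> \<partial>lborel) \<longlonglongrightarrow> 0"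
proof (rule LIMSEQ_I)
  fix r :: real assume "0 < r"
  then obtain g where g: "integrable lborel g" "(\<integral>z. \<bar>f z - g z\<bar> \<partial>lborel) < r / 3"
    and lim: "(\<lambda>n. \<integral>z. \<bar>g (z - c n) - g z\<bar> \<partial>lborel) \<longlonglongrightarrow> 0"
    using approx[of "r / 3"] by auto
  have [measurable]: "f \<in> borel_measurable borel" "g \<in> borel_measurable borel"
    using f g(1) by auto
  obtain N where N: "\<And>n. n \<ge> N \<Longrightarrow> norm ((\<integral>z. \<bar>g (z - c n) - g z\<bar> \<partial>lborel) - 0) < r / 3"
    using LIMSEQ_D[OF lim, of "r / 3"] \<open>0 < r\<close> by auto
  have ts: "integrable lborel (\<lambda>z. f (z - a))" "integrable lborel (\<lambda>z. g (z - a))" for a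
    using integral_translation(2)[of f a] integral_translation(2)[of g a] f g(1) by simp_all
  have "(\<integral>z. \<bar>f (z - c n) - f z\<bar> \<partial>lborel) < r" if "n \<ge> N" for n
  proof -
    have "(\<integral>z. \<bar>f (z - c n) - f z\<bar> \<partial>lborel)
        \<le> (\<integral>z. \<bar>f (z - c n) - g (z - c n)\<bar> + \<bar>g (z - c n) - g z\<bar> + \<bar>f z - g z\<bar> \<partial>lborel)"
      using f g(1) ts by (intro integral_mono) auto
    also have "\<dots> = (\<integral>z. \<bar>f (z - c n) - g (z - c n)\<bar> \<partial>lborel) + (\<integral>z. \<bar>g (z - c n) - g z\<bar> \<partial>lborel)
        + (\<integral>z. \<bar>f z - g z\<bar> \<partial>lborel)"
      using f g(1) ts by simp
    also have "(\<integral>z. \<bar>f (z - c n) - g (z - c n)\<bar> \<partial>lborel) = (\<integral>z. \<bar>f z - g z\<bar> \<partial>lborel)"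
      using integral_translation(1)[of "\<lambda>z. \<bar>f z - g z\<bar>" "c n"] by simp
    finally show ?thesis using N[OF that] g(2) by simp
  qed
  then show "\<exists>N. \<forall>n\<ge>N. norm ((\<integral>z. \<bar>f (z - c n) - f z\<bar> \<partial>lborel) - 0) < r"
    by auto
qed

text \<open>
  By integrable induction it suffices to treat indicator functions, and by inner regularity those of compact sets.
\<close>

lemma translation_tendsto_L1:
  fixes f :: "'a::euclidean_space \<Rightarrow> real"
  assumes f: "integrable lborel f" and c: "c \<longlonglongrightarrow> 0"
  shows "(\<lambda>n. \<integral>z. \<bar>f (z - c n) - f z\<bar> \<partial>lborel) \<longlonglongrightarrow> 0"
  using f
proof (induction rule: integrable_induct)
  case (base A b)
  have A: "A \<in> sets borel" "emeasure lborel A < \<infinity>" using base by auto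
  have "(\<lambda>n. \<integral>z. \<bar>indicat_real A (z - c n) - indicat_real A z\<bar> \<partial>lborel) \<longlonglongrightarrow> 0"
  proof (rule translation_tendsto_approx)
    show "integrable lborel (indicat_real A)" using A by simp
    fix e :: real assume "e > 0"
    obtain S where S: "closed S" "S \<subseteq> A" "A - S \<in> lmeasurable" "emeasure lebesgue (A - S) < ennreal (e / 2)"
      using sets_lebesgue_inner_closed[of A "e / 2"] A \<open>e > 0\<close> by auto
    have S': "S \<in> sets borel" using S(1) by simp
    have iS: "integrable lborel (indicat_real S)"
      using emeasure_mono[OF S(2), of lborel] A S' by (auto simp: le_less_trans)
    have "emeasure lborel (A - S) < ennreal (e / 2)"
      using S(4) A(1) S' by simp
    moreover from this have "emeasure lborel (A - S) \<noteq> top" by auto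
    ultimately have mAS: "measure lborel (A - S) < e / 2"
      by (simp add: emeasure_eq_ennreal_measure ennreal_less_iff)
    have lim: "(\<lambda>n. \<integral>z. indicat_real (S \<inter> cball 0 (real n)) z \<partial>lborel) \<longlonglongrightarrow> (\<integral>z. indicat_real S z \<partial>lborel)"
    proof (rule integral_dominated_convergence[where w = "indicat_real S"])
      show "AE z in lborel. (\<lambda>n. indicat_real (S \<inter> cball 0 (real n)) z) \<longlonglongrightarrow> indicat_real S z"
      proof (rule AE_I2)
        fix z :: 'a
        obtain N where N: "norm z \<le> real N" using real_arch_simple by blast
        have "eventually (\<lambda>n. indicat_real (S \<inter> cball 0 (real n)) z = indicat_real S z) sequentially"
          using eventually_ge_at_top[of N]
          by eventually_elim (use N in \<open>auto simp: indicator_def\<close>)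
        then show "(\<lambda>n. indicat_real (S \<inter> cball 0 (real n)) z) \<longlonglongrightarrow> indicat_real S z"
          by (rule tendsto_eventually)
      qed
    qed (use iS S' in \<open>auto simp: indicator_def\<close>)
    then obtain n where n: "\<bar>(\<integral>z. indicat_real (S \<inter> cball 0 (real n)) z \<partial>lborel) - (\<integral>z. indicat_real S z \<partial>lborel)\<bar> < e / 2"
      using LIMSEQ_D[OF lim, of "e / 2"] \<open>e > 0\<close> by auto
    let ?K = "S \<inter> cball 0 (real n)"
    have cK: "compact ?K" using S(1) by (simp add: closed_Int_compact)
    have iK: "integrable lborel (indicat_real ?K)"
      using emeasure_bounded_finite[OF compact_imp_bounded[OF cK]] cK by (simp add: less_top borel_compact)
    have "(\<integral>z. \<bar>indicat_real A z - indicat_real ?K z\<bar> \<partial>lborel)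
        = (\<integral>z. indicat_real (A - S) z + (indicat_real S z - indicat_real ?K z) \<partial>lborel)"
      using S(2) by (intro Bochner_Integration.integral_cong) (auto simp: indicator_def)
    also have "\<dots> = measure lborel (A - S) + ((\<integral>z. indicat_real S z \<partial>lborel) - (\<integral>z. indicat_real ?K z \<partial>lborel))"
    proof -
      have "integrable lborel (indicat_real (A - S))"
        using emeasure_mono[of "A - S" A lborel] A S' by (auto simp: le_less_trans)
      then show ?thesis using iS iK A(1) S' by simp
    qed
    also have "\<dots> < e" using mAS n by linarith
    finally show "\<exists>g. integrable lborel g \<and> (\<integral>z. \<bar>indicat_real A z - g z\<bar> \<partial>lborel) < e \<and>
        (\<lambda>n. \<integral>z. \<bar>g (z - c n) - g z\<bar> \<partial>lborel) \<longlonglongrightarrow> 0"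
      using iK translation_tendsto_compact[OF cK c] by blast
  qed
  then have l: "(\<lambda>n. \<bar>b\<bar> * (\<integral>z. \<bar>indicat_real A (z - c n) - indicat_real A z\<bar> \<partial>lborel)) \<longlonglongrightarrow> 0"
    by (rule tendsto_mult_right_zero)
  show ?case
  proof -
    have "\<bar>indicat_real A (z - c n) *\<^sub>R b - indicat_real A z *\<^sub>R b\<bar>
        = \<bar>b\<bar> * \<bar>indicat_real A (z - c n) - indicat_real A z\<bar>" for n z
      by (simp add: abs_mult[symmetric] algebra_simps)
    then show ?thesis using l by simp
  qed
next
  case (add f g)
  note [measurable] = borel_measurable_integrable[OF add.hyps(1)] borel_measurable_integrable[OF add.hyps(2)]
  have ts: "integrable lborel (\<lambda>z. f (z - a))" "integrable lborel (\<lambda>z. g (z - a))" for a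
    using integral_translation(2)[of f a] integral_translation(2)[of g a] add.hyps by simp_all
  show ?case
  proof (rule tendsto_sandwich[OF _ _ tendsto_const])
    show "(\<lambda>n. (\<integral>z. \<bar>f (z - c n) - f z\<bar> \<partial>lborel) + (\<integral>z. \<bar>g (z - c n) - g z\<bar> \<partial>lborel)) \<longlonglongrightarrow> 0"
      using tendsto_add[OF add.IH] by simp
    show "\<forall>\<^sub>F n in sequentially. (\<integral>z. \<bar>f (z - c n) + g (z - c n) - (f z + g z)\<bar> \<partial>lborel)
        \<le> (\<integral>z. \<bar>f (z - c n) - f z\<bar> \<partial>lborel) + (\<integral>z. \<bar>g (z - c n) - g z\<bar> \<partial>lborel)"
    proof (rule always_eventually, rule allI)
      fix n
      have "(\<integral>z. \<bar>f (z - c n) + g (z - c n) - (f z + g z)\<bar> \<partial>lborel)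
          \<le> (\<integral>z. \<bar>f (z - c n) - f z\<bar> + \<bar>g (z - c n) - g z\<bar> \<partial>lborel)"
        using add.hyps ts by (intro integral_mono) auto
      then show "(\<integral>z. \<bar>f (z - c n) + g (z - c n) - (f z + g z)\<bar> \<partial>lborel)
        \<le> (\<integral>z. \<bar>f (z - c n) - f z\<bar> \<partial>lborel) + (\<integral>z. \<bar>g (z - c n) - g z\<bar> \<partial>lborel)"
        using add.hyps ts by simp
    qed
  qed simp
next
  case (lim f s)
  show ?case
  proof (rule translation_tendsto_approx[OF lim.hyps(4)])
    fix e :: real assume "e > 0"
    have "(\<lambda>i. \<integral>z. \<bar>f z - s i z\<bar> \<partial>lborel) \<longlonglongrightarrow> (\<integral>z. 0 \<partial>(lborel :: 'a measure))"
    proof (rule integral_dominated_convergence[where w = "\<lambda>z. 3 * norm (f z)"])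
      show "AE z in lborel. (\<lambda>i. \<bar>f z - s i z\<bar>) \<longlonglongrightarrow> 0"
      proof (rule AE_I2)
        fix z :: 'a
        have "(\<lambda>i. f z - s i z) \<longlonglongrightarrow> f z - f z"
          by (intro tendsto_diff tendsto_const lim.hyps(2)) simp
        then show "(\<lambda>i. \<bar>f z - s i z\<bar>) \<longlonglongrightarrow> 0"
          using tendsto_rabs_zero by fastforce
      qed
      show "AE z in lborel. norm \<bar>f z - s i z\<bar> \<le> 3 * norm (f z)" for i
      proof (rule AE_I2)
        fix z
        show "norm \<bar>f z - s i z\<bar> \<le> 3 * norm (f z)"
          using lim.hyps(3)[of z i] by simp
      qed
    qed (use lim.hyps in auto)
    then have "(\<lambda>i. \<integral>z. \<bar>f z - s i z\<bar> \<partial>lborel) \<longlonglongrightarrow> 0" by simp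
    from LIMSEQ_D[OF this \<open>e > 0\<close>] obtain i where "(\<integral>z. \<bar>f z - s i z\<bar> \<partial>lborel) < e"
      by auto
    then show "\<exists>g. integrable lborel g \<and> (\<integral>z. \<bar>f z - g z\<bar> \<partial>lborel) < e \<and>
        (\<lambda>n. \<integral>z. \<bar>g (z - c n) - g z\<bar> \<partial>lborel) \<longlonglongrightarrow> 0"
      using lim.hyps(1) lim.IH by blast
  qed
qed

text \<open>
  Continuity of translations in \<open>L\<^sup>2\<close>, tested against \<open>h\<close>. It is reduced to \<open>L\<^sup>1\<close> by means of the
  sign-preserving square \<open>g \<bar>g\<bar>\<close>.
\<close>

lemma translation_tendsto_L2:
  fixes g h :: "'a::euclidean_space \<Rightarrow> real"
  assumes g: "sq_int lborel g" and h: "sq_int lborel h" and c: "c \<longlonglongrightarrow> 0"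
  shows "(\<lambda>n. \<integral>z. g (z - c n) * h z \<partial>lborel) \<longlonglongrightarrow> (\<integral>z. g z * h z \<partial>lborel)"
proof -
  have [measurable]: "g \<in> borel_measurable borel" "h \<in> borel_measurable borel"
    using g h by (auto simp: sq_int_def)
  define k where "k z = g z * \<bar>g z\<bar>" for z
  have [measurable]: "k \<in> borel_measurable borel" unfolding k_def by measurable
  have k: "integrable lborel k"
  proof (rule Bochner_Integration.integrable_bound[OF sq_intD(2)[OF g]])
    show "AE z in lborel. norm (k z) \<le> norm ((g z)\<^sup>2)"
      by (simp add: k_def abs_mult power2_eq_square)
  qed simp
  have h1: "x \<le> 2 * \<bar>y\<bar>" if "0 \<le> x" "x \<le> y" for x y :: real using that by linarith
  have h2: "x \<le> 2 * \<bar>y\<bar>" if "x \<le> 2 * y" for x y :: real using that by linarith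
  have key: "(a - b)\<^sup>2 \<le> 2 * \<bar>a * \<bar>a\<bar> - b * \<bar>b\<bar>\<bar>" for a b :: real
  proof -
    have "(a - b)\<^sup>2 \<le> 2 * \<bar>a * \<bar>a\<bar> - b * \<bar>b\<bar>\<bar>" if "b \<le> a" for a b :: real
    proof -
      consider "0 \<le> b" | "b \<le> 0" "0 \<le> a" | "a \<le> 0" using that by linarith
      then show ?thesis
      proof cases
        case 1
        have "(a - b)\<^sup>2 \<le> (a - b) * (a + b)" using 1 that by (auto simp: power2_eq_square intro!: mult_left_mono)
        also have "\<dots> = a * \<bar>a\<bar> - b * \<bar>b\<bar>" using 1 that by (simp add: algebra_simps)
        finally show ?thesis by (rule h1[OF zero_le_power2])
      next
        case 2
        have "0 \<le> (a + b)\<^sup>2" by simp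
        then have "(a - b)\<^sup>2 \<le> 2 * (a * \<bar>a\<bar> - b * \<bar>b\<bar>)" using 2 by (simp add: power2_eq_square algebra_simps)
        then show ?thesis by (rule h2)
      next
        case 3
        have "(a - b)\<^sup>2 \<le> (a - b) * (- a - b)" using 3 that by (auto simp: power2_eq_square intro!: mult_left_mono)
        also have "\<dots> = a * \<bar>a\<bar> - b * \<bar>b\<bar>" using 3 that by (simp add: algebra_simps)
        finally show ?thesis by (rule h1[OF zero_le_power2])
      qed
    qed
    from this[of a b] this[of b a] show ?thesis
      by (cases "b \<le> a") (auto simp: power2_commute abs_minus_commute)
  qed
  have keyk: "(g a - g b)\<^sup>2 \<le> 2 * \<bar>k a - k b\<bar>" for a b unfolding k_def by (rule key)
  let ?d = "\<lambda>n z. g (z - c n) - g z"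
  have d: "sq_int lborel (?d n)" for n
    using sq_int_diff[OF sq_int_translation[OF g] g] .
  have ik: "integrable lborel (\<lambda>z. k (z - a))" for a
    using integral_translation(2)[of k] k by auto
  have "(\<lambda>n. \<integral>z. (?d n z)\<^sup>2 \<partial>lborel) \<longlonglongrightarrow> 0"
  proof (rule tendsto_sandwich[OF _ _ tendsto_const])
    show "(\<lambda>n. 2 * (\<integral>z. \<bar>k (z - c n) - k z\<bar> \<partial>lborel)) \<longlonglongrightarrow> 0"
      using tendsto_mult_right_zero[OF translation_tendsto_L1[OF k c]] .
    show "\<forall>\<^sub>F n in sequentially. (\<integral>z. (?d n z)\<^sup>2 \<partial>lborel) \<le> 2 * (\<integral>z. \<bar>k (z - c n) - k z\<bar> \<partial>lborel)"
    proof (rule always_eventually, rule allI)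
      fix n
      have "(\<integral>z. (?d n z)\<^sup>2 \<partial>lborel) \<le> (\<integral>z. 2 * \<bar>k (z - c n) - k z\<bar> \<partial>lborel)"
        using sq_intD(2)[OF d] ik k keyk by (intro integral_mono) auto
      then show "(\<integral>z. (?d n z)\<^sup>2 \<partial>lborel) \<le> 2 * (\<integral>z. \<bar>k (z - c n) - k z\<bar> \<partial>lborel)" by simp
    qed
  qed simp
  then have "(\<lambda>n. sqrt (\<integral>z. (?d n z)\<^sup>2 \<partial>lborel)) \<longlonglongrightarrow> 0"
    using tendsto_real_sqrt by fastforce
  then have l: "(\<lambda>n. sqrt (\<integral>z. (?d n z)\<^sup>2 \<partial>lborel) * sqrt (\<integral>z. (h z)\<^sup>2 \<partial>lborel)) \<longlonglongrightarrow> 0"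
    by (rule tendsto_mult_left_zero)
  have "(\<lambda>n. (\<integral>z. g (z - c n) * h z \<partial>lborel) - (\<integral>z. g z * h z \<partial>lborel)) \<longlonglongrightarrow> 0"
  proof (rule Lim_null_comparison[OF _ l], rule always_eventually, rule allI)
    fix n
    have "(\<integral>z. g (z - c n) * h z \<partial>lborel) - (\<integral>z. g z * h z \<partial>lborel) = (\<integral>z. ?d n z * h z \<partial>lborel)"
      using sq_int_mult[OF sq_int_translation[OF g] h] sq_int_mult[OF g h]
      by (simp add: left_diff_distrib)
    then show "norm ((\<integral>z. g (z - c n) * h z \<partial>lborel) - (\<integral>z. g z * h z \<partial>lborel))
        \<le> sqrt (\<integral>z. (?d n z)\<^sup>2 \<partial>lborel) * sqrt (\<integral>z. (h z)\<^sup>2 \<partial>lborel)"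
      using Cauchy_Schwarz_sqrt[OF d h] by simp
  qed
  then show ?thesis by (rule LIM_zero_cancel)
qed

text \<open>The positive and the negative part of \<open>f\<close> are densities of the same measure.\<close>

lemma AE_zero_if_integral_half_lines_zero:
  fixes f :: "real \<Rightarrow> real"
  assumes f: "integrable lborel f" and z: "\<And>x. (\<integral>t. indicator {x<..} t * f t \<partial>lborel) = 0"
  shows "AE t in lborel. f t = 0"
proof -
  have [measurable]: "f \<in> borel_measurable borel" using f by auto
  define p where "p t = max 0 (f t)" for t
  define m where "m t = max 0 (- f t)" for t
  have [measurable]: "p \<in> borel_measurable borel" "m \<in> borel_measurable borel"
    unfolding p_def m_def by measurable
  have pm: "integrable lborel p" "integrable lborel m"
    unfolding p_def m_def using f by (auto intro!: integrable_max)
  have pm0: "0 \<le> p t" "0 \<le> m t" for t by (simp_all add: p_def m_def)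
  have fpm: "f t = p t - m t" for t by (simp add: p_def m_def)
  have em: "emeasure (density lborel (\<lambda>t. ennreal (q t))) {x<..} = ennreal (\<integral>t. indicator {x<..} t * q t \<partial>lborel)"
    if "integrable lborel q" "\<And>t. 0 \<le> q t" for q :: "real \<Rightarrow> real" and x
  proof -
    have [measurable]: "q \<in> borel_measurable borel" using that by auto
    have i: "integrable lborel (\<lambda>t. indicator {x<..} t * q t)"
      using integrable_mult_indicator[of "{x<..}" lborel q] that by simp
    have "emeasure (density lborel (\<lambda>t. ennreal (q t))) {x<..} = (\<integral>\<^sup>+t. ennreal (indicator {x<..} t * q t) \<partial>lborel)"
      by (subst emeasure_density) (auto intro!: nn_integral_cong simp: indicator_def)
    also have "\<dots> = ennreal (\<integral>t. indicator {x<..} t * q t \<partial>lborel)"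
      using i that by (intro nn_integral_eq_integral) auto
    finally show ?thesis .
  qed
  have eqi: "(\<integral>t. indicator {x<..} t * p t \<partial>lborel) = (\<integral>t. indicator {x<..} t * m t \<partial>lborel)" for x
  proof -
    have "integrable lborel (\<lambda>t. indicator {x<..} t * p t)" "integrable lborel (\<lambda>t. indicator {x<..} t * m t)"
      using integrable_mult_indicator[of "{x<..}" lborel p] integrable_mult_indicator[of "{x<..}" lborel m] pm by auto
    then show ?thesis using z[of x] by (simp add: fpm right_diff_distrib)
  qed
  have "density lborel (\<lambda>t. ennreal (p t)) = density lborel (\<lambda>t. ennreal (m t))"
    by (rule measure_eqI_lessThan) (simp_all add: em pm pm0 eqi)
  then have "AE t in lborel. ennreal (p t) = ennreal (m t)"
    by (rule sigma_finite_measure.density_unique[OF sigma_finite_lborel, rotated 2]) auto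
  then show ?thesis
    by eventually_elim (simp add: fpm, simp add: p_def m_def)
qed

section \<open>Smooth functions and test functions\<close>

text \<open>The derivatives of order at most \<open>n\<close> exist and are differentiable everywhere.\<close>

definition diff_upto :: "nat \<Rightarrow> (real \<Rightarrow> real) \<Rightarrow> bool" where
  "diff_upto n f \<longleftrightarrow> (\<forall>k\<le>n. \<forall>t. (deriv ^^ k) f field_differentiable at t)"

text \<open>The smoothness condition in the definition of \<open>test_fun\<close>.\<close>

definition smooth :: "(real \<Rightarrow> real) \<Rightarrow> bool" where
  "smooth f \<longleftrightarrow> (\<forall>n t. (deriv ^^ n) f field_differentiable at t)"

lemma smooth_iff_diff_upto: "smooth f \<longleftrightarrow> (\<forall>n. diff_upto n f)"
  by (auto simp: smooth_def diff_upto_def)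

lemma diff_upto_0: "diff_upto 0 f \<longleftrightarrow> (\<forall>t. f field_differentiable at t)"
  by (simp add: diff_upto_def)

lemma diff_upto_Suc:
  "diff_upto (Suc n) f \<longleftrightarrow> (\<forall>t. f field_differentiable at t) \<and> diff_upto n (deriv f)"
proof -
  have "(\<forall>k\<le>Suc n. \<forall>t. (deriv ^^ k) f field_differentiable at t) \<longleftrightarrow>
      (\<forall>t. f field_differentiable at t) \<and> (\<forall>k\<le>n. \<forall>t. (deriv ^^ Suc k) f field_differentiable at t)"
    by (metis (no_types, lifting) Suc_le_mono funpow_0 not0_implies_Suc zero_le)
  then show ?thesis by (simp add: diff_upto_def funpow_swap1)
qed

lemma diff_upto_imp_differentiable: "diff_upto n f \<Longrightarrow> f field_differentiable at t"
  by (cases n) (auto simp: diff_upto_0 diff_upto_Suc)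

lemma diff_upto_mono: "diff_upto n f \<Longrightarrow> m \<le> n \<Longrightarrow> diff_upto m f"
  by (auto simp: diff_upto_def)

lemma diff_upto_add: "diff_upto n f \<Longrightarrow> diff_upto n g \<Longrightarrow> diff_upto n (\<lambda>x. f x + g x)"
proof (induction n arbitrary: f g)
  case 0
  then show ?case by (auto simp: diff_upto_0 intro!: field_differentiable_add)
next
  case (Suc n)
  have "deriv (\<lambda>x. f x + g x) = (\<lambda>x. deriv f x + deriv g x)"
    using Suc.prems by (auto simp: diff_upto_Suc)
  with Suc show ?case by (auto simp: diff_upto_Suc intro!: field_differentiable_add)
qed

lemma diff_upto_mult: "diff_upto n f \<Longrightarrow> diff_upto n g \<Longrightarrow> diff_upto n (\<lambda>x. f x * g x)"
proof (induction n arbitrary: f g)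
  case 0
  then show ?case by (auto simp: diff_upto_0 intro!: field_differentiable_mult)
next
  case (Suc n)
  have "deriv (\<lambda>x. f x * g x) = (\<lambda>x. f x * deriv g x + deriv f x * g x)"
    using Suc.prems by (auto simp: diff_upto_Suc)
  moreover have "diff_upto n f" "diff_upto n g"
    using Suc.prems diff_upto_mono by (meson le_SucI order_refl)+
  ultimately show ?case
    using Suc by (auto simp: diff_upto_Suc intro!: field_differentiable_mult diff_upto_add)
qed

lemma diff_upto_const: "diff_upto n (\<lambda>x. c)"
  by (induction n arbitrary: c) (auto simp: diff_upto_0 diff_upto_Suc)

lemma diff_upto_affine: "diff_upto n f \<Longrightarrow> diff_upto n (\<lambda>x. f (a * x + b))"
proof (induction n arbitrary: f)
  case 0
  have "(\<lambda>x. f (a * x + b)) field_differentiable at t" for t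
  proof -
    from 0 obtain D where D: "(f has_field_derivative D) (at (a * t + b))"
      by (auto simp: diff_upto_0 field_differentiable_def)
    have "((\<lambda>x. a * x + b) has_field_derivative a) (at t)"
      by (auto intro!: derivative_eq_intros)
    from DERIV_chain2[OF D this] show ?thesis
      by (auto simp: field_differentiable_def)
  qed
  then show ?case by (simp add: diff_upto_0)
next
  case (Suc n)
  have d: "((\<lambda>x. f (a * x + b)) has_field_derivative deriv f (a * t + b) * a) (at t)" for t
  proof -
    have D: "(f has_field_derivative deriv f (a * t + b)) (at (a * t + b))"
      using Suc.prems by (simp add: diff_upto_Suc field_differentiable_derivI)
    have "((\<lambda>x. a * x + b) has_field_derivative a) (at t)"
      by (auto intro!: derivative_eq_intros)
    from DERIV_chain2[OF D this] show ?thesis .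
  qed
  then have "deriv (\<lambda>x. f (a * x + b)) = (\<lambda>t. deriv f (a * t + b) * a)"
    by (auto intro!: DERIV_imp_deriv)
  moreover have "diff_upto n (\<lambda>t. deriv f (a * t + b) * a)"
    using Suc by (intro diff_upto_mult diff_upto_const Suc.IH) (simp add: diff_upto_Suc)
  ultimately show ?case
    using d by (auto simp: diff_upto_Suc field_differentiable_def)
qed

lemma smooth_add: "smooth f \<Longrightarrow> smooth g \<Longrightarrow> smooth (\<lambda>x. f x + g x)"
  by (simp add: smooth_iff_diff_upto diff_upto_add)

lemma smooth_mult: "smooth f \<Longrightarrow> smooth g \<Longrightarrow> smooth (\<lambda>x. f x * g x)"
  by (simp add: smooth_iff_diff_upto diff_upto_mult)

lemma smooth_const: "smooth (\<lambda>x. c)"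
  by (simp add: smooth_iff_diff_upto diff_upto_const)

lemma smooth_affine: "smooth f \<Longrightarrow> smooth (\<lambda>x. f (a * x + b))"
  by (simp add: smooth_iff_diff_upto diff_upto_affine)

lemma smooth_deriv_iff: "smooth f \<longleftrightarrow> (\<forall>t. f field_differentiable at t) \<and> smooth (deriv f)"
  by (meson diff_upto_Suc diff_upto_imp_differentiable diff_upto_mono le_SucI order_refl smooth_iff_diff_upto)

lemma smooth_has_deriv: "smooth f \<Longrightarrow> (f has_real_derivative deriv f t) (at t)"
  using smooth_deriv_iff[of f] by (auto intro: field_differentiable_derivI)

lemma smooth_continuous: "smooth f \<Longrightarrow> continuous_on S f"
  by (meson DERIV_isCont continuous_at_imp_continuous_on smooth_has_deriv)

text \<open>A class of functions that is closed under differentiation consists of smooth functions.\<close>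

lemma smooth_coinduct:
  assumes "X f" and "\<And>g. X g \<Longrightarrow> \<exists>g'. X g' \<and> (\<forall>t. (g has_real_derivative g' t) (at t))"
  shows "smooth f"
proof -
  have "diff_upto n g" if "X g" for n g
    using that
  proof (induction n arbitrary: g)
    case 0
    then show ?case using assms(2)[of g] by (auto simp: diff_upto_0 field_differentiable_def)
  next
    case (Suc n)
    obtain g' where g': "X g'" "\<And>t. (g has_real_derivative g' t) (at t)"
      using assms(2)[OF Suc.prems] by blast
    then have "deriv g = g'" by (auto intro!: DERIV_imp_deriv)
    with g' Suc.IH[OF g'(1)] show ?case by (auto simp: diff_upto_Suc field_differentiable_def)
  qed
  then show ?thesis using assms(1) by (simp add: smooth_iff_diff_upto)
qed

lemma smooth_cos: "smooth cos"
proof (rule smooth_coinduct[where X = "\<lambda>f. \<exists>a b. f = (\<lambda>x. a * cos x + b * sin x)"])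
  show "\<exists>a b. cos = (\<lambda>x::real. a * cos x + b * sin x)"
    by (intro exI[of _ 1] exI[of _ 0]) simp
  fix g :: "real \<Rightarrow> real" assume "\<exists>a b. g = (\<lambda>x. a * cos x + b * sin x)"
  then obtain a b where g: "g = (\<lambda>x. a * cos x + b * sin x)" by blast
  have "(g has_real_derivative b * cos t + (- a) * sin t) (at t)" for t
    unfolding g by (auto intro!: derivative_eq_intros)
  then show "\<exists>g'. (\<exists>a b. g' = (\<lambda>x. a * cos x + b * sin x)) \<and> (\<forall>t. (g has_real_derivative g' t) (at t))"
    by blast
qed

text \<open>The classical flat function, multiplied by polynomials in \<open>1/x\<close> so that the family is closed
  under differentiation.\<close>

definition flat :: "real \<Rightarrow> real poly \<Rightarrow> real \<Rightarrow> real" where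
  "flat c p x = (if x > 0 then poly p (inverse x) * exp (- c / x) else 0)"

lemma poly_times_exp_tendsto_0:
  fixes c :: real
  assumes "c > 0"
  shows "((\<lambda>y. y ^ k * poly p y * exp (- c * y)) \<longlongrightarrow> 0) at_top"
proof (induction p arbitrary: k)
  case 0
  then show ?case by simp
next
  case (pCons a p)
  have m: "((\<lambda>y. y ^ k * exp (- c * y)) \<longlongrightarrow> 0) at_top" for k
  proof -
    have "filterlim (\<lambda>y. c * y) at_top at_top"
      by (rule filterlim_tendsto_pos_mult_at_top[where f = "\<lambda>_. c" and c = c])
        (use assms in \<open>auto simp: filterlim_ident\<close>)
    from filterlim_compose[OF tendsto_power_div_exp_0 this]
    have "((\<lambda>y. (1 / c ^ k) * ((c * y) ^ k / exp (c * y))) \<longlongrightarrow> (1 / c ^ k) * 0) at_top"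
      by (intro tendsto_mult tendsto_const) blast
    moreover have "(1 / c ^ k) * ((c * y) ^ k / exp (c * y)) = y ^ k * exp (- c * y)" for y
      using assms by (simp add: power_mult_distrib exp_minus field_simps)
    ultimately show ?thesis by simp
  qed
  have "((\<lambda>y. a * (y ^ k * exp (- c * y)) + y ^ Suc k * poly p y * exp (- c * y)) \<longlongrightarrow> a * 0 + 0) at_top"
    by (intro tendsto_add tendsto_mult tendsto_const m pCons.IH)
  then show ?case by (simp add: algebra_simps)
qed

lemma flat_has_derivative:
  assumes c: "c > 0"
  shows "(flat c p has_real_derivative flat c ([:0, 0, 1:] * (smult c p - pderiv p)) t) (at t)"
proof -
  consider "t > 0" | "t < 0" | "t = 0" by linarith
  then show ?thesis
  proof cases
    case 1
    have "((\<lambda>x. poly p (inverse x) * exp (- c / x)) has_real_derivative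
        poly ([:0, 0, 1:] * (smult c p - pderiv p)) (inverse t) * exp (- c / t)) (at t)"
      using 1 by (auto intro!: derivative_eq_intros poly_DERIV[THEN DERIV_chain2]
          simp: algebra_simps power2_eq_square divide_simps)
    moreover have "eventually (\<lambda>x. poly p (inverse x) * exp (- c / x) = flat c p x) (nhds t)"
      using order_tendstoD(1)[OF filterlim_ident 1]
      by (auto simp: flat_def elim!: eventually_mono)
    ultimately have "(flat c p has_real_derivative
        poly ([:0, 0, 1:] * (smult c p - pderiv p)) (inverse t) * exp (- c / t)) (at t)"
      by (simp only: DERIV_cong_ev[OF refl _ refl])
    then show ?thesis
      using 1 by (simp only: flat_def if_True)
  next
    case 2
    have "eventually (\<lambda>x. 0 = flat c p x) (nhds t)"
      using order_tendstoD(2)[OF filterlim_ident 2] by (auto simp: flat_def elim!: eventually_mono)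
    then have "(flat c p has_real_derivative 0) (at t)"
      using DERIV_const[of 0 "at t"] by (simp only: DERIV_cong_ev[OF refl _ refl])
    then show ?thesis
      using 2 by (simp add: flat_def)
  next
    case 3
    have "((\<lambda>y. y * poly p y * exp (- c * y)) \<longlongrightarrow> 0) at_top"
      using poly_times_exp_tendsto_0[OF c, of 1 p] by simp
    from filterlim_compose[OF this filterlim_inverse_at_top_right]
    have r: "((\<lambda>h. flat c p h / h) \<longlongrightarrow> 0) (at_right 0)"
    proof (rule tendsto_cong[THEN iffD1, rotated])
      show "\<forall>\<^sub>F h in at_right 0. inverse h * poly p (inverse h) * exp (- c * inverse h) = flat c p h / h"
        using eventually_at_right_less[of "0::real"]
        by eventually_elim (simp add: flat_def field_simps)
    qed
    have l: "((\<lambda>h. flat c p h / h) \<longlongrightarrow> 0) (at_left 0)"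
    proof (rule tendsto_eventually)
      show "\<forall>\<^sub>F h in at_left 0. flat c p h / h = 0"
        by (auto simp: eventually_at_filter flat_def)
    qed
    have "((\<lambda>h. flat c p h / h) \<longlongrightarrow> 0) (at 0)"
      using l r by (rule filterlim_split_at)
    then show ?thesis
      using 3 by (simp add: DERIV_def flat_def)
  qed
qed

lemma smooth_flat: "c > 0 \<Longrightarrow> smooth (flat c p)"
  by (rule smooth_coinduct[where X = "\<lambda>f. \<exists>p. f = flat c p"]) (use flat_has_derivative in blast)+

text \<open>As \<open>n\<close> grows, the bump functions increase to the indicator function of \<open>(a,b)\<close>.\<close>

definition bump :: "nat \<Rightarrow> real \<Rightarrow> real \<Rightarrow> real \<Rightarrow> real" where
  "bump n a b t = flat (1 / real (Suc n)) 1 (t - a) * flat (1 / real (Suc n)) 1 (b - t)"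

lemma smooth_bump: "smooth (bump n a b)"
proof -
  let ?c = "1 / real (Suc n)"
  have "smooth (\<lambda>t. flat ?c 1 (1 * t + (- a)) * flat ?c 1 ((-1) * t + b))"
    by (intro smooth_mult smooth_affine smooth_flat) auto
  then show ?thesis by (simp add: bump_def[abs_def])
qed

lemma bump_bounds: "0 \<le> bump n a b t" "bump n a b t \<le> 1"
  by (auto simp: bump_def flat_def intro!: mult_le_one)

lemma bump_zero: "t \<notin> {a<..<b} \<Longrightarrow> bump n a b t = 0"
  by (auto simp: bump_def flat_def)

lemma bump_tendsto: "(\<lambda>n. bump n a b t) \<longlonglongrightarrow> indicat_real {a<..<b} t"
proof (cases "t \<in> {a<..<b}")
  case True
  have e: "(\<lambda>n. exp (- (1 / real (Suc n)) / d)) \<longlonglongrightarrow> 1" for d :: real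
  proof -
    have "(\<lambda>n. exp (inverse (real (Suc n)) * (- 1 / d))) \<longlonglongrightarrow> exp 0"
      by (intro tendsto_exp tendsto_mult_left_zero LIMSEQ_inverse_real_of_nat)
    then show ?thesis by (simp add: inverse_eq_divide)
  qed
  have "(\<lambda>n. exp (- (1 / real (Suc n)) / (t - a)) * exp (- (1 / real (Suc n)) / (b - t))) \<longlonglongrightarrow> 1 * 1"
    by (intro tendsto_mult e)
  then show ?thesis using True by (simp add: bump_def flat_def)
next
  case False
  then show ?thesis by (simp add: bump_zero)
qed

lemma test_funI:
  assumes "smooth \<phi>" "a < c" "d < b" "\<And>t. t \<notin> {c..d} \<Longrightarrow> \<phi> t = 0"
  shows "\<phi> \<in> test_fun a b"
  unfolding test_fun_def using assms by (auto simp: smooth_def intro!: exI[of _ "{c..d}"])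

lemma test_fun_smooth: "\<phi> \<in> test_fun a b \<Longrightarrow> smooth \<phi>"
  by (auto simp: test_fun_def smooth_def)

lemma test_funE:
  assumes "\<phi> \<in> test_fun a b" "a < b"
  obtains c d where "a < c" "c \<le> d" "d < b" "\<And>t. t \<notin> {c..d} \<Longrightarrow> \<phi> t = 0"
proof -
  obtain K where K: "compact K" "K \<subseteq> {a<..<b}" "\<And>t. t \<notin> K \<Longrightarrow> \<phi> t = 0"
    using assms by (auto simp: test_fun_def)
  show thesis
  proof (cases "K = {}")
    case True
    show thesis by (rule that[of "(a + b) / 2" "(a + b) / 2"]) (use True K(3) assms(2) in auto)
  next
    case False
    obtain c where c: "c \<in> K" "\<And>t. t \<in> K \<Longrightarrow> c \<le> t"
      using compact_attains_inf[OF K(1) False] by blast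
    obtain d where d: "d \<in> K" "\<And>t. t \<in> K \<Longrightarrow> t \<le> d"
      using compact_attains_sup[OF K(1) False] by blast
    have "\<phi> t = 0" if "t \<notin> {c..d}" for t
      using that c(2)[of t] d(2)[of t] by (intro K(3)) auto
    then show thesis by (intro that[of c d]) (use c d K(2) in auto)
  qed
qed

lemma bump_test_fun: "a < c \<Longrightarrow> d < b \<Longrightarrow> bump n c d \<in> test_fun a b"
  by (rule test_funI[OF smooth_bump, of a c d b]) (auto intro: bump_zero)

lemma test_fun_cmult: "\<phi> \<in> test_fun a b \<Longrightarrow> (\<lambda>x. k * \<phi> x) \<in> test_fun a b"
  using smooth_mult[OF smooth_const test_fun_smooth, of \<phi> a b k]
  by (auto simp: test_fun_def smooth_def)

lemma test_fun_diff:
  assumes "\<phi> \<in> test_fun a b" "\<psi> \<in> test_fun a b"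
  shows "(\<lambda>x. \<phi> x - \<psi> x) \<in> test_fun a b"
proof -
  obtain K where K: "compact K" "K \<subseteq> {a<..<b}" "\<And>t. t \<notin> K \<Longrightarrow> \<phi> t = 0"
    using assms by (auto simp: test_fun_def)
  obtain L where L: "compact L" "L \<subseteq> {a<..<b}" "\<And>t. t \<notin> L \<Longrightarrow> \<psi> t = 0"
    using assms by (auto simp: test_fun_def)
  have "smooth (\<lambda>x. \<phi> x + (-1) * \<psi> x)"
    using assms by (intro smooth_add smooth_mult smooth_const) (auto intro: test_fun_smooth)
  then have "smooth (\<lambda>x. \<phi> x - \<psi> x)" by simp
  moreover have "\<phi> t - \<psi> t = 0" if "t \<notin> K \<union> L" for t
    using K(3)[of t] L(3)[of t] that by simp
  moreover have "compact (K \<union> L)" "K \<union> L \<subseteq> {a<..<b}"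
    using K L by auto
  ultimately show ?thesis
    unfolding test_fun_def smooth_def by blast
qed

lemma test_fun_deriv:
  assumes \<phi>: "\<phi> \<in> test_fun a b" and "a < b"
  shows "deriv \<phi> \<in> test_fun a b"
proof -
  obtain c d where cd: "a < c" "c \<le> d" "d < b" "\<And>t. t \<notin> {c..d} \<Longrightarrow> \<phi> t = 0"
    using test_funE[OF assms] by blast
  show ?thesis
  proof (rule test_funI[OF _ cd(1,3)])
    show "smooth (deriv \<phi>)" using test_fun_smooth[OF \<phi>] smooth_deriv_iff by blast
    fix t assume t: "t \<notin> {c..d}"
    have "open (- {c..d})" by (simp add: open_Compl)
    then have "eventually (\<lambda>x. x \<in> - {c..d}) (nhds t)" using t by (intro eventually_nhds_in_open) auto
    then have "eventually (\<lambda>x. \<phi> x = 0) (nhds t)" by eventually_elim (use cd(4) in auto)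
    then have "deriv \<phi> t = deriv (\<lambda>_. 0) t" by (intro deriv_cong_ev) auto
    then show "deriv \<phi> t = 0" by simp
  qed
qed

lemma test_fun_has_deriv: "\<phi> \<in> test_fun a b \<Longrightarrow> (\<phi> has_real_derivative deriv \<phi> t) (at t)"
  by (rule smooth_has_deriv[OF test_fun_smooth])

lemma test_fun_continuous: "\<phi> \<in> test_fun a b \<Longrightarrow> continuous_on S \<phi>"
  by (rule smooth_continuous[OF test_fun_smooth])

lemma test_fun_borel: "\<phi> \<in> test_fun a b \<Longrightarrow> \<phi> \<in> borel_measurable borel"
  by (intro borel_measurable_continuous_onI test_fun_continuous)

lemma test_fun_zero: "\<phi> \<in> test_fun a b \<Longrightarrow> t \<notin> {a<..<b} \<Longrightarrow> \<phi> t = 0"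
  by (auto simp: test_fun_def)

section \<open>Weak derivatives on an interval\<close>

lemma finite_lebesgue_on_Ioo: "finite_measure (lebesgue_on {a<..<b::real})"
  by (rule finite_measure_lebesgue_on) simp

lemma continuous_integral_Ioo:
  fixes f :: "real \<Rightarrow> real"
  assumes "continuous_on {a..b} f"
  shows "integrable (lebesgue_on {a<..<b}) f" "(\<integral>t. f t \<partial>lebesgue_on {a<..<b}) = integral {a..b} f"
proof -
  have "f absolutely_integrable_on {a..b}"
    by (rule absolutely_integrable_continuous_real[OF assms])
  then have "f absolutely_integrable_on {a<..<b}"
    by (rule set_integrable_subset) auto
  then show i: "integrable (lebesgue_on {a<..<b}) f"
    by (simp add: set_integrable_def integrable_restrict_space)
  show "(\<integral>t. f t \<partial>lebesgue_on {a<..<b}) = integral {a..b} f"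
    using lebesgue_integral_eq_integral[OF i] integral_open_interval_real[of a b f] by simp
qed

lemma continuous_sq_int_Ioo:
  fixes f :: "real \<Rightarrow> real"
  assumes "continuous_on {a..b} f"
  shows "sq_int (lebesgue_on {a<..<b}) f"
proof -
  have "integrable (lebesgue_on {a<..<b}) (\<lambda>x. (f x)\<^sup>2)"
    by (intro continuous_integral_Ioo continuous_intros assms)
  then show ?thesis
    using continuous_integral_Ioo(1)[OF assms] by (simp add: sq_int_def)
qed

lemma test_fun_sq_int: "\<phi> \<in> test_fun c d \<Longrightarrow> sq_int (lebesgue_on {a<..<b}) \<phi>"
  by (rule continuous_sq_int_Ioo[OF test_fun_continuous])

lemma integral_by_parts_test_fun:
  assumes ab: "a < b" and \<phi>: "\<phi> \<in> test_fun a b"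
    and f: "\<And>t. t \<in> {a..b} \<Longrightarrow> (f has_real_derivative f' t) (at t within {a..b})"
    and f': "continuous_on {a..b} f'"
  shows "(\<integral>t. f t * deriv \<phi> t \<partial>lebesgue_on {a<..<b}) = - (\<integral>t. f' t * \<phi> t \<partial>lebesgue_on {a<..<b})"
proof -
  have cf: "continuous_on {a..b} f"
    using f by (meson DERIV_continuous_on)
  note c = test_fun_continuous[OF \<phi>] test_fun_continuous[OF test_fun_deriv[OF \<phi> ab]]
  have "((\<lambda>t. f t * deriv \<phi> t + f' t * \<phi> t) has_integral f b * \<phi> b - f a * \<phi> a) {a..b}"
  proof (rule fundamental_theorem_of_calculus)
    fix t assume t: "t \<in> {a..b}"
    have "((\<lambda>t. f t * \<phi> t) has_real_derivative f t * deriv \<phi> t + f' t * \<phi> t) (at t within {a..b})"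
      using DERIV_mult[OF f[OF t] has_field_derivative_at_within[OF test_fun_has_deriv[OF \<phi>]]]
      by (simp add: add.commute mult.commute)
    then show "((\<lambda>t. f t * \<phi> t) has_vector_derivative f t * deriv \<phi> t + f' t * \<phi> t) (at t within {a..b})"
      by (simp add: has_real_derivative_iff_has_vector_derivative)
  qed (use ab in simp)
  then have "integral {a..b} (\<lambda>t. f t * deriv \<phi> t + f' t * \<phi> t) = 0"
    using test_fun_zero[OF \<phi>, of a] test_fun_zero[OF \<phi>, of b] by (simp add: integral_unique)
  moreover have "(\<lambda>t. f t * deriv \<phi> t) integrable_on {a..b}" "(\<lambda>t. f' t * \<phi> t) integrable_on {a..b}"
    by (auto intro!: integrable_continuous_interval continuous_intros cf f' c)
  ultimately have "integral {a..b} (\<lambda>t. f t * deriv \<phi> t) = - integral {a..b} (\<lambda>t. f' t * \<phi> t)"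
    by (simp add: Henstock_Kurzweil_Integration.integral_add)
  then show ?thesis
    by (subst (1 2) continuous_integral_Ioo(2)) (auto intro!: continuous_intros cf f' c)
qed

text \<open>
  A family of test functions that separates square-integrable functions. It is countable, so that identities holding
  almost everywhere for each member hold almost everywhere for all members at once.
\<close>

definition bump_family :: "real \<Rightarrow> real \<Rightarrow> (real \<Rightarrow> real) set" where
  "bump_family a b = (\<lambda>(n, c, d). bump n c d) ` {(n, c, d). c \<in> \<rat> \<and> d \<in> \<rat> \<and> a < c \<and> c < d \<and> d < b}"

lemma countable_bump_family: "countable (bump_family a b)"
proof -
  have "{(n, c, d). c \<in> \<rat> \<and> d \<in> \<rat> \<and> a < c \<and> c < d \<and> d < b} \<subseteq> (UNIV :: nat set) \<times> (\<rat> \<times> \<rat>)"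
    by auto
  then have "countable {(n :: nat, c, d). c \<in> \<rat> \<and> d \<in> \<rat> \<and> a < c \<and> c < d \<and> d < b}"
    by (rule countable_subset) (intro countable_SIGMA countable_rat countableI_type)
  then show ?thesis by (simp add: bump_family_def)
qed

lemma bump_family_test_fun: "\<phi> \<in> bump_family a b \<Longrightarrow> \<phi> \<in> test_fun a b"
  by (auto simp: bump_family_def bump_test_fun)

lemma sq_int_Ioo_integrable:
  assumes "sq_int (lebesgue_on {a<..<b::real}) f"
  shows "integrable (lebesgue_on {a<..<b}) f"
  using sq_int_mult[OF assms continuous_sq_int_Ioo[of a b "\<lambda>_. 1"]] by simp

text \<open>
  The lemma of du Bois-Reymond. The bump functions tend to indicator functions of intervals with rational end points, and
  these exhaust \<open>(max a x, b)\<close> for every \<open>x\<close>.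
\<close>

lemma AE_zero_if_bump_integrals_zero:
  assumes ab: "a < b" and f: "sq_int (lebesgue_on {a<..<b}) f"
    and z: "\<And>\<phi>. \<phi> \<in> bump_family a b \<Longrightarrow> (\<integral>t. f t * \<phi> t \<partial>lebesgue_on {a<..<b}) = 0"
  shows "AE t in lebesgue_on {a<..<b}. f t = 0"
proof -
  have S: "{a<..<b} \<in> sets borel" by simp
  obtain f' where r: "borel_rep {a<..<b} f f'"
    using ex_borel_rep[OF S sq_intD(1)[OF f]] by (elim exE)
  have [measurable]: "f' \<in> borel_measurable borel" using borel_repD(1)[OF r] .
  have i: "integrable lborel f'"
    using sq_int_Ioo_integrable[OF f] borel_rep_integral(1)[OF S r] by simp
  have [measurable]: "bump n c d \<in> borel_measurable borel" for n c d
    by (intro borel_measurable_continuous_onI smooth_continuous smooth_bump)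
  have 1: "(\<integral>t. f' t * indicat_real {c<..<d} t \<partial>lborel) = 0"
    if "c \<in> \<rat>" "d \<in> \<rat>" "a < c" "c < d" "d < b" for c d
  proof -
    have "(\<lambda>n. \<integral>t. f' t * bump n c d t \<partial>lborel) \<longlonglongrightarrow> (\<integral>t. f' t * indicat_real {c<..<d} t \<partial>lborel)"
    proof (rule integral_dominated_convergence[where w = "\<lambda>t. norm (f' t)"])
      show "AE t in lborel. (\<lambda>n. f' t * bump n c d t) \<longlonglongrightarrow> f' t * indicat_real {c<..<d} t"
        by (intro AE_I2 tendsto_mult tendsto_const bump_tendsto)
      show "AE t in lborel. norm (f' t * bump n c d t) \<le> norm (f' t)" for n
        using bump_bounds[of n c d] by (auto intro!: AE_I2 simp: abs_mult mult_left_le)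
    qed (use i in auto)
    moreover have "(\<integral>t. f' t * bump n c d t \<partial>lborel) = 0" for n
    proof -
      have "bump n c d \<in> bump_family a b" using that by (force simp: bump_family_def)
      then show ?thesis
        using z borel_rep_integral(2)[OF S borel_rep_mult_fun[OF r, of "bump n c d"]] by simp
    qed
    ultimately show ?thesis by (simp add: LIMSEQ_const_iff)
  qed
  have "AE t in lborel. f' t = 0"
  proof (rule AE_zero_if_integral_half_lines_zero[OF i])
    fix x
    show "(\<integral>t. indicator {x<..} t * f' t \<partial>lborel) = 0"
    proof (cases "x < b")
      case False
      have "indicator {x<..} t * f' t = 0" for t
        using False borel_repD(2)[OF r, of t] by (auto simp: indicator_def)
      then show ?thesis by (simp only: Bochner_Integration.integral_zero)
    next
      case True
      define y where "y = max a x"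
      have y: "y < b" "a \<le> y" using True ab by (auto simp: y_def)
      define m where "m = (y + b) / 2"
      have m: "y < m" "m < b" using y by (auto simp: m_def)
      have "\<exists>c\<in>\<rat>. y < c \<and> c < min m (y + inverse (real (Suc n)))" for n
        using m by (intro Rats_dense_in_real) auto
      then obtain c where c: "\<And>n. c n \<in> \<rat>" "\<And>n. y < c n" "\<And>n. c n < m" "\<And>n. c n < y + inverse (real (Suc n))"
        by (metis min_less_iff_conj)
      have "\<exists>d\<in>\<rat>. max m (b - inverse (real (Suc n))) < d \<and> d < b" for n
        using m by (intro Rats_dense_in_real) auto
      then obtain d where d: "\<And>n. d n \<in> \<rat>" "\<And>n. d n < b" "\<And>n. m < d n" "\<And>n. b - inverse (real (Suc n)) < d n"
        by (metis max_less_iff_conj)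
      have "(\<lambda>n. \<integral>t. f' t * indicat_real {c n<..<d n} t \<partial>lborel) \<longlonglongrightarrow> (\<integral>t. f' t * indicat_real {y<..<b} t \<partial>lborel)"
      proof (rule integral_dominated_convergence[where w = "\<lambda>t. norm (f' t)"])
        show "AE t in lborel. (\<lambda>n. f' t * indicat_real {c n<..<d n} t) \<longlonglongrightarrow> f' t * indicat_real {y<..<b} t"
        proof (rule AE_I2)
          fix t
          have "(\<lambda>n. indicat_real {c n<..<d n} t) \<longlonglongrightarrow> indicat_real {y<..<b} t"
          proof (cases "y < t \<and> t < b")
            case True
            have cl: "(\<lambda>n. y + inverse (real (Suc n))) \<longlonglongrightarrow> y + 0"
              by (intro tendsto_add tendsto_const LIMSEQ_inverse_real_of_nat)
            have dl: "(\<lambda>n. b - inverse (real (Suc n))) \<longlonglongrightarrow> b - 0"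
              by (intro tendsto_diff tendsto_const LIMSEQ_inverse_real_of_nat)
            have "\<forall>\<^sub>F n in sequentially. y + inverse (real (Suc n)) < t"
              using order_tendstoD(2)[OF cl] True by simp
            moreover have "\<forall>\<^sub>F n in sequentially. t < b - inverse (real (Suc n))"
              using order_tendstoD(1)[OF dl] True by simp
            ultimately have "\<forall>\<^sub>F n in sequentially. indicat_real {c n<..<d n} t = 1"
            proof eventually_elim
              case (elim n)
              then show ?case using c(4)[of n] d(4)[of n] by (simp add: indicator_def)
            qed
            then show ?thesis using True by (simp add: tendsto_eventually)
          next
            case False
            have "indicat_real {c n<..<d n} t = 0" for n
              using False c(2)[of n] d(2)[of n] by (auto simp: indicator_def)
            moreover have "indicat_real {y<..<b} t = 0" using False by auto
            ultimately show ?thesis by (simp only: tendsto_const)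
          qed
          then show "(\<lambda>n. f' t * indicat_real {c n<..<d n} t) \<longlonglongrightarrow> f' t * indicat_real {y<..<b} t"
            by (intro tendsto_mult tendsto_const)
        qed
        show "AE t in lborel. norm (f' t * indicat_real {c n<..<d n} t) \<le> norm (f' t)" for n
          by (auto intro!: AE_I2 simp: indicator_def)
      qed (use i in auto)
      moreover have "(\<integral>t. f' t * indicat_real {c n<..<d n} t \<partial>lborel) = 0" for n
        using c[of n] d[of n] y by (intro 1) linarith+
      ultimately have "(\<integral>t. f' t * indicat_real {y<..<b} t \<partial>lborel) = 0"
        by (simp add: LIMSEQ_const_iff)
      moreover have "f' t * indicat_real {y<..<b} t = indicator {x<..} t * f' t" for t
        using borel_repD(2)[OF r, of t] by (auto simp: indicator_def y_def)
      ultimately show ?thesis by simp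
    qed
  qed
  then have "AE t in lebesgue_on {a<..<b}. f' t = 0"
    unfolding AE_lebesgue_on_iff[OF S] by eventually_elim simp
  with borel_repD(3)[OF r] show ?thesis by eventually_elim simp
qed

lemma weak_derivD:
  assumes "weak_deriv a b f g"
  shows "sq_int (lebesgue_on {a<..<b}) f" "sq_int (lebesgue_on {a<..<b}) g"
    "\<And>\<phi>. \<phi> \<in> test_fun a b \<Longrightarrow> (\<integral>t. f t * deriv \<phi> t \<partial>lebesgue_on {a<..<b}) = - (\<integral>t. g t * \<phi> t \<partial>lebesgue_on {a<..<b})"
  using assms by (auto simp: weak_deriv_def L2_on_iff)

lemma integral_mult_AE_cong:
  fixes f g \<phi> :: "'a \<Rightarrow> real"
  assumes "f \<in> borel_measurable M" "g \<in> borel_measurable M" "\<phi> \<in> borel_measurable M" "AE x in M. f x = g x"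
  shows "(\<integral>x. f x * \<phi> x \<partial>M) = (\<integral>x. g x * \<phi> x \<partial>M)"
  by (rule integral_cong_AE) (use assms in auto)

lemma weak_deriv_AE_cong:
  assumes w: "weak_deriv a b f g" and ab: "a < b"
    and f: "AE t in lebesgue_on {a<..<b}. f t = f1 t" and g: "AE t in lebesgue_on {a<..<b}. g t = g1 t"
  shows "weak_deriv a b f1 g1"
proof -
  note d = weak_derivD[OF w]
  have m: "f1 \<in> borel_measurable (lebesgue_on {a<..<b})" "g1 \<in> borel_measurable (lebesgue_on {a<..<b})"
    using borel_measurable_lebesgue_on_AE[OF _ sq_intD(1)[OF d(1)] f]
      borel_measurable_lebesgue_on_AE[OF _ sq_intD(1)[OF d(2)] g] by auto
  have "(\<integral>t. f1 t * deriv \<phi> t \<partial>lebesgue_on {a<..<b}) = - (\<integral>t. g1 t * \<phi> t \<partial>lebesgue_on {a<..<b})"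
    if \<phi>: "\<phi> \<in> test_fun a b" for \<phi>
  proof -
    have "(\<integral>t. f t * deriv \<phi> t \<partial>lebesgue_on {a<..<b}) = (\<integral>t. f1 t * deriv \<phi> t \<partial>lebesgue_on {a<..<b})"
      by (rule integral_mult_AE_cong) (use m d f sq_intD(1)[OF test_fun_sq_int[OF test_fun_deriv[OF \<phi> ab]]] in \<open>auto simp: sq_int_def\<close>)
    moreover have "(\<integral>t. g t * \<phi> t \<partial>lebesgue_on {a<..<b}) = (\<integral>t. g1 t * \<phi> t \<partial>lebesgue_on {a<..<b})"
      by (rule integral_mult_AE_cong) (use m d g sq_intD(1)[OF test_fun_sq_int[OF \<phi>]] in \<open>auto simp: sq_int_def\<close>)
    ultimately show ?thesis using d(3)[OF \<phi>] by simp
  qed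
  then show ?thesis
    using sq_int_AE_cong[OF d(1) m(1) f] sq_int_AE_cong[OF d(2) m(2) g]
    by (simp add: weak_deriv_def L2_on_iff)
qed

lemma weak_deriv_unique:
  assumes ab: "a < b" and "weak_deriv a b f g" "weak_deriv a b f g'"
  shows "AE t in lebesgue_on {a<..<b}. g t = g' t"
proof -
  note d = weak_derivD[OF assms(2)] and d' = weak_derivD[OF assms(3)]
  have "AE t in lebesgue_on {a<..<b}. g t - g' t = 0"
  proof (rule AE_zero_if_bump_integrals_zero[OF ab sq_int_diff[OF d(2) d'(2)]])
    fix \<phi> assume "\<phi> \<in> bump_family a b"
    then have \<phi>: "\<phi> \<in> test_fun a b" by (rule bump_family_test_fun)
    have "integrable (lebesgue_on {a<..<b}) (\<lambda>t. g t * \<phi> t)" "integrable (lebesgue_on {a<..<b}) (\<lambda>t. g' t * \<phi> t)"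
      using sq_int_mult d(2) d'(2) test_fun_sq_int[OF \<phi>] by blast+
    then show "(\<integral>t. (g t - g' t) * \<phi> t \<partial>lebesgue_on {a<..<b}) = 0"
      using d(3)[OF \<phi>] d'(3)[OF \<phi>] by (simp add: left_diff_distrib)
  qed
  then show ?thesis by eventually_elim simp
qed

lemma weak_deriv_C1:
  assumes "a < b" "\<And>t. t \<in> {a..b} \<Longrightarrow> (f has_real_derivative f' t) (at t within {a..b})" "continuous_on {a..b} f'"
  shows "weak_deriv a b f f'"
proof -
  have "continuous_on {a..b} f" using assms(2) by (meson DERIV_continuous_on)
  then show ?thesis
    using continuous_sq_int_Ioo[of a b f] continuous_sq_int_Ioo[OF assms(3)]
      integral_by_parts_test_fun[OF assms(1) _ assms(2,3)]
    by (auto simp: weak_deriv_def L2_on_iff)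
qed

lemma weak_deriv_diff:
  assumes ab: "a < b" and "weak_deriv a b f g" "weak_deriv a b f' g'"
  shows "weak_deriv a b (\<lambda>x. f x - f' x) (\<lambda>x. g x - g' x)"
proof -
  note d = weak_derivD[OF assms(2)] and d' = weak_derivD[OF assms(3)]
  have "(\<integral>t. (f t - f' t) * deriv \<phi> t \<partial>lebesgue_on {a<..<b}) = - (\<integral>t. (g t - g' t) * \<phi> t \<partial>lebesgue_on {a<..<b})"
    if \<phi>: "\<phi> \<in> test_fun a b" for \<phi>
  proof -
    note s = test_fun_sq_int[OF \<phi>, of a b] test_fun_sq_int[OF test_fun_deriv[OF \<phi> ab], of a b]
    have "integrable (lebesgue_on {a<..<b}) (\<lambda>t. f t * deriv \<phi> t)" "integrable (lebesgue_on {a<..<b}) (\<lambda>t. f' t * deriv \<phi> t)"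
      "integrable (lebesgue_on {a<..<b}) (\<lambda>t. g t * \<phi> t)" "integrable (lebesgue_on {a<..<b}) (\<lambda>t. g' t * \<phi> t)"
      using sq_int_mult d(1,2) d'(1,2) s by blast+
    then show ?thesis using d(3)[OF \<phi>] d'(3)[OF \<phi>] by (simp add: left_diff_distrib)
  qed
  then show ?thesis
    using sq_int_diff[OF d(1) d'(1)] sq_int_diff[OF d(2) d'(2)] by (simp add: weak_deriv_def L2_on_iff)
qed

text \<open>A test function of mean zero is the derivative of a test function.\<close>

lemma test_fun_antideriv:
  assumes ab: "a < b" and \<psi>: "\<psi> \<in> test_fun a b" and z: "(\<integral>t. \<psi> t \<partial>lebesgue_on {a<..<b}) = 0"
  shows "(\<lambda>x. integral {a..x} \<psi>) \<in> test_fun a b" "deriv (\<lambda>x. integral {a..x} \<psi>) = \<psi>"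
proof -
  let ?F = "\<lambda>x. integral {a..x} \<psi>"
  obtain c d where cd: "a < c" "c \<le> d" "d < b" "\<And>t. t \<notin> {c..d} \<Longrightarrow> \<psi> t = 0"
    using test_funE[OF \<psi> ab] by blast
  have D: "(?F has_real_derivative \<psi> t) (at t)" for t
  proof (cases "t < c")
    case True
    have "eventually (\<lambda>x. x < c) (nhds t)" using True by (rule order_tendstoD(2)[OF filterlim_ident])
    then have "eventually (\<lambda>x. 0 = ?F x) (nhds t)"
    proof eventually_elim
      case (elim x)
      have "integral {a..x} \<psi> = integral {a..x} (\<lambda>_. 0)"
        using elim cd(4) by (intro Henstock_Kurzweil_Integration.integral_cong) auto
      then show ?case by simp
    qed
    then have "(?F has_real_derivative 0) (at t)"
      using DERIV_const[of 0 "at t"] by (simp only: DERIV_cong_ev[OF refl _ refl])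
    then show ?thesis using True cd(4)[of t] by simp
  next
    case False
    have "(?F has_real_derivative \<psi> t) (at t within {a..t + 1})"
      using False cd by (intro integral_has_real_derivative test_fun_continuous[OF \<psi>]) auto
    then show ?thesis using False cd by (subst (asm) at_within_interior) auto
  qed
  then show dF: "deriv ?F = \<psi>" by (auto intro!: DERIV_imp_deriv)
  show "?F \<in> test_fun a b"
  proof (rule test_funI[OF _ cd(1,3)])
    show "smooth ?F"
      using D test_fun_smooth[OF \<psi>] dF smooth_deriv_iff[of ?F] by (auto simp: field_differentiable_def)
    have F0: "?F b = 0"
      using z continuous_integral_Ioo(2)[OF test_fun_continuous[OF \<psi>]] by simp
    fix t assume t: "t \<notin> {c..d}"
    show "?F t = 0"
    proof (cases "t < c")
      case True
      have "integral {a..t} \<psi> = integral {a..t} (\<lambda>_. 0)"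
        using True cd(4) by (intro Henstock_Kurzweil_Integration.integral_cong) auto
      then show ?thesis by simp
    next
      case False
      then have "d < t" using t by auto
      define m where "m = max t b"
      have i: "\<psi> integrable_on {u..v}" for u v
        by (intro integrable_continuous_interval test_fun_continuous[OF \<psi>])
      have tail: "integral {s..m} \<psi> = 0" if "d < s" for s
      proof -
        have "integral {s..m} \<psi> = integral {s..m} (\<lambda>_. 0)"
          using that cd(4) by (intro Henstock_Kurzweil_Integration.integral_cong) auto
        then show ?thesis by simp
      qed
      have "?F t + integral {t..m} \<psi> = ?F m" "?F b + integral {b..m} \<psi> = ?F m"
        using cd \<open>d < t\<close> ab i by (auto simp: m_def intro!: Henstock_Kurzweil_Integration.integral_combine)
      then show ?thesis using F0 tail[OF \<open>d < t\<close>] tail[OF cd(3)] by simp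
    qed
  qed
qed

section \<open>Weak derivatives on the cylinder\<close>

lemma AE_lborel_imp_lebesgue_on:
  assumes "S \<in> sets borel" "AE x in lborel. P x"
  shows "AE x in lebesgue_on S. P x"
  unfolding AE_lebesgue_on_iff[OF assms(1)] using assms(2) by eventually_elim simp

lemma sq_int_Q_slices:
  assumes "sq_int (lebesgue_on (Q T)) f"
  shows "AE t in lebesgue_on {0<..<T}. sq_int (lebesgue_on {0<..<pi}) (\<lambda>x. f (t, x))"
    and "AE x in lebesgue_on {0<..<pi}. sq_int (lebesgue_on {0<..<T}) (\<lambda>t. f (t, x))"
proof -
  obtain f' where r: "borel_rep (Q T) f f'"
    using ex_borel_rep[OF Q_borel sq_intD(1)[OF assms]] by (elim exE)
  have f': "sq_int lborel f'" using borel_rep_sq_int[OF Q_borel r] assms by simp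
  have S: "{0<..<T} \<in> sets borel" "{0<..<pi} \<in> sets borel" by auto
  show "AE t in lebesgue_on {0<..<T}. sq_int (lebesgue_on {0<..<pi}) (\<lambda>x. f (t, x))"
    using AE_lborel_imp_lebesgue_on[OF S(1) sq_int_slices(1)[OF f']] borel_rep_slices(1)[OF r]
    by eventually_elim (simp add: borel_rep_sq_int[OF S(2)])
  show "AE x in lebesgue_on {0<..<pi}. sq_int (lebesgue_on {0<..<T}) (\<lambda>t. f (t, x))"
    using AE_lborel_imp_lebesgue_on[OF S(2) sq_int_slices(2)[OF f']] borel_rep_slices(2)[OF r]
    by eventually_elim (simp add: borel_rep_sq_int[OF S(1)])
qed

lemma is_DxD:
  assumes "is_Dx T w g"
  shows "sq_int (lebesgue_on (Q T)) g"
    "AE t in lebesgue_on {0<..<T}. weak_deriv 0 pi (\<lambda>x. w (t, x)) (\<lambda>x. g (t, x))"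
  using assms by (auto simp: is_Dx_def L2_on_iff)

lemma is_DtauD:
  assumes "is_Dtau T w g"
  shows "sq_int (lebesgue_on (Q T)) g"
    "\<phi> \<in> test_fun 0 T \<Longrightarrow> AE x in lebesgue_on {0<..<pi}.
        (\<integral>\<tau>. w (\<tau>, x) * deriv \<phi> \<tau> \<partial>lebesgue_on {0<..<T}) = - (\<integral>\<tau>. g (\<tau>, x) * \<phi> \<tau> \<partial>lebesgue_on {0<..<T})"
  using assms by (auto simp: is_Dtau_def L2_on_iff)

lemma is_Dx_AE_cong:
  assumes "AE z in lebesgue_on (Q T). w z = w1 z" "is_Dx T w g"
  shows "is_Dx T w1 g"
proof -
  have "AE t in lebesgue_on {0<..<T}. weak_deriv 0 pi (\<lambda>x. w1 (t, x)) (\<lambda>x. g (t, x))"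
    using AE_Q_slices(1)[OF assms(1)] is_DxD(2)[OF assms(2)]
    by eventually_elim (rule weak_deriv_AE_cong, auto)
  then show ?thesis using assms(2) by (simp add: is_Dx_def)
qed

lemma AE_sym: "AE z in M. f z = g z \<Longrightarrow> AE z in M. g z = f z"
  by (auto elim: eventually_mono)

lemma Dx_AE_cong:
  assumes "AE z in lebesgue_on (Q T). w z = w1 z"
  shows "Dx T w = Dx T w1"
proof -
  have "is_Dx T w = is_Dx T w1"
    using is_Dx_AE_cong[OF assms] is_Dx_AE_cong[OF AE_sym[OF assms]] by (intro ext iffI)
  then show ?thesis by (simp add: Dx_def)
qed

lemma is_Dx_unique:
  assumes "is_Dx T w g" "is_Dx T w g'"
  shows "AE z in lebesgue_on (Q T). g z = g' z"
proof -
  have "AE t in lebesgue_on {0<..<T}. AE x in lebesgue_on {0<..<pi}. g (t, x) = g' (t, x)"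
    using is_DxD(2)[OF assms(1)] is_DxD(2)[OF assms(2)]
    by eventually_elim (rule weak_deriv_unique, auto)
  then show ?thesis
    using AE_Q_eqI[OF sq_intD(1)[OF is_DxD(1)[OF assms(1)]] sq_intD(1)[OF is_DxD(1)[OF assms(2)]]] by blast
qed

lemma is_Dx_Dx: "is_Dx T w g \<Longrightarrow> is_Dx T w (Dx T w)"
  unfolding Dx_def by (rule someI[of "is_Dx T w"])

lemma Dx_AE_eq: "is_Dx T w g \<Longrightarrow> AE z in lebesgue_on (Q T). Dx T w z = g z"
  using is_Dx_unique is_Dx_Dx by blast

lemma is_Dx_Dxx:
  assumes "is_Dx T w g" "is_Dx T g h"
  shows "is_Dx T (Dx T w) (Dxx T w)"
proof -
  have "is_Dx T (Dx T w) h"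
    by (rule is_Dx_AE_cong[OF AE_sym[OF Dx_AE_eq[OF assms(1)]] assms(2)])
  then show ?thesis unfolding Dxx_def by (rule is_Dx_Dx)
qed

lemma Dxx_AE_eq:
  assumes "is_Dx T w g" "is_Dx T g h"
  shows "AE z in lebesgue_on (Q T). Dxx T w z = h z"
  unfolding Dxx_def Dx_AE_cong[OF Dx_AE_eq[OF assms(1)]] by (rule Dx_AE_eq[OF assms(2)])

lemma integral_slice_AE_cong:
  fixes w w1 :: "real \<times> real \<Rightarrow> real"
  assumes w: "w \<in> borel_measurable (lebesgue_on (Q T))" and eq: "AE z in lebesgue_on (Q T). w z = w1 z"
    and \<phi>: "\<phi> \<in> borel_measurable borel"
  shows "AE x in lebesgue_on {0<..<pi}. (\<integral>\<tau>. w (\<tau>, x) * \<phi> \<tau> \<partial>lebesgue_on {0<..<T}) = (\<integral>\<tau>. w1 (\<tau>, x) * \<phi> \<tau> \<partial>lebesgue_on {0<..<T})"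
proof -
  obtain w' where r: "borel_rep (Q T) w w'"
    using ex_borel_rep[OF Q_borel w] by (elim exE)
  have r1: "borel_rep (Q T) w1 w'"
    using r eq by (auto simp: borel_rep_def elim: eventually_elim2)
  have S: "{0<..<T} \<in> sets borel" by simp
  show ?thesis
    using borel_rep_slices(2)[OF r] borel_rep_slices(2)[OF r1]
  proof eventually_elim
    case (elim x)
    show ?case
      using borel_rep_integral(2)[OF S borel_rep_mult_fun[OF elim(1) \<phi>]]
        borel_rep_integral(2)[OF S borel_rep_mult_fun[OF elim(2) \<phi>]] by simp
  qed
qed

lemma is_Dtau_AE_cong:
  assumes T: "0 < T" and w: "w \<in> borel_measurable (lebesgue_on (Q T))"
    and eq: "AE z in lebesgue_on (Q T). w z = w1 z" and D: "is_Dtau T w g"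
  shows "is_Dtau T w1 g"
proof -
  have "AE x in lebesgue_on {0<..<pi}.
        (\<integral>\<tau>. w1 (\<tau>, x) * deriv \<phi> \<tau> \<partial>lebesgue_on {0<..<T}) = - (\<integral>\<tau>. g (\<tau>, x) * \<phi> \<tau> \<partial>lebesgue_on {0<..<T})"
    if \<phi>: "\<phi> \<in> test_fun 0 T" for \<phi>
    using integral_slice_AE_cong[OF w eq test_fun_borel[OF test_fun_deriv[OF \<phi> T]]] is_DtauD(2)[OF D \<phi>]
    by eventually_elim simp
  then show ?thesis using D by (simp add: is_Dtau_def)
qed

text \<open>
  The exceptional null set in the definition of the time derivative depends on the test function; the countable family
  \<open>bump_family\<close> makes it uniform.
\<close>

lemma is_Dtau_unique:
  assumes T: "0 < T" and D: "is_Dtau T w g" "is_Dtau T w g'"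
  shows "AE z in lebesgue_on (Q T). g z = g' z"
proof -
  have fam: "AE x in lebesgue_on {0<..<pi}. \<forall>\<phi>\<in>bump_family 0 T.
      (\<integral>\<tau>. g (\<tau>, x) * \<phi> \<tau> \<partial>lebesgue_on {0<..<T}) = (\<integral>\<tau>. g' (\<tau>, x) * \<phi> \<tau> \<partial>lebesgue_on {0<..<T})"
    unfolding AE_ball_countable[OF countable_bump_family]
  proof
    fix \<phi> assume "\<phi> \<in> bump_family 0 T"
    then have \<phi>: "\<phi> \<in> test_fun 0 T" by (rule bump_family_test_fun)
    show "AE x in lebesgue_on {0<..<pi}.
      (\<integral>\<tau>. g (\<tau>, x) * \<phi> \<tau> \<partial>lebesgue_on {0<..<T}) = (\<integral>\<tau>. g' (\<tau>, x) * \<phi> \<tau> \<partial>lebesgue_on {0<..<T})"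
      using is_DtauD(2)[OF D(1) \<phi>] is_DtauD(2)[OF D(2) \<phi>] by eventually_elim simp
  qed
  have "AE x in lebesgue_on {0<..<pi}. AE t in lebesgue_on {0<..<T}. g (t, x) = g' (t, x)"
    using fam sq_int_Q_slices(2)[OF is_DtauD(1)[OF D(1)]] sq_int_Q_slices(2)[OF is_DtauD(1)[OF D(2)]]
  proof eventually_elim
    case (elim x)
    have "AE t in lebesgue_on {0<..<T}. g (t, x) - g' (t, x) = 0"
    proof (rule AE_zero_if_bump_integrals_zero[OF T sq_int_diff[OF elim(2,3)]])
      fix \<phi> assume \<phi>: "\<phi> \<in> bump_family 0 T"
      note s = test_fun_sq_int[OF bump_family_test_fun[OF \<phi>], of 0 T]
      show "(\<integral>t. (g (t, x) - g' (t, x)) * \<phi> t \<partial>lebesgue_on {0<..<T}) = 0"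
        using elim(1) \<phi> sq_int_mult[OF elim(2) s] sq_int_mult[OF elim(3) s] by (simp add: left_diff_distrib)
    qed
    then show ?case by eventually_elim simp
  qed
  then show ?thesis
    using AE_Q_eqI[OF sq_intD(1)[OF is_DtauD(1)[OF D(1)]] sq_intD(1)[OF is_DtauD(1)[OF D(2)]]] by blast
qed

lemma is_Dtau_Dtau: "is_Dtau T w g \<Longrightarrow> is_Dtau T w (Dtau T w)"
  unfolding Dtau_def by (rule someI[of "is_Dtau T w"])

lemma Dtau_AE_eq: "0 < T \<Longrightarrow> is_Dtau T w g \<Longrightarrow> AE z in lebesgue_on (Q T). Dtau T w z = g z"
  using is_Dtau_unique is_Dtau_Dtau by blast

lemma X2D:
  assumes "w \<in> X2 T"
  shows "sq_int (lebesgue_on (Q T)) w" "is_Dtau T w (Dtau T w)" "is_Dx T w (Dx T w)" "is_Dx T (Dx T w) (Dxx T w)"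
  using assms is_Dtau_Dtau is_Dx_Dx is_Dx_Dxx by (auto simp: X2_def L2_on_iff)

section \<open>Differences of functions in the solution space\<close>

lemma is_Dx_diff:
  assumes "is_Dx T w g" "is_Dx T w' g'"
  shows "is_Dx T (\<lambda>z. w z - w' z) (\<lambda>z. g z - g' z)"
proof -
  have "AE t in lebesgue_on {0<..<T}. weak_deriv 0 pi (\<lambda>x. w (t, x) - w' (t, x)) (\<lambda>x. g (t, x) - g' (t, x))"
    using is_DxD(2)[OF assms(1)] is_DxD(2)[OF assms(2)]
    by eventually_elim (rule weak_deriv_diff, auto)
  then show ?thesis
    using sq_int_diff[OF is_DxD(1)[OF assms(1)] is_DxD(1)[OF assms(2)]] by (simp add: is_Dx_def L2_on_iff)
qed

lemma is_Dtau_diff: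
  assumes T: "0 < T" and w: "sq_int (lebesgue_on (Q T)) w" "sq_int (lebesgue_on (Q T)) w'"
    and D: "is_Dtau T w g" "is_Dtau T w' g'"
  shows "is_Dtau T (\<lambda>z. w z - w' z) (\<lambda>z. g z - g' z)"
proof -
  have "AE x in lebesgue_on {0<..<pi}.
        (\<integral>\<tau>. (w (\<tau>, x) - w' (\<tau>, x)) * deriv \<phi> \<tau> \<partial>lebesgue_on {0<..<T})
        = - (\<integral>\<tau>. (g (\<tau>, x) - g' (\<tau>, x)) * \<phi> \<tau> \<partial>lebesgue_on {0<..<T})"
    if \<phi>: "\<phi> \<in> test_fun 0 T" for \<phi>
    using is_DtauD(2)[OF D(1) \<phi>] is_DtauD(2)[OF D(2) \<phi>]
      sq_int_Q_slices(2)[OF w(1)] sq_int_Q_slices(2)[OF w(2)]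
      sq_int_Q_slices(2)[OF is_DtauD(1)[OF D(1)]] sq_int_Q_slices(2)[OF is_DtauD(1)[OF D(2)]]
  proof eventually_elim
    case (elim x)
    note s = test_fun_sq_int[OF \<phi>, of 0 T] test_fun_sq_int[OF test_fun_deriv[OF \<phi> T], of 0 T]
    show ?case
      using elim(1,2) sq_int_mult[OF elim(3) s(2)] sq_int_mult[OF elim(4) s(2)]
        sq_int_mult[OF elim(5) s(1)] sq_int_mult[OF elim(6) s(1)]
      by (simp add: left_diff_distrib)
  qed
  then show ?thesis
    using sq_int_diff[OF is_DtauD(1)[OF D(1)] is_DtauD(1)[OF D(2)]] by (simp add: is_Dtau_def L2_on_iff)
qed

lemma L2_norm_diff_le:
  assumes "sq_int (lebesgue_on S) f" "sq_int (lebesgue_on S) g"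
  shows "L2_norm S (\<lambda>x. f x - g x) \<le> L2_norm S f + L2_norm S g"
  using Minkowski_integral[OF assms(1) sq_int_cmult[OF assms(2), of "-1"]] by (simp add: L2_norm_def)

lemma L2_norm_cmult: "L2_norm S (\<lambda>x. c * f x) = \<bar>c\<bar> * L2_norm S f"
  by (simp add: L2_norm_def power_mult_distrib real_sqrt_mult)

lemma L2_norm_nonneg: "0 \<le> L2_norm S f"
  by (simp add: L2_norm_def)

text \<open>
  The derivative used in the approximation may be any weak derivative, since weak derivatives agree almost everywhere.
\<close>

lemma W12_0E:
  assumes "f \<in> W12_0 a b" "weak_deriv a b f g" "a < b" "\<epsilon> > 0"
  obtains \<phi> where "\<phi> \<in> test_fun a b" "L2_norm {a<..<b} (\<lambda>x. \<phi> x - f x) < \<epsilon>"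
    "L2_norm {a<..<b} (\<lambda>x. deriv \<phi> x - g x) < \<epsilon>"
proof -
  obtain h where h: "weak_deriv a b f h" and ap: "\<forall>\<epsilon>>0. \<exists>\<phi>\<in>test_fun a b. L2_norm {a<..<b} (\<lambda>x. \<phi> x - f x) < \<epsilon> \<and>
                              L2_norm {a<..<b} (\<lambda>x. deriv \<phi> x - h x) < \<epsilon>"
    using assms(1) by (auto simp: W12_0_def)
  obtain \<phi> where \<phi>: "\<phi> \<in> test_fun a b" "L2_norm {a<..<b} (\<lambda>x. \<phi> x - f x) < \<epsilon>" "L2_norm {a<..<b} (\<lambda>x. deriv \<phi> x - h x) < \<epsilon>"
    using ap assms(4) by blast
  have "AE t in lebesgue_on {a<..<b}. h t = g t" by (rule weak_deriv_unique[OF assms(3) h assms(2)])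
  then have "AE t in lebesgue_on {a<..<b}. (deriv \<phi> t - h t)\<^sup>2 = (deriv \<phi> t - g t)\<^sup>2" by eventually_elim simp
  moreover have "(\<lambda>t. (deriv \<phi> t - h t)\<^sup>2) \<in> borel_measurable (lebesgue_on {a<..<b})"
    "(\<lambda>t. (deriv \<phi> t - g t)\<^sup>2) \<in> borel_measurable (lebesgue_on {a<..<b})"
    using sq_intD(1)[OF weak_derivD(2)[OF h]] sq_intD(1)[OF weak_derivD(2)[OF assms(2)]]
      sq_intD(1)[OF test_fun_sq_int[OF test_fun_deriv[OF \<phi>(1) assms(3)]]] by auto
  ultimately have "L2_norm {a<..<b} (\<lambda>x. deriv \<phi> x - h x) = L2_norm {a<..<b} (\<lambda>x. deriv \<phi> x - g x)"
    unfolding L2_norm_def by (intro arg_cong[where f = sqrt] integral_cong_AE)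
  with \<phi> show thesis by (intro that[of \<phi>]) auto
qed

lemma W12_0_weak_deriv: "f \<in> W12_0 a b \<Longrightarrow> \<exists>g. weak_deriv a b f g"
  by (auto simp: W12_0_def)

lemma W12_0_diff:
  assumes f: "f \<in> W12_0 a b" "f' \<in> W12_0 a b" and ab: "a < b"
  shows "(\<lambda>x. f x - f' x) \<in> W12_0 a b"
proof -
  obtain g where g: "weak_deriv a b f g" using W12_0_weak_deriv[OF f(1)] by blast
  obtain g' where g': "weak_deriv a b f' g'" using W12_0_weak_deriv[OF f(2)] by blast
  have "\<exists>\<phi>\<in>test_fun a b. L2_norm {a<..<b} (\<lambda>x. \<phi> x - (f x - f' x)) < \<epsilon> \<and>
                              L2_norm {a<..<b} (\<lambda>x. deriv \<phi> x - (g x - g' x)) < \<epsilon>" if "\<epsilon> > 0" for \<epsilon>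
  proof -
    have e2: "\<epsilon> / 2 > 0" using that by simp
    obtain \<phi> where \<phi>: "\<phi> \<in> test_fun a b" "L2_norm {a<..<b} (\<lambda>x. \<phi> x - f x) < \<epsilon> / 2"
      "L2_norm {a<..<b} (\<lambda>x. deriv \<phi> x - g x) < \<epsilon> / 2"
      using W12_0E[OF f(1) g ab e2] by blast
    obtain \<psi> where \<psi>: "\<psi> \<in> test_fun a b" "L2_norm {a<..<b} (\<lambda>x. \<psi> x - f' x) < \<epsilon> / 2"
      "L2_norm {a<..<b} (\<lambda>x. deriv \<psi> x - g' x) < \<epsilon> / 2"
      using W12_0E[OF f(2) g' ab e2] by blast
    have d: "deriv (\<lambda>x. \<phi> x - \<psi> x) x = deriv \<phi> x - deriv \<psi> x" for x
      by (intro DERIV_imp_deriv DERIV_diff test_fun_has_deriv[OF \<phi>(1)] test_fun_has_deriv[OF \<psi>(1)])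
    note s = test_fun_sq_int[OF \<phi>(1), of a b] test_fun_sq_int[OF \<psi>(1), of a b]
      test_fun_sq_int[OF test_fun_deriv[OF \<phi>(1) ab], of a b] test_fun_sq_int[OF test_fun_deriv[OF \<psi>(1) ab], of a b]
    have "L2_norm {a<..<b} (\<lambda>x. (\<phi> x - f x) - (\<psi> x - f' x)) < \<epsilon>"
      using L2_norm_diff_le[OF sq_int_diff[OF s(1) weak_derivD(1)[OF g]] sq_int_diff[OF s(2) weak_derivD(1)[OF g']]]
        \<phi>(2) \<psi>(2) by simp
    moreover have "L2_norm {a<..<b} (\<lambda>x. (deriv \<phi> x - g x) - (deriv \<psi> x - g' x)) < \<epsilon>"
      using L2_norm_diff_le[OF sq_int_diff[OF s(3) weak_derivD(2)[OF g]] sq_int_diff[OF s(4) weak_derivD(2)[OF g']]]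
        \<phi>(3) \<psi>(3) by simp
    ultimately show ?thesis
      by (intro bexI[OF _ test_fun_diff[OF \<phi>(1) \<psi>(1)]]) (simp add: d algebra_simps)
  qed
  then show ?thesis
    unfolding W12_0_def using weak_deriv_diff[OF ab g g'] by blast
qed

lemma zero_initial_diff:
  assumes "zero_initial T w" "zero_initial T w'"
  shows "zero_initial T (\<lambda>z. w z - w' z)"
proof -
  obtain W where W: "\<forall>t\<in>{0..T}. W t \<in> L2_on {0<..<pi}"
     "\<forall>t\<in>{0..T}. ((\<lambda>s. L2_norm {0<..<pi} (\<lambda>x. W s x - W t x)) \<longlongrightarrow> 0) (at t within {0..T})"
     "AE t in lebesgue_on {0<..<T}. AE x in lebesgue_on {0<..<pi}. W t x = w (t, x)"
     "AE x in lebesgue_on {0<..<pi}. W 0 x = 0"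
    using assms(1) unfolding zero_initial_def by blast
  obtain V where V: "\<forall>t\<in>{0..T}. V t \<in> L2_on {0<..<pi}"
     "\<forall>t\<in>{0..T}. ((\<lambda>s. L2_norm {0<..<pi} (\<lambda>x. V s x - V t x)) \<longlongrightarrow> 0) (at t within {0..T})"
     "AE t in lebesgue_on {0<..<T}. AE x in lebesgue_on {0<..<pi}. V t x = w' (t, x)"
     "AE x in lebesgue_on {0<..<pi}. V 0 x = 0"
    using assms(2) unfolding zero_initial_def by blast
  show ?thesis
    unfolding zero_initial_def
  proof (intro exI[of _ "\<lambda>t x. W t x - V t x"] conjI ballI)
    fix t assume t: "t \<in> {0..T}"
    show "(\<lambda>x. W t x - V t x) \<in> L2_on {0<..<pi}"
      using W(1) V(1) t by (simp add: L2_on_iff sq_int_diff)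
    show "((\<lambda>s. L2_norm {0<..<pi} (\<lambda>x. W s x - V s x - (W t x - V t x))) \<longlongrightarrow> 0) (at t within {0..T})"
    proof (rule tendsto_sandwich[OF _ _ tendsto_const])
      show "((\<lambda>s. L2_norm {0<..<pi} (\<lambda>x. W s x - W t x) + L2_norm {0<..<pi} (\<lambda>x. V s x - V t x)) \<longlongrightarrow> 0) (at t within {0..T})"
        using tendsto_add[of _ 0 _ _ 0] W(2) V(2) t by fastforce
      show "\<forall>\<^sub>F s in at t within {0..T}. L2_norm {0<..<pi} (\<lambda>x. W s x - V s x - (W t x - V t x))
          \<le> L2_norm {0<..<pi} (\<lambda>x. W s x - W t x) + L2_norm {0<..<pi} (\<lambda>x. V s x - V t x)"
        unfolding eventually_at_filter
      proof (rule always_eventually, intro allI impI)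
        fix s assume s: "s \<in> {0..T}"
        have "L2_norm {0<..<pi} (\<lambda>x. (W s x - W t x) - (V s x - V t x))
          \<le> L2_norm {0<..<pi} (\<lambda>x. W s x - W t x) + L2_norm {0<..<pi} (\<lambda>x. V s x - V t x)"
          using W(1) V(1) s t by (intro L2_norm_diff_le sq_int_diff) (simp_all add: L2_on_iff)
        then show "L2_norm {0<..<pi} (\<lambda>x. W s x - V s x - (W t x - V t x))
          \<le> L2_norm {0<..<pi} (\<lambda>x. W s x - W t x) + L2_norm {0<..<pi} (\<lambda>x. V s x - V t x)"
          by (simp add: algebra_simps)
      qed
    qed (simp add: L2_norm_nonneg)
  next
    show "AE t in lebesgue_on {0<..<T}. AE x in lebesgue_on {0<..<pi}. W t x - V t x = w (t, x) - w' (t, x)"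
      using W(3) V(3)
    proof eventually_elim
      case (elim t)
      then show ?case by eventually_elim simp
    qed
    show "AE x in lebesgue_on {0<..<pi}. W 0 x - V 0 x = 0"
      using W(4) V(4) by eventually_elim simp
  qed
qed

section \<open>Recovering a function from its time derivative\<close>

lemma sq_int_indicator_Ioo: "sq_int lborel (indicat_real {a<..<b::real})"
proof -
  have "integrable lborel (indicat_real {a<..<b})"
    using emeasure_bounded_finite[of "{a<..<b}"] by simp
  moreover have "(\<lambda>x. (indicat_real {a<..<b} x)\<^sup>2) = indicat_real {a<..<b}"
    by (auto simp: indicator_def)
  ultimately show ?thesis by (simp add: sq_int_def)
qed

lemma sq_int_imp_integrable_bounded_support:
  fixes f :: "real \<Rightarrow> real"
  assumes f: "sq_int lborel f" and z: "\<And>t. t \<notin> {a<..<b} \<Longrightarrow> f t = 0"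
  shows "integrable lborel f"
proof -
  from sq_int_mult[OF f sq_int_indicator_Ioo] have "integrable lborel (\<lambda>t. f t * indicat_real {a<..<b} t)" .
  moreover have "f t * indicat_real {a<..<b} t = f t" for t using z[of t] by (auto simp: indicator_def)
  ultimately show ?thesis by simp
qed

lemma test_fun_lborel:
  assumes \<phi>: "\<phi> \<in> test_fun a b"
  shows "integrable lborel \<phi>" "(\<integral>t. \<phi> t \<partial>lebesgue_on {a<..<b}) = (\<integral>t. \<phi> t \<partial>lborel)"
  using lebesgue_on_transfer[of "{a<..<b}" \<phi>] test_fun_borel[OF \<phi>] test_fun_zero[OF \<phi>]
    continuous_integral_Ioo(1)[OF test_fun_continuous[OF \<phi>]] by auto

lemma integral_test_fun_deriv_tail:
  assumes \<phi>: "\<phi> \<in> test_fun 0 T" and s: "0 < s" "s < T"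
  shows "(\<integral>t. (if s < t then deriv \<phi> t else 0) \<partial>lborel) = - \<phi> s"
proof -
  have T: "0 < T" using s by simp
  note d = test_fun_deriv[OF \<phi> T]
  have [measurable]: "deriv \<phi> \<in> borel_measurable borel" by (rule test_fun_borel[OF d])
  define f where "f t = indicat_real {s<..<T} t * deriv \<phi> t" for t
  have "(if s < t then deriv \<phi> t else 0) = f t" for t
    using test_fun_zero[OF d, of t] s by (auto simp: f_def indicator_def)
  then have "(\<integral>t. (if s < t then deriv \<phi> t else 0) \<partial>lborel) = (\<integral>t. f t \<partial>lborel)" by simp
  also have "\<dots> = (\<integral>t. deriv \<phi> t \<partial>lebesgue_on {s<..<T})"
    using borel_rep_integral(2)[OF _ borel_rep_indicator[of "{s<..<T}" "deriv \<phi>"]] by (simp add: f_def)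
  also have "\<dots> = integral {s..T} (deriv \<phi>)"
    by (rule continuous_integral_Ioo(2)[OF test_fun_continuous[OF d]])
  also have "\<dots> = \<phi> T - \<phi> s"
  proof (rule integral_unique, rule fundamental_theorem_of_calculus)
    show "(\<phi> has_vector_derivative deriv \<phi> t) (at t within {s..T})" for t
      using has_field_derivative_at_within[OF test_fun_has_deriv[OF \<phi>]]
      by (simp add: has_real_derivative_iff_has_vector_derivative)
  qed (use s in simp)
  also have "\<phi> T = 0" by (rule test_fun_zero[OF \<phi>]) simp
  finally show ?thesis by simp
qed

lemma integrable_product_lborel:
  fixes f :: "'a::euclidean_space \<Rightarrow> real" and g :: "'b::euclidean_space \<Rightarrow> real"
  assumes f: "integrable lborel f" and g: "integrable lborel g"
  shows "integrable (lborel \<Otimes>\<^sub>M lborel) (\<lambda>(s, t). f s * g t)"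
proof (rule lborel_pair.Fubini_integrable)
  have [measurable]: "f \<in> borel_measurable borel" "g \<in> borel_measurable borel" using f g by auto
  show "(\<lambda>(s, t). f s * g t) \<in> borel_measurable (lborel \<Otimes>\<^sub>M lborel)" by measurable
  show "integrable lborel (\<lambda>x. LINT y|lborel. norm (case (x, y) of (s, t) \<Rightarrow> f s * g t))"
    using f by (simp add: abs_mult)
  show "AE x in lborel. integrable lborel (\<lambda>y. case (x, y) of (s, t) \<Rightarrow> f s * g t)"
    using g by simp
qed

text \<open>
  The integral from \<open>-\<infinity>\<close> to \<open>t\<close>. For functions that vanish at negative times it is the integral from \<open>0\<close> to \<open>t\<close>.
\<close>

definition primitive :: "(real \<Rightarrow> real) \<Rightarrow> real \<Rightarrow> real" where
  "primitive f t = (\<integral>s. (if s < t then f s else 0) \<partial>lborel)"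

lemma primitive_abs_le:
  assumes "integrable lborel f"
  shows "\<bar>primitive f t\<bar> \<le> (\<integral>s. \<bar>f s\<bar> \<partial>lborel)"
proof -
  have [measurable]: "f \<in> borel_measurable borel" using assms by auto
  have i: "integrable lborel (\<lambda>s. if s < t then f s else 0)"
    by (rule Bochner_Integration.integrable_bound[OF assms]) auto
  have "\<bar>primitive f t\<bar> \<le> (\<integral>s. \<bar>if s < t then f s else 0\<bar> \<partial>lborel)"
    unfolding primitive_def using integral_norm_bound[of lborel "\<lambda>s. if s < t then f s else 0"] by simp
  also have "\<dots> \<le> (\<integral>s. \<bar>f s\<bar> \<partial>lborel)"
    using i assms by (intro integral_mono) auto
  finally show ?thesis .
qed

lemma primitive_measurable2 [measurable]:
  assumes [measurable]: "f \<in> borel_measurable (borel \<Otimes>\<^sub>M borel)"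
  shows "(\<lambda>z. primitive (\<lambda>s. f (s, snd z)) (fst z)) \<in> borel_measurable (borel \<Otimes>\<^sub>M borel)"
  unfolding primitive_def by measurable

lemma primitive_by_parts:
  assumes \<phi>: "\<phi> \<in> test_fun 0 T" and T: "0 < T" and f: "integrable lborel f" and z: "\<And>t. t \<notin> {0<..<T} \<Longrightarrow> f t = 0"
  shows "(\<integral>t. primitive f t * deriv \<phi> t \<partial>lborel) = - (\<integral>t. f t * \<phi> t \<partial>lborel)"
proof -
  note d = test_fun_deriv[OF \<phi> T]
  have [measurable]: "deriv \<phi> \<in> borel_measurable borel" by (rule test_fun_borel[OF d])
  have [measurable]: "f \<in> borel_measurable borel" using f by auto
  define F where "F s t = f s * (if s < t then deriv \<phi> t else 0)" for s t
  have i: "integrable (lborel \<Otimes>\<^sub>M lborel) (\<lambda>(s, t). F s t)"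
  proof (rule Bochner_Integration.integrable_bound[OF integrable_product_lborel[OF f test_fun_lborel(1)[OF d]]])
    show "(\<lambda>(s, t). F s t) \<in> borel_measurable (lborel \<Otimes>\<^sub>M lborel)" unfolding F_def by measurable
    show "AE z in lborel \<Otimes>\<^sub>M lborel. norm (case z of (s, t) \<Rightarrow> F s t) \<le> norm (case z of (s, t) \<Rightarrow> f s * deriv \<phi> t)"
      by (auto simp: F_def)
  qed
  have "(\<integral>t. (\<integral>s. F s t \<partial>lborel) \<partial>lborel) = (\<integral>s. (\<integral>t. F s t \<partial>lborel) \<partial>lborel)"
    by (rule lborel_pair.Fubini_integral[OF i])
  moreover have "(\<integral>s. F s t \<partial>lborel) = primitive f t * deriv \<phi> t" for t
  proof -
    have "(\<integral>s. F s t \<partial>lborel) = (\<integral>s. (if s < t then f s else 0) * deriv \<phi> t \<partial>lborel)"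
      by (intro Bochner_Integration.integral_cong) (auto simp: F_def)
    then show ?thesis by (simp add: primitive_def)
  qed
  moreover have "(\<integral>t. F s t \<partial>lborel) = - (f s * \<phi> s)" for s
    using z[of s] integral_test_fun_deriv_tail[OF \<phi>, of s] by (cases "s \<in> {0<..<T}") (auto simp: F_def)
  ultimately show ?thesis by simp
qed

lemma ex_good_time:
  fixes T \<delta> :: real
  assumes P: "AE t in lebesgue_on {0<..<T}. P t" and "0 < T" "0 < \<delta>"
  shows "\<exists>t. 0 < t \<and> t < \<delta> \<and> t < T \<and> P t"
proof (rule ccontr)
  assume n: "\<not> ?thesis"
  have "AE t in lborel. t \<in> {0<..<T} \<longrightarrow> P t" using P unfolding AE_lebesgue_on_iff[OF borel_open[OF open_greaterThanLessThan]] .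
  then have "AE t in lborel. t \<notin> {0<..<min \<delta> T}"
    by eventually_elim (use n in auto)
  then have "{0<..<min \<delta> T} \<in> null_sets lborel"
    by (subst AE_iff_null_sets) auto
  then have "emeasure lborel {0<..<min \<delta> T} = 0"
    by (rule null_setsD1)
  then show False using assms by simp
qed

lemma ex_bump_integral_nonzero:
  assumes "0 < T"
  shows "\<exists>\<phi>\<in>bump_family 0 T. (\<integral>t. \<phi> t \<partial>lebesgue_on {0<..<T}) \<noteq> 0"
proof (rule ccontr)
  assume n: "\<not> ?thesis"
  have "AE t in lebesgue_on {0<..<T}. (1::real) = 0"
    by (rule AE_zero_if_bump_integrals_zero[OF assms continuous_sq_int_Ioo]) (use n in auto)
  from ex_good_time[OF this assms assms] show False by auto
qed

text \<open>
  The time derivative determines the function up to a term \<open>c(x)\<close> that is constant in time. Its value is found by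
  testing with one function \<open>\<phi>0\<close> of nonzero mean.
\<close>

lemma weak_time_primitive:
  assumes T: "0 < T" and w: "sq_int (lebesgue_on (Q T)) w" and D: "is_Dtau T w g"
    and r: "borel_rep (Q T) g g'"
  shows "\<exists>c. c \<in> borel_measurable borel \<and>
    (AE z in lebesgue_on (Q T). w z = c (snd z) + primitive (\<lambda>s. g' (s, snd z)) (fst z))"
proof -
  have S: "{0<..<T} \<in> sets borel" "{0<..<pi} \<in> sets borel" by auto
  obtain w' where rw: "borel_rep (Q T) w w'"
    using ex_borel_rep[OF Q_borel sq_intD(1)[OF w]] by (elim exE)
  have [measurable]: "g' \<in> borel_measurable (borel \<Otimes>\<^sub>M borel)" "w' \<in> borel_measurable (borel \<Otimes>\<^sub>M borel)"
    using borel_repD(1)[OF r] borel_repD(1)[OF rw] by (simp_all add: borel_prod)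
  have sq: "sq_int lborel g'" "sq_int lborel w'"
    using borel_rep_sq_int[OF Q_borel r] is_DtauD(1)[OF D] borel_rep_sq_int[OF Q_borel rw] w by auto
  have gz: "g' (t, x) = 0" if "t \<notin> {0<..<T}" for t x
    using borel_repD(2)[OF r, of "(t, x)"] that by (auto simp: Q_def)
  obtain \<phi>0 where \<phi>0: "\<phi>0 \<in> bump_family 0 T" "(\<integral>t. \<phi>0 t \<partial>lebesgue_on {0<..<T}) \<noteq> 0"
    using ex_bump_integral_nonzero[OF T] by blast
  have t\<phi>0: "\<phi>0 \<in> test_fun 0 T" by (rule bump_family_test_fun[OF \<phi>0(1)])
  have [measurable]: "\<phi>0 \<in> borel_measurable borel" by (rule test_fun_borel[OF t\<phi>0])
  define I where "I \<phi> = (\<integral>t. \<phi> t \<partial>lborel)" for \<phi> :: "real \<Rightarrow> real"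
  have I0: "I \<phi>0 \<noteq> 0" using \<phi>0(2) test_fun_lborel(2)[OF t\<phi>0] by (simp add: I_def)
  define K where "K z = primitive (\<lambda>s. g' (s, snd z)) (fst z)" for z :: "real \<times> real"
  have [measurable]: "K \<in> borel_measurable (borel \<Otimes>\<^sub>M borel)" unfolding K_def by measurable
  define c where "c x = (\<integral>t. (w' (t, x) - K (t, x)) * \<phi>0 t \<partial>lborel) / I \<phi>0" for x
  have [measurable]: "c \<in> borel_measurable borel" unfolding c_def by measurable
  (* Each member of the family, corrected by a multiple of \<phi>0 to have mean zero, is the derivative
     of a test function. *)
  define psi where "psi \<phi> t = \<phi> t - (I \<phi> / I \<phi>0) * \<phi>0 t" for \<phi> :: "real \<Rightarrow> real" and t
  have psi: "\<exists>\<xi>\<in>test_fun 0 T. deriv \<xi> = psi \<phi>" if "\<phi> \<in> bump_family 0 T" for \<phi>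
  proof -
    have t\<phi>: "\<phi> \<in> test_fun 0 T" by (rule bump_family_test_fun[OF that])
    have t: "psi \<phi> \<in> test_fun 0 T"
      unfolding psi_def by (intro test_fun_diff t\<phi> test_fun_cmult t\<phi>0)
    have "(\<integral>t. psi \<phi> t \<partial>lborel) = 0"
      unfolding psi_def using test_fun_lborel(1)[OF t\<phi>] test_fun_lborel(1)[OF t\<phi>0] I0 by (simp add: I_def)
    then have "(\<integral>t. psi \<phi> t \<partial>lebesgue_on {0<..<T}) = 0" using test_fun_lborel(2)[OF t] by simp
    from test_fun_antideriv[OF T t this] show ?thesis by blast
  qed
  have "AE x in lebesgue_on {0<..<pi}. \<forall>\<phi>\<in>bump_family 0 T.
      (\<integral>t. w' (t, x) * psi \<phi> t \<partial>lborel) = (\<integral>t. K (t, x) * psi \<phi> t \<partial>lborel)"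
    unfolding AE_ball_countable[OF countable_bump_family]
  proof
    fix \<phi> assume \<phi>: "\<phi> \<in> bump_family 0 T"
    obtain \<xi> where \<xi>: "\<xi> \<in> test_fun 0 T" "deriv \<xi> = psi \<phi>" using psi[OF \<phi>] by blast
    have m: "\<xi> \<in> borel_measurable borel" "psi \<phi> \<in> borel_measurable borel"
      using test_fun_borel[OF \<xi>(1)] test_fun_borel[OF test_fun_deriv[OF \<xi>(1) T]] \<xi>(2) by auto
    show "AE x in lebesgue_on {0<..<pi}.
      (\<integral>t. w' (t, x) * psi \<phi> t \<partial>lborel) = (\<integral>t. K (t, x) * psi \<phi> t \<partial>lborel)"
      using is_DtauD(2)[OF D \<xi>(1)] borel_rep_slices(2)[OF r] borel_rep_slices(2)[OF rw]
        AE_lborel_imp_lebesgue_on[OF S(2) sq_int_slices(2)[OF sq(1)]]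
    proof eventually_elim
      case (elim x)
      have gi: "integrable lborel (\<lambda>t. g' (t, x))"
        by (rule sq_int_imp_integrable_bounded_support[OF elim(4)]) (rule gz)
      have "(\<integral>t. w' (t, x) * psi \<phi> t \<partial>lborel) = - (\<integral>t. g' (t, x) * \<xi> t \<partial>lborel)"
        using elim(1) borel_rep_integral(2)[OF S(1) borel_rep_mult_fun[OF elim(2) m(1)]]
          borel_rep_integral(2)[OF S(1) borel_rep_mult_fun[OF elim(3) m(2)]] \<xi>(2) by simp
      also have "\<dots> = (\<integral>t. K (t, x) * psi \<phi> t \<partial>lborel)"
        using primitive_by_parts[OF \<xi>(1) T gi] gz \<xi>(2) by (simp add: K_def)
      finally show ?case .
    qed
  qed
  then have "AE x in lebesgue_on {0<..<pi}. AE t in lebesgue_on {0<..<T}. w' (t, x) = c x + K (t, x)"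
    using AE_lborel_imp_lebesgue_on[OF S(2) sq_int_slices(2)[OF sq(1)]]
      AE_lborel_imp_lebesgue_on[OF S(2) sq_int_slices(2)[OF sq(2)]]
  proof eventually_elim
    case (elim x)
    have gi: "integrable lborel (\<lambda>t. g' (t, x))"
      by (rule sq_int_imp_integrable_bounded_support[OF elim(2)]) (rule gz)
    have Km: "(\<lambda>t. K (t, x)) \<in> borel_measurable borel" by measurable
    have sK: "sq_int (lebesgue_on {0<..<T}) (\<lambda>t. K (t, x))"
      by (rule sq_int_finite_measure[OF finite_lebesgue_on_Ioo borel_measurable_imp_lebesgue_on[OF Km]])
        (use primitive_abs_le[OF gi] in \<open>simp add: K_def\<close>)
    have sw: "sq_int (lebesgue_on {0<..<T}) (\<lambda>t. w' (t, x))"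
    proof -
      have "borel_rep {0<..<T} (\<lambda>t. w' (t, x)) (\<lambda>t. w' (t, x))"
        using borel_repD(2)[OF rw] by (auto simp: borel_rep_def Q_def)
      then show ?thesis using elim(3) borel_rep_sq_int[OF S(1)] by blast
    qed
    have s1: "sq_int (lebesgue_on {0<..<T}) (\<lambda>_. k)" for k :: real
      by (rule continuous_sq_int_Ioo) simp
    have "AE t in lebesgue_on {0<..<T}. (w' (t, x) - K (t, x)) - c x = 0"
    proof (rule AE_zero_if_bump_integrals_zero[OF T sq_int_diff[OF sq_int_diff[OF sw sK] s1]])
      fix \<phi> assume \<phi>: "\<phi> \<in> bump_family 0 T"
      have t\<phi>: "\<phi> \<in> test_fun 0 T" by (rule bump_family_test_fun[OF \<phi>])
      have tr: "(\<integral>t. f t * \<psi> t \<partial>lebesgue_on {0<..<T}) = (\<integral>t. f t * \<psi> t \<partial>lborel)"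
        "integrable (lebesgue_on {0<..<T}) (\<lambda>t. f t * \<psi> t) \<longleftrightarrow> integrable lborel (\<lambda>t. f t * \<psi> t)"
        if "f \<in> borel_measurable borel" "\<psi> \<in> test_fun 0 T" for f \<psi> :: "real \<Rightarrow> real"
        using lebesgue_on_transfer[of "{0<..<T}" "\<lambda>t. f t * \<psi> t"] that test_fun_zero[OF that(2)] test_fun_borel[OF that(2)]
        by auto
      have wm: "(\<lambda>t. w' (t, x)) \<in> borel_measurable borel" by measurable
      have i: "integrable lborel (\<lambda>t. w' (t, x) * \<psi> t)" "integrable lborel (\<lambda>t. K (t, x) * \<psi> t)"
        if "\<psi> \<in> test_fun 0 T" for \<psi>
        using tr(2)[OF wm that] tr(2)[OF Km that] sq_int_mult[OF sw test_fun_sq_int[OF that]]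
          sq_int_mult[OF sK test_fun_sq_int[OF that]] by auto
      note ii = i[OF t\<phi>] i[OF t\<phi>0]
      have "(\<integral>t. w' (t, x) * psi \<phi> t \<partial>lborel) = (\<integral>t. w' (t, x) * \<phi> t - (I \<phi> / I \<phi>0) * (w' (t, x) * \<phi>0 t) \<partial>lborel)"
        by (intro Bochner_Integration.integral_cong) (auto simp: psi_def algebra_simps)
      then have 1: "(\<integral>t. w' (t, x) * psi \<phi> t \<partial>lborel) = (\<integral>t. w' (t, x) * \<phi> t \<partial>lborel) - (I \<phi> / I \<phi>0) * (\<integral>t. w' (t, x) * \<phi>0 t \<partial>lborel)"
        using ii by simp
      have "(\<integral>t. K (t, x) * psi \<phi> t \<partial>lborel) = (\<integral>t. K (t, x) * \<phi> t - (I \<phi> / I \<phi>0) * (K (t, x) * \<phi>0 t) \<partial>lborel)"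
        by (intro Bochner_Integration.integral_cong) (auto simp: psi_def algebra_simps)
      then have 2: "(\<integral>t. K (t, x) * psi \<phi> t \<partial>lborel) = (\<integral>t. K (t, x) * \<phi> t \<partial>lborel) - (I \<phi> / I \<phi>0) * (\<integral>t. K (t, x) * \<phi>0 t \<partial>lborel)"
        using ii by simp
      have 3: "c x * I \<phi>0 = (\<integral>t. w' (t, x) * \<phi>0 t \<partial>lborel) - (\<integral>t. K (t, x) * \<phi>0 t \<partial>lborel)"
      proof -
        have "(\<integral>t. (w' (t, x) - K (t, x)) * \<phi>0 t \<partial>lborel) = (\<integral>t. w' (t, x) * \<phi>0 t \<partial>lborel) - (\<integral>t. K (t, x) * \<phi>0 t \<partial>lborel)"
          using ii by (simp add: left_diff_distrib)
        then show ?thesis using I0 by (simp add: c_def)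
      qed
      have 4: "(\<integral>t. w' (t, x) * \<phi> t \<partial>lborel) - (\<integral>t. K (t, x) * \<phi> t \<partial>lborel) = c x * I \<phi>"
      proof -
        have e: "(\<integral>t. w' (t, x) * psi \<phi> t \<partial>lborel) = (\<integral>t. K (t, x) * psi \<phi> t \<partial>lborel)"
          using elim(1) \<phi> by blast
        have "(\<integral>t. w' (t, x) * \<phi> t \<partial>lborel) - (\<integral>t. K (t, x) * \<phi> t \<partial>lborel)
            = (I \<phi> / I \<phi>0) * ((\<integral>t. w' (t, x) * \<phi>0 t \<partial>lborel) - (\<integral>t. K (t, x) * \<phi>0 t \<partial>lborel))"
          using e unfolding 1 2 by (simp add: right_diff_distrib)
        also have "\<dots> = c x * I \<phi>" unfolding 3[symmetric] using I0 by simp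
        finally show ?thesis .
      qed
      have "(\<integral>t. (w' (t, x) - K (t, x) - c x) * \<phi> t \<partial>lebesgue_on {0<..<T})
          = (\<integral>t. (w' (t, x) - K (t, x) - c x) * \<phi> t \<partial>lborel)"
        by (rule tr(1)[OF _ t\<phi>]) measurable
      also have "\<dots> = (\<integral>t. w' (t, x) * \<phi> t - K (t, x) * \<phi> t - c x * \<phi> t \<partial>lborel)"
        by (simp add: left_diff_distrib)
      also have "\<dots> = (\<integral>t. w' (t, x) * \<phi> t \<partial>lborel) - (\<integral>t. K (t, x) * \<phi> t \<partial>lborel) - c x * I \<phi>"
        using ii test_fun_lborel(1)[OF t\<phi>] by (simp add: I_def)
      finally show "(\<integral>t. (w' (t, x) - K (t, x) - c x) * \<phi> t \<partial>lebesgue_on {0<..<T}) = 0"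
        using 4 by simp
    qed
    then show ?case by eventually_elim simp
  qed
  moreover have m: "w' \<in> borel_measurable (lebesgue_on (Q T))"
    using borel_measurable_imp_lebesgue_on[OF borel_repD(1)[OF rw]] .
  moreover have "(\<lambda>z. c (snd z) + K z) \<in> borel_measurable (lebesgue_on (Q T))"
    by (rule borel_measurable_imp_lebesgue_on) (simp flip: borel_prod)
  ultimately have "AE z in lebesgue_on (Q T). w' z = c (snd z) + K z"
    by (intro AE_Q_eqI) auto
  with borel_repD(3)[OF rw] have "AE z in lebesgue_on (Q T). w z = c (snd z) + K z"
    by eventually_elim simp
  then show ?thesis unfolding K_def by (intro exI[of _ c]) simp
qed

lemma lborel_integral_iterated:
  fixes f :: "real \<times> real \<Rightarrow> real"
  assumes "integrable lborel f"
  shows "(\<integral>z. f z \<partial>lborel) = (\<integral>t. (\<integral>x. f (t, x) \<partial>lborel) \<partial>lborel)"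
    and "(\<integral>z. f z \<partial>lborel) = (\<integral>x. (\<integral>t. f (t, x) \<partial>lborel) \<partial>lborel)"
    and "integrable lborel (\<lambda>x. \<integral>t. f (t, x) \<partial>lborel)"
proof -
  have i: "integrable (lborel \<Otimes>\<^sub>M lborel) (\<lambda>(t, x). f (t, x))"
    unfolding lborel_prod using assms by (simp add: case_prod_beta')
  have "integral\<^sup>L (lborel \<Otimes>\<^sub>M lborel) (\<lambda>(t, x). f (t, x)) = (\<integral>z. f z \<partial>lborel)"
    unfolding lborel_prod by (simp add: case_prod_beta')
  then show "(\<integral>z. f z \<partial>lborel) = (\<integral>t. (\<integral>x. f (t, x) \<partial>lborel) \<partial>lborel)"
    "(\<integral>z. f z \<partial>lborel) = (\<integral>x. (\<integral>t. f (t, x) \<partial>lborel) \<partial>lborel)"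
    using lborel_pair.integral_fst[OF i] lborel_pair.integral_snd[OF i] by simp_all
  show "integrable lborel (\<lambda>x. \<integral>t. f (t, x) \<partial>lborel)"
    using lborel_pair.integrable_snd[OF i] by simp
qed

text \<open>
  The initial condition gives \<open>c = 0\<close>: for almost all small \<open>t\<close> the function \<open>c\<close> is the difference of
  \<open>w(t,\<cdot>)\<close> and a primitive, which are both small in \<open>L\<^sup>2(0,\<pi>)\<close>.
\<close>

lemma zero_initial_time_primitive:
  assumes T: "0 < T" and w: "sq_int (lebesgue_on (Q T)) w" and D: "is_Dtau T w g"
    and zi: "zero_initial T w" and r: "borel_rep (Q T) g g'"
  shows "AE z in lebesgue_on (Q T). w z = primitive (\<lambda>s. g' (s, snd z)) (fst z)"
proof -
  have S: "{0<..<T} \<in> sets borel" "{0<..<pi} \<in> sets borel" by auto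
  define K where "K z = primitive (\<lambda>s. g' (s, snd z)) (fst z)" for z :: "real \<times> real"
  obtain c where c [measurable]: "c \<in> borel_measurable borel"
    and wc: "AE z in lebesgue_on (Q T). w z = c (snd z) + K z"
    using weak_time_primitive[OF T w D r] unfolding K_def by blast
  have [measurable]: "g' \<in> borel_measurable (borel \<Otimes>\<^sub>M borel)"
    using borel_repD(1)[OF r] by (simp add: borel_prod)
  have [measurable]: "K \<in> borel_measurable (borel \<Otimes>\<^sub>M borel)" unfolding K_def by measurable
  have sg: "sq_int lborel g'" using borel_rep_sq_int[OF Q_borel r] is_DtauD(1)[OF D] by simp
  have gz: "g' (t, x) = 0" if "t \<notin> {0<..<T} \<or> x \<notin> {0<..<pi}" for t x
    using borel_repD(2)[OF r, of "(t, x)"] that by (auto simp: Q_def)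
  define G where "G x = (\<integral>s. (g' (s, x))\<^sup>2 \<partial>lborel)" for x
  have G: "integrable lborel G" "\<And>x. 0 \<le> G x"
    unfolding G_def using lborel_integral_iterated(3)[OF sq_intD(2)[OF sg]] by auto
  define \<Gamma> where "\<Gamma> = (\<integral>x. G x \<partial>lborel)"
  have \<Gamma>: "0 \<le> \<Gamma>" using G(2) by (simp add: \<Gamma>_def)
  have K0: "K (t, x) = 0" if "x \<notin> {0<..<pi}" for t x
    using gz that by (simp add: K_def primitive_def)
  (* Cauchy-Schwarz on (0,t); this is what makes K small near the initial time. *)
  have Kle: "AE x in lborel. \<forall>t\<in>{0<..}. (K (t, x))\<^sup>2 \<le> t * G x"
    using sq_int_slices(2)[OF sg]
  proof eventually_elim
    case (elim x)
    show ?case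
    proof
      fix t :: real assume t: "t \<in> {0<..}"
      have i: "sq_int lborel (indicat_real {0<..<t})" by (rule sq_int_indicator_Ioo)
      have "(\<integral>s. g' (s, x) * indicat_real {0<..<t} s \<partial>lborel)\<^sup>2 \<le> G x * (\<integral>s. (indicat_real {0<..<t} s)\<^sup>2 \<partial>lborel)"
        unfolding G_def by (rule Cauchy_Schwarz_integral[OF elim i])
      also have "(\<integral>s. (indicat_real {0<..<t} s)\<^sup>2 \<partial>lborel) = t"
        using t by (simp add: power2_eq_square flip: indicator_inter_arith)
      also have "(\<integral>s. g' (s, x) * indicat_real {0<..<t} s \<partial>lborel) = K (t, x)"
        unfolding K_def primitive_def using gz
        by (intro Bochner_Integration.integral_cong) (auto simp: indicator_def)
      finally show "(K (t, x))\<^sup>2 \<le> t * G x" by (simp add: mult.commute)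
    qed
  qed
  have Kt: "sq_int lborel (\<lambda>x. K (t, x))" "(\<integral>x. (K (t, x))\<^sup>2 \<partial>lborel) \<le> t * \<Gamma>" if "0 < t" for t
  proof -
    have le: "AE x in lborel. (K (t, x))\<^sup>2 \<le> t * G x"
      using Kle by eventually_elim (use that in auto)
    have m: "(\<lambda>x. K (t, x)) \<in> borel_measurable borel" by measurable
    have "integrable lborel (\<lambda>x. (K (t, x))\<^sup>2)"
      by (rule Bochner_Integration.integrable_bound[of lborel "\<lambda>x. t * G x"])
        (use G m le that in \<open>auto elim!: eventually_mono\<close>)
    then show "sq_int lborel (\<lambda>x. K (t, x))" using m by (simp add: sq_int_def)
    then have "(\<integral>x. (K (t, x))\<^sup>2 \<partial>lborel) \<le> (\<integral>x. t * G x \<partial>lborel)"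
      using le G by (intro integral_mono_AE) (auto simp: sq_int_def)
    then show "(\<integral>x. (K (t, x))\<^sup>2 \<partial>lborel) \<le> t * \<Gamma>" by (simp add: \<Gamma>_def)
  qed
  have KL: "sq_int (lebesgue_on {0<..<pi}) (\<lambda>x. K (t, x))" "L2_norm {0<..<pi} (\<lambda>x. K (t, x)) \<le> sqrt (t * \<Gamma>)"
    if "0 < t" for t
  proof -
    have m: "(\<lambda>x. K (t, x)) \<in> borel_measurable borel" by measurable
    have b: "borel_rep {0<..<pi} (\<lambda>x. K (t, x)) (\<lambda>x. K (t, x))"
      using K0 m by (auto simp: borel_rep_def)
    show "sq_int (lebesgue_on {0<..<pi}) (\<lambda>x. K (t, x))"
      using borel_rep_sq_int[OF S(2) b] Kt(1)[OF that] by simp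
    show "L2_norm {0<..<pi} (\<lambda>x. K (t, x)) \<le> sqrt (t * \<Gamma>)"
      using borel_rep_integral(2)[OF S(2) borel_rep_power2[OF b]] Kt(2)[OF that] by (simp add: L2_norm_def)
  qed
  obtain W where W: "\<forall>t\<in>{0..T}. W t \<in> L2_on {0<..<pi}"
     "\<forall>t\<in>{0..T}. ((\<lambda>s. L2_norm {0<..<pi} (\<lambda>x. W s x - W t x)) \<longlongrightarrow> 0) (at t within {0..T})"
     "AE t in lebesgue_on {0<..<T}. AE x in lebesgue_on {0<..<pi}. W t x = w (t, x)"
     "AE x in lebesgue_on {0<..<pi}. W 0 x = 0"
    using zi unfolding zero_initial_def by blast
  have sW: "sq_int (lebesgue_on {0<..<pi}) (W t)" if "t \<in> {0..T}" for t
    using W(1) that by (simp add: L2_on_iff)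
  have good: "AE t in lebesgue_on {0<..<T}. AE x in lebesgue_on {0<..<pi}. c x = W t x - K (t, x)"
    using W(3) AE_Q_slices(1)[OF wc]
  proof eventually_elim
    case (elim t)
    then show ?case by eventually_elim simp
  qed
  have cm: "c \<in> borel_measurable (lebesgue_on {0<..<pi})" by (rule borel_measurable_imp_lebesgue_on[OF c])
  have cle: "L2_norm {0<..<pi} c \<le> \<epsilon> \<and> sq_int (lebesgue_on {0<..<pi}) c" if e: "0 < \<epsilon>" for \<epsilon>
  proof -
    have "((\<lambda>s. L2_norm {0<..<pi} (\<lambda>x. W s x - W 0 x)) \<longlongrightarrow> 0) (at 0 within {0..T})"
      using W(2) T by simp
    then have "\<forall>\<^sub>F s in at 0 within {0..T}. L2_norm {0<..<pi} (\<lambda>x. W s x - W 0 x) < \<epsilon> / 2"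
      using e by (intro order_tendstoD(2)) auto
    then obtain d where d: "0 < d" "\<And>s. s \<in> {0..T} \<Longrightarrow> s \<noteq> 0 \<Longrightarrow> dist s 0 < d \<Longrightarrow> L2_norm {0<..<pi} (\<lambda>x. W s x - W 0 x) < \<epsilon> / 2"
      by (auto simp: eventually_at)
    define d2 where "d2 = (\<epsilon> / 2)\<^sup>2 / (\<Gamma> + 1)"
    have d2: "0 < d2" using e \<Gamma> by (simp add: d2_def)
    obtain t where t: "0 < t" "t < min d d2" "t < T" "AE x in lebesgue_on {0<..<pi}. c x = W t x - K (t, x)"
      using ex_good_time[OF good T, of "min d d2"] d(1) d2 by auto
    have tT: "t \<in> {0..T}" using t by simp
    have sWt: "sq_int (lebesgue_on {0<..<pi}) (W t)" using sW[OF tT] .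
    have sc: "sq_int (lebesgue_on {0<..<pi}) c"
      by (rule sq_int_AE_cong[OF sq_int_diff[OF sWt KL(1)[OF t(1)]] cm AE_sym[OF t(4)]])
    have "L2_norm {0<..<pi} c = L2_norm {0<..<pi} (\<lambda>x. W t x - K (t, x))"
      unfolding L2_norm_def
    proof (intro arg_cong[where f = sqrt] integral_cong_AE)
      show "AE x in lebesgue_on {0<..<pi}. (c x)\<^sup>2 = (W t x - K (t, x))\<^sup>2"
        using t(4) by eventually_elim simp
    qed (use sq_intD(2)[OF sc] sq_intD(2)[OF sq_int_diff[OF sWt KL(1)[OF t(1)]]] in auto)
    also have "\<dots> \<le> L2_norm {0<..<pi} (W t) + L2_norm {0<..<pi} (\<lambda>x. K (t, x))"
      by (rule L2_norm_diff_le[OF sWt KL(1)[OF t(1)]])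
    also have "L2_norm {0<..<pi} (W t) = L2_norm {0<..<pi} (\<lambda>x. W t x - W 0 x)"
      unfolding L2_norm_def
    proof (intro arg_cong[where f = sqrt] integral_cong_AE)
      show "AE x in lebesgue_on {0<..<pi}. (W t x)\<^sup>2 = (W t x - W 0 x)\<^sup>2"
        using W(4) by eventually_elim simp
    qed (use sq_intD(2)[OF sWt] sq_intD(2)[OF sq_int_diff[OF sWt sW[of 0]]] T in auto)
    also have "\<dots> < \<epsilon> / 2" using d(2)[OF tT] t by simp
    also have "L2_norm {0<..<pi} (\<lambda>x. K (t, x)) \<le> \<epsilon> / 2"
    proof -
      have "t * \<Gamma> \<le> d2 * (\<Gamma> + 1)" using t \<Gamma> d2 by (intro mult_mono) auto
      also have "\<dots> = (\<epsilon> / 2)\<^sup>2" using \<Gamma> by (simp add: d2_def)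
      finally have "sqrt (t * \<Gamma>) \<le> \<epsilon> / 2" using e by (intro real_le_lsqrt) auto
      then show ?thesis using KL(2)[OF t(1)] by linarith
    qed
    finally show ?thesis using sc by simp
  qed
  have sc: "sq_int (lebesgue_on {0<..<pi}) c" using cle[of 1] by simp
  have "L2_norm {0<..<pi} c \<le> 0"
    by (rule field_le_epsilon) (use cle in auto)
  then have "(\<integral>x. (c x)\<^sup>2 \<partial>lebesgue_on {0<..<pi}) = 0"
    by (intro antisym) (simp_all add: L2_norm_def)
  then have c0: "AE x in lebesgue_on {0<..<pi}. (c x)\<^sup>2 = 0"
    by (subst (asm) integral_nonneg_eq_0_iff_AE) (use sq_intD(2)[OF sc] in auto)
  have mc: "(\<lambda>z. c (snd z)) \<in> borel_measurable (lebesgue_on (Q T))"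
    by (rule borel_measurable_imp_lebesgue_on) (simp flip: borel_prod)
  have "AE x in lebesgue_on {0<..<pi}. AE t in lebesgue_on {0<..<T}. c (snd (t, x)) = 0"
    using c0 by eventually_elim simp
  then have "AE z in lebesgue_on (Q T). c (snd z) = 0"
    using AE_Q_eqI[OF mc, of "\<lambda>_. 0"] by simp
  with wc show ?thesis unfolding K_def by eventually_elim simp
qed

section \<open>The energy inequality\<close>

lemma AE_translation:
  fixes c :: "'a::euclidean_space"
  assumes "AE z in lborel. P z"
  shows "AE z in lborel. P (z - c)"
proof -
  obtain N where N: "N \<in> null_sets lborel" "{z. \<not> P z} \<subseteq> N"
    using assms by (auto simp: eventually_ae_filter)
  have "emeasure lborel ((\<lambda>z. (- c) + z) -` N \<inter> space lborel) = emeasure (distr lborel borel ((+) (- c))) N"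
    using N(1) by (subst emeasure_distr) (auto simp: null_sets_def)
  also have "\<dots> = 0" unfolding lborel_distr_plus using N(1) by auto
  finally have em: "emeasure lborel ((\<lambda>z. (- c) + z) -` N \<inter> space lborel) = 0" .
  have "(\<lambda>z. (- c) + z) -` N \<inter> space lborel \<in> null_sets lborel"
  proof -
    have "(\<lambda>z. (- c) + z) -` N \<inter> space lborel \<in> sets lborel"
      by (rule measurable_sets[of _ lborel borel]) (use N(1) in \<open>auto simp: null_sets_def\<close>)
    with em show ?thesis by (rule null_setsI)
  qed
  then have "AE z in lborel. z \<notin> (\<lambda>z. (- c) + z) -` N \<inter> space lborel" by (rule AE_not_in)
  then show ?thesis
    by eventually_elim (use N(2) in \<open>auto simp: algebra_simps\<close>)
qed

text \<open>
  There is no boundary term because \<open>f\<close> is a limit of test functions. Below, \<open>f\<close> and \<open>p\<close> are taken at two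
  different times.
\<close>

lemma W12_0_by_parts:
  assumes f: "f \<in> W12_0 a b" "weak_deriv a b f f'" and p: "weak_deriv a b p h" and ab: "a < b"
  shows "(\<integral>x. f x * h x \<partial>lebesgue_on {a<..<b}) = - (\<integral>x. f' x * p x \<partial>lebesgue_on {a<..<b})"
proof -
  let ?M = "lebesgue_on {a<..<b}"
  note df = weak_derivD[OF f(2)] and dp = weak_derivD[OF p]
  let ?d = "(\<integral>x. f x * h x \<partial>?M) + (\<integral>x. f' x * p x \<partial>?M)"
  have "\<bar>?d\<bar> \<le> e * (L2_norm {a<..<b} h + L2_norm {a<..<b} p)" if e: "0 < e" for e
  proof -
    obtain \<phi> where \<phi>: "\<phi> \<in> test_fun a b" "L2_norm {a<..<b} (\<lambda>x. \<phi> x - f x) < e"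
        "L2_norm {a<..<b} (\<lambda>x. deriv \<phi> x - f' x) < e"
      using W12_0E[OF f ab e] by blast
    note s = test_fun_sq_int[OF \<phi>(1), of a b] test_fun_sq_int[OF test_fun_deriv[OF \<phi>(1) ab], of a b]
    have 1: "(\<integral>x. (\<phi> x - f x) * h x \<partial>?M) = (\<integral>x. \<phi> x * h x \<partial>?M) - (\<integral>x. f x * h x \<partial>?M)"
      using sq_int_mult[OF s(1) dp(2)] sq_int_mult[OF df(1) dp(2)] by (simp add: left_diff_distrib)
    have 2: "(\<integral>x. (deriv \<phi> x - f' x) * p x \<partial>?M) = (\<integral>x. deriv \<phi> x * p x \<partial>?M) - (\<integral>x. f' x * p x \<partial>?M)"
      using sq_int_mult[OF s(2) dp(1)] sq_int_mult[OF df(2) dp(1)] by (simp add: left_diff_distrib)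
    have "(\<integral>x. deriv \<phi> x * p x \<partial>?M) = - (\<integral>x. \<phi> x * h x \<partial>?M)"
      using dp(3)[OF \<phi>(1)] by (simp add: mult.commute)
    then have "?d = - (\<integral>x. (\<phi> x - f x) * h x \<partial>?M) - (\<integral>x. (deriv \<phi> x - f' x) * p x \<partial>?M)"
      using 1 2 by linarith
    then have "\<bar>?d\<bar> \<le> \<bar>\<integral>x. (\<phi> x - f x) * h x \<partial>?M\<bar> + \<bar>\<integral>x. (deriv \<phi> x - f' x) * p x \<partial>?M\<bar>" by linarith
    also have "\<dots> \<le> L2_norm {a<..<b} (\<lambda>x. \<phi> x - f x) * L2_norm {a<..<b} h
        + L2_norm {a<..<b} (\<lambda>x. deriv \<phi> x - f' x) * L2_norm {a<..<b} p"
      using Cauchy_Schwarz_sqrt[OF sq_int_diff[OF s(1) df(1)] dp(2)] Cauchy_Schwarz_sqrt[OF sq_int_diff[OF s(2) df(2)] dp(1)]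
      unfolding L2_norm_def by (rule add_mono)
    also have "\<dots> \<le> e * L2_norm {a<..<b} h + e * L2_norm {a<..<b} p"
      using \<phi>(2,3) by (intro add_mono mult_right_mono L2_norm_nonneg) auto
    finally show ?thesis by (simp add: algebra_simps)
  qed
  note b = this
  have "\<bar>?d\<bar> \<le> 0"
  proof (rule field_le_epsilon)
    fix e :: real assume e: "0 < e"
    let ?S = "L2_norm {a<..<b} h + L2_norm {a<..<b} p"
    have S: "0 \<le> ?S" by (simp add: L2_norm_nonneg)
    have "\<bar>?d\<bar> \<le> e / (?S + 1) * ?S" using b[of "e / (?S + 1)"] e S by simp
    also have "\<dots> \<le> e" using e S by (simp add: field_simps)
    finally show "\<bar>?d\<bar> \<le> 0 + e" by simp
  qed
  then show ?thesis by linarith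
qed

text \<open>
  Integration by parts in \<open>x\<close> on almost every slice, for the pair of times \<open>t\<close>, \<open>t - s\<close>; the predicate
  \<open>Gd\<close> singles out the times at which it is allowed.
\<close>

lemma shifted_by_parts:
  fixes w p h :: "real \<times> real \<Rightarrow> real"
  assumes w: "sq_int lborel w" and p: "sq_int lborel p" and h: "sq_int lborel h"
    and G: "AE t in lborel. Gd t"
    and id: "\<And>t t'. Gd t \<Longrightarrow> Gd t' \<Longrightarrow> (\<integral>x. w (t', x) * h (t, x) \<partial>lborel) = - (\<integral>x. p (t', x) * p (t, x) \<partial>lborel)"
  shows "(\<integral>z. w (z - (s, 0)) * h z \<partial>lborel) = - (\<integral>z. p (z - (s, 0)) * p z \<partial>lborel)"
proof -
  have [measurable]: "w \<in> borel_measurable (borel \<Otimes>\<^sub>M borel)" "p \<in> borel_measurable (borel \<Otimes>\<^sub>M borel)"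
    "h \<in> borel_measurable (borel \<Otimes>\<^sub>M borel)"
    using w p h by (simp_all add: sq_int_def borel_prod)
  note i = sq_int_mult[OF sq_int_translation[OF w] h] sq_int_mult[OF sq_int_translation[OF p] p]
  have "(\<integral>z. w (z - (s, 0)) * h z \<partial>lborel) = (\<integral>t. (\<integral>x. w (t - s, x) * h (t, x) \<partial>lborel) \<partial>lborel)"
    using lborel_integral_iterated(1)[OF i(1)[of "(s, 0)"]] by simp
  also have "\<dots> = (\<integral>t. - (\<integral>x. p (t - s, x) * p (t, x) \<partial>lborel) \<partial>lborel)"
  proof (rule integral_cong_AE)
    show "AE t in lborel. (\<integral>x. w (t - s, x) * h (t, x) \<partial>lborel) = - (\<integral>x. p (t - s, x) * p (t, x) \<partial>lborel)"
      using G AE_translation[OF G, of s] by eventually_elim (rule id)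
  qed measurable
  also have "\<dots> = - (\<integral>z. p (z - (s, 0)) * p z \<partial>lborel)"
    using lborel_integral_iterated(1)[OF i(2)[of "(s, 0)"]] by simp
  finally show ?thesis .
qed

lemma autocorrelation_le:
  fixes p :: "'a::euclidean_space \<Rightarrow> real"
  assumes p: "sq_int lborel p"
  shows "(\<integral>z. p (z - c) * p z \<partial>lborel) \<le> (\<integral>z. (p z)\<^sup>2 \<partial>lborel)"
proof -
  have [measurable]: "p \<in> borel_measurable borel" using p by (simp add: sq_int_def)
  have e: "(\<integral>z. (p (z - c))\<^sup>2 \<partial>lborel) = (\<integral>z. (p z)\<^sup>2 \<partial>lborel)"
    using integral_translation(1)[of "\<lambda>z. (p z)\<^sup>2" c] by simp
  have "\<bar>\<integral>z. p (z - c) * p z \<partial>lborel\<bar> \<le> sqrt (\<integral>z. (p z)\<^sup>2 \<partial>lborel) * sqrt (\<integral>z. (p z)\<^sup>2 \<partial>lborel)"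
    using Cauchy_Schwarz_sqrt[OF sq_int_translation[OF p] p, of c] unfolding e .
  then show ?thesis by simp
qed

text \<open>
  The difference of two values of the primitive is an average of shifts, and Fubini's theorem turns
  the integral against \<open>h\<close> into an average of correlations.
\<close>

lemma primitive_shift_correlation:
  fixes g h :: "real \<times> real \<Rightarrow> real"
  assumes g: "sq_int lborel g" and h: "sq_int lborel h" and s: "0 < s"
    and gz: "\<And>t x. t \<notin> {0<..<T} \<Longrightarrow> g (t, x) = 0"
    and w: "sq_int lborel w"
    and wK: "AE z in lborel. fst z < T \<longrightarrow> w z = primitive (\<lambda>\<sigma>. g (\<sigma>, snd z)) (fst z)"
    and hz: "\<And>z. h z \<noteq> 0 \<Longrightarrow> fst z < T"
  shows "(\<integral>z. w z * h z \<partial>lborel) - (\<integral>z. w (z - (s, 0)) * h z \<partial>lborel)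
      = (\<integral>r. indicat_real {0<..<s} r * (\<integral>z. g (z - (r, 0)) * h z \<partial>lborel) \<partial>lborel)"
    and "integrable lborel (\<lambda>r. indicat_real {0<..<s} r * (\<integral>z. g (z - (r, 0)) * h z \<partial>lborel))"
proof -
  have mb: "g \<in> borel_measurable borel" "h \<in> borel_measurable borel" using g h by (simp_all add: sq_int_def)
  have [measurable]: "g \<in> borel_measurable (borel \<Otimes>\<^sub>M borel)" "h \<in> borel_measurable (borel \<Otimes>\<^sub>M borel)"
    using mb by (simp_all add: borel_prod)
  define F where "F r z = indicat_real {0<..<s} r * (g (fst z - r, snd z) * h z)" for r and z :: "real \<times> real"
  have sh: "g (fst z - r, snd z) = g (z - (r, 0))" for z r by (cases z) simp
  have mF: "(\<lambda>(r, z). F r z) \<in> borel_measurable (lborel \<Otimes>\<^sub>M (lborel :: (real \<times> real) measure))"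
    unfolding F_def lborel_prod[symmetric] by measurable
  define B where "B = sqrt (\<integral>z. (g z)\<^sup>2 \<partial>lborel) * sqrt (\<integral>z. (h z)\<^sup>2 \<partial>lborel)"
  have Bb: "(\<integral>z. \<bar>g (z - (r, 0))\<bar> * \<bar>h z\<bar> \<partial>lborel) \<le> B" for r
  proof -
    have s1: "sq_int lborel (\<lambda>z. \<bar>g (z - (r, 0))\<bar>)" "sq_int lborel (\<lambda>z. \<bar>h z\<bar>)"
      using sq_int_translation[OF g, of "(r, 0)"] h by (auto simp: sq_int_def)
    have "(\<integral>z. (g (z - (r, 0)))\<^sup>2 \<partial>lborel) = (\<integral>z. (g z)\<^sup>2 \<partial>lborel)"
      using integral_translation(1)[of "\<lambda>z. (g z)\<^sup>2" "(r, 0)"] mb by simp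
    then show ?thesis using Cauchy_Schwarz_sqrt[OF s1] by (simp add: B_def)
  qed
  have iz: "integrable lborel (F r)" for r
    using sq_int_mult[OF sq_int_translation[OF g, of "(r, 0)"] h] by (simp add: F_def[abs_def] sh)
  have i: "integrable (lborel \<Otimes>\<^sub>M lborel) (\<lambda>(r, z). F r z)"
  proof (rule lborel_pair.Fubini_integrable[OF mF])
    show "AE r in lborel. integrable lborel (\<lambda>z. case (r, z) of (r, z) \<Rightarrow> F r z)" using iz by simp
    show "integrable lborel (\<lambda>r. LINT z|lborel. norm (case (r, z) of (r, z) \<Rightarrow> F r z))"
    proof (rule Bochner_Integration.integrable_bound[of lborel "\<lambda>r. B * indicat_real {0<..<s} r"])
      show "integrable lborel (\<lambda>r. B * indicat_real {0<..<s} r)"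
        using s by simp
      show "(\<lambda>r. LINT z|lborel. norm (case (r, z) of (r, z) \<Rightarrow> F r z)) \<in> borel_measurable lborel"
        using mF by (intro lborel.borel_measurable_lebesgue_integral) simp
      have "(\<integral>z. \<bar>F r z\<bar> \<partial>lborel) \<le> B * indicat_real {0<..<s} r" for r
        using Bb[of r] by (auto simp: F_def sh abs_mult indicator_def)
      moreover have "0 \<le> (\<integral>z. \<bar>F r z\<bar> \<partial>lborel)" for r by simp
      ultimately show "AE r in lborel. norm (LINT z|lborel. norm (case (r, z) of (r, z) \<Rightarrow> F r z))
          \<le> norm (B * indicat_real {0<..<s} r)"
        by (auto intro: order_trans[OF _ abs_ge_self])
    qed
  qed
  have C: "(\<integral>z. F r z \<partial>lborel) = indicat_real {0<..<s} r * (\<integral>z. g (z - (r, 0)) * h z \<partial>lborel)" for r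
    by (simp add: F_def sh)
  show "integrable lborel (\<lambda>r. indicat_real {0<..<s} r * (\<integral>z. g (z - (r, 0)) * h z \<partial>lborel))"
    using lborel_pair.integrable_fst[OF i] by (simp add: C)
  have "(\<integral>r. (\<integral>z. F r z \<partial>lborel) \<partial>lborel) = (\<integral>z. (\<integral>r. F r z \<partial>lborel) \<partial>lborel)"
    using lborel_pair.Fubini_integral[OF i] by simp
  also have "\<dots> = (\<integral>z. w z * h z - w (z - (s, 0)) * h z \<partial>lborel)"
  proof (rule integral_cong_AE)
    show "(\<lambda>z. \<integral>r. F r z \<partial>lborel) \<in> borel_measurable lborel"
      using lborel_pair.integrable_snd[OF i] by auto
    show "(\<lambda>z. w z * h z - w (z - (s, 0)) * h z) \<in> borel_measurable lborel"
      using sq_int_mult[OF w h] sq_int_mult[OF sq_int_translation[OF w] h] by auto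
    have sl: "AE z :: real \<times> real in lborel. sq_int lborel (\<lambda>t. g (t, snd z))"
    proof -
      have "AE x in lborel. sq_int lborel (\<lambda>t. g (t, x))" by (rule sq_int_slices(2)[OF g])
      then obtain N where N: "N \<in> null_sets lborel" "{x. \<not> sq_int lborel (\<lambda>t. g (t, x))} \<subseteq> N"
        by (auto simp: eventually_ae_filter)
      have "AE x in lborel. x \<notin> N" using N(1) by (rule AE_not_in)
      then have "AE t in (lborel :: real measure). AE x in lborel. snd (t, x) \<notin> N" by simp
      then have "AE z in lborel \<Otimes>\<^sub>M lborel. snd (z :: real \<times> real) \<notin> N"
      proof (rule lborel_pair.AE_pair_measure[rotated])
        have [measurable]: "N \<in> sets borel" using N(1) by (auto simp: null_sets_def)
        show "{z \<in> space (lborel \<Otimes>\<^sub>M lborel). snd (z :: real \<times> real) \<notin> N} \<in> sets (lborel \<Otimes>\<^sub>M lborel)"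
          by measurable
      qed
      then show ?thesis unfolding lborel_prod by eventually_elim (use N(2) in auto)
    qed
    show "AE z in lborel. (\<integral>r. F r z \<partial>lborel) = w z * h z - w (z - (s, 0)) * h z"
      using wK AE_translation[OF wK, of "(s, 0)"] sl
    proof eventually_elim
      case (elim z)
      show ?case
      proof (cases "h z = 0")
        case True
        then show ?thesis by (simp add: F_def)
      next
        case False
        obtain t x where z: "z = (t, x)" by (cases z)
        have t: "t < T" using hz[OF False] z by simp
        have gi: "integrable lborel (\<lambda>t. g (t, x))"
          by (rule sq_int_imp_integrable_bounded_support[of _ 0 T]) (use elim(3) z gz in auto)
        have gm [measurable]: "(\<lambda>t. g (t, x)) \<in> borel_measurable borel" using gi by auto
        have ib: "integrable lborel (\<lambda>\<sigma>. if \<sigma> < u then g (\<sigma>, x) else 0)" for u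
          by (rule Bochner_Integration.integrable_bound[OF gi]) auto
        have "(\<integral>r. indicat_real {0<..<s} r * g (t - r, x) \<partial>lborel)
            = (\<integral>\<sigma>. indicat_real {0<..<s} (t - \<sigma>) * g (\<sigma>, x) \<partial>lborel)"
          using lborel_integral_real_affine[of "-1" "\<lambda>\<sigma>. indicat_real {0<..<s} (t - \<sigma>) * g (\<sigma>, x)" t] by simp
        also have "\<dots> = (\<integral>\<sigma>. (if \<sigma> < t then g (\<sigma>, x) else 0) - (if \<sigma> < t - s then g (\<sigma>, x) else 0) \<partial>lborel)"
        proof (rule integral_cong_AE)
          have "AE \<sigma> in lborel. \<sigma> \<noteq> t - s" by (rule AE_lborel_singleton)
          then show "AE \<sigma> in lborel. indicat_real {0<..<s} (t - \<sigma>) * g (\<sigma>, x)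
              = (if \<sigma> < t then g (\<sigma>, x) else 0) - (if \<sigma> < t - s then g (\<sigma>, x) else 0)"
            by eventually_elim (use s in \<open>auto simp: indicator_def\<close>)
        qed measurable
        also have "\<dots> = primitive (\<lambda>\<sigma>. g (\<sigma>, x)) t - primitive (\<lambda>\<sigma>. g (\<sigma>, x)) (t - s)"
          using ib by (simp add: primitive_def)
        also have "\<dots> = w z - w (z - (s, 0))"
          using elim(1,2) z t s by simp
        finally have "(\<integral>r. indicat_real {0<..<s} r * g (t - r, x) \<partial>lborel) = w z - w (z - (s, 0))" .
        moreover have "(\<integral>r. F r z \<partial>lborel) = (\<integral>r. indicat_real {0<..<s} r * g (t - r, x) \<partial>lborel) * h z"
          by (simp add: F_def z flip: mult.assoc)
        ultimately show ?thesis by (simp add: left_diff_distrib)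
      qed
    qed
  qed
  also have "\<dots> = (\<integral>z. w z * h z \<partial>lborel) - (\<integral>z. w (z - (s, 0)) * h z \<partial>lborel)"
    using sq_int_mult[OF w h] sq_int_mult[OF sq_int_translation[OF w] h] by simp
  finally show "(\<integral>z. w z * h z \<partial>lborel) - (\<integral>z. w (z - (s, 0)) * h z \<partial>lborel)
      = (\<integral>r. indicat_real {0<..<s} r * (\<integral>z. g (z - (r, 0)) * h z \<partial>lborel) \<partial>lborel)"
    by (simp add: C)
qed

text \<open>
  Formally, \<open>\<integral>\<integral> w\<^sub>\<tau> w\<^sub>x\<^sub>x = -1/2 \<parallel>w\<^sub>x(T)\<parallel>\<^sup>2\<close>.  With all functions extended by zero, the correlation of
  \<open>w\<^sub>x\<close> with its time shifts is largest for the shift zero; dividing the resulting inequality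
  for the differences \<open>w(\<tau>) - w(\<tau>-s)\<close> by \<open>s \<rightarrow> 0\<close> gives the claim without regularity assumptions.
\<close>

lemma energy_inequality:
  assumes T: "0 < T" and w: "sq_int (lebesgue_on (Q T)) w" and D: "is_Dtau T w g"
    and px: "is_Dx T w p" and hx: "is_Dx T p h"
    and w0: "AE \<tau> in lebesgue_on {0<..<T}. (\<lambda>x. w (\<tau>, x)) \<in> W12_0 0 pi"
    and zi: "zero_initial T w"
  shows "(\<integral>z. g z * h z \<partial>lebesgue_on (Q T)) \<le> 0"
proof (rule ccontr)
  assume neg: "\<not> ?thesis"
  have S: "{0<..<T} \<in> sets borel" "{0<..<pi} \<in> sets borel" by auto
  obtain w' where rw: "borel_rep (Q T) w w'"
    using ex_borel_rep[OF Q_borel sq_intD(1)[OF w]] by (elim exE)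
  obtain g' where rg: "borel_rep (Q T) g g'"
    using ex_borel_rep[OF Q_borel sq_intD(1)[OF is_DtauD(1)[OF D]]] by (elim exE)
  obtain p' where rp: "borel_rep (Q T) p p'"
    using ex_borel_rep[OF Q_borel sq_intD(1)[OF is_DxD(1)[OF px]]] by (elim exE)
  obtain h' where rh: "borel_rep (Q T) h h'"
    using ex_borel_rep[OF Q_borel sq_intD(1)[OF is_DxD(1)[OF hx]]] by (elim exE)
  have sq: "sq_int lborel w'" "sq_int lborel g'" "sq_int lborel p'" "sq_int lborel h'"
    using borel_rep_sq_int[OF Q_borel rw] borel_rep_sq_int[OF Q_borel rg] borel_rep_sq_int[OF Q_borel rp]
      borel_rep_sq_int[OF Q_borel rh] w is_DtauD(1)[OF D] is_DxD(1)[OF px] is_DxD(1)[OF hx] by auto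
  define C where "C r = (\<integral>z. g' (z - (r, 0)) * h' z \<partial>lborel)" for r :: real
  have C0: "C 0 > 0"
    using neg borel_rep_integral(2)[OF Q_borel borel_rep_mult[OF rg rh]] by (simp add: C_def flip: zero_prod_def)
  define Gd where "Gd t \<longleftrightarrow> t \<in> {0<..<T} \<longrightarrow> borel_rep {0<..<pi} (\<lambda>x. w (t, x)) (\<lambda>x. w' (t, x))
      \<and> borel_rep {0<..<pi} (\<lambda>x. p (t, x)) (\<lambda>x. p' (t, x)) \<and> borel_rep {0<..<pi} (\<lambda>x. h (t, x)) (\<lambda>x. h' (t, x))
      \<and> weak_deriv 0 pi (\<lambda>x. w (t, x)) (\<lambda>x. p (t, x)) \<and> weak_deriv 0 pi (\<lambda>x. p (t, x)) (\<lambda>x. h (t, x))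
      \<and> (\<lambda>x. w (t, x)) \<in> W12_0 0 pi" for t
  have G: "AE t in lborel. Gd t"
    unfolding Gd_def AE_lebesgue_on_iff[OF S(1), symmetric]
    using borel_rep_slices(1)[OF rw] borel_rep_slices(1)[OF rp] borel_rep_slices(1)[OF rh]
      is_DxD(2)[OF px] is_DxD(2)[OF hx] w0
    by eventually_elim blast
  have zero: "w' (t, x) = 0" "p' (t, x) = 0" "h' (t, x) = 0" "g' (t, x) = 0" if "t \<notin> {0<..<T}" for t x
    using borel_repD(2)[OF rw, of "(t, x)"] borel_repD(2)[OF rp, of "(t, x)"] borel_repD(2)[OF rh, of "(t, x)"]
      borel_repD(2)[OF rg, of "(t, x)"] that by (auto simp: Q_def)
  have id: "(\<integral>x. w' (t', x) * h' (t, x) \<partial>lborel) = - (\<integral>x. p' (t', x) * p' (t, x) \<partial>lborel)"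
    if "Gd t" "Gd t'" for t t'
  proof (cases "t \<in> {0<..<T} \<and> t' \<in> {0<..<T}")
    case True
    then have a: "borel_rep {0<..<pi} (\<lambda>x. w (t', x)) (\<lambda>x. w' (t', x))"
      "borel_rep {0<..<pi} (\<lambda>x. p (t', x)) (\<lambda>x. p' (t', x))"
      "weak_deriv 0 pi (\<lambda>x. w (t', x)) (\<lambda>x. p (t', x))" "(\<lambda>x. w (t', x)) \<in> W12_0 0 pi"
      and b: "borel_rep {0<..<pi} (\<lambda>x. p (t, x)) (\<lambda>x. p' (t, x))" "borel_rep {0<..<pi} (\<lambda>x. h (t, x)) (\<lambda>x. h' (t, x))"
      "weak_deriv 0 pi (\<lambda>x. p (t, x)) (\<lambda>x. h (t, x))"
      using that unfolding Gd_def by blast+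
    from W12_0_by_parts[OF a(4,3) b(3) pi_gt_zero] show ?thesis
      using borel_rep_integral(2)[OF S(2) borel_rep_mult[OF a(1) b(2)]]
        borel_rep_integral(2)[OF S(2) borel_rep_mult[OF a(2) b(1)]] by simp
  next
    case False
    then show ?thesis by (auto simp: zero)
  qed
  have D_le: "(\<integral>z. w' z * h' z \<partial>lborel) - (\<integral>z. w' (z - (s, 0)) * h' z \<partial>lborel) \<le> 0" for s
    using shifted_by_parts[OF sq(1,3,4) G id, of 0] shifted_by_parts[OF sq(1,3,4) G id, of s]
      autocorrelation_le[OF sq(3), of "(s, 0)"] by (simp add: power2_eq_square flip: zero_prod_def)
  have wK: "AE z in lborel. fst z < T \<longrightarrow> w' z = primitive (\<lambda>\<sigma>. g' (\<sigma>, snd z)) (fst z)"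
  proof -
    have "AE z in lebesgue_on (Q T). w' z = primitive (\<lambda>\<sigma>. g' (\<sigma>, snd z)) (fst z)"
      using zero_initial_time_primitive[OF T w D zi rg] borel_repD(3)[OF rw] by eventually_elim simp
    then have "AE z in lborel. z \<in> Q T \<longrightarrow> w' z = primitive (\<lambda>\<sigma>. g' (\<sigma>, snd z)) (fst z)"
      by (simp only: AE_lebesgue_on_iff[OF Q_borel])
    then show ?thesis
    proof eventually_elim
      case (elim z)
      show ?case
      proof
        assume zT: "fst z < T"
        show "w' z = primitive (\<lambda>\<sigma>. g' (\<sigma>, snd z)) (fst z)"
        proof (cases "z \<in> Q T")
          case True
          then show ?thesis using elim by blast
        next
          case False
          have "(if \<sigma> < fst z then g' (\<sigma>, snd z) else 0) = 0" for \<sigma>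
          proof (cases "(\<sigma>, snd z) \<in> Q T")
            case True
            then show ?thesis using False zT by (cases z) (auto simp: Q_def)
          qed (simp add: borel_repD(2)[OF rg])
          then show ?thesis using borel_repD(2)[OF rw False] by (simp add: primitive_def)
        qed
      qed
    qed
  qed
  have hz: "fst z < T" if "h' z \<noteq> 0" for z
    using that borel_repD(2)[OF rh, of z] by (cases z) (auto simp: Q_def)
  have "\<exists>\<delta>>0. \<forall>r. 0 < r \<and> r < \<delta> \<longrightarrow> C r \<ge> C 0 / 2"
  proof (rule ccontr)
    assume n: "\<not> ?thesis"
    have "\<exists>r. 0 < r \<and> r < inverse (real (Suc n)) \<and> C r < C 0 / 2" for n
    proof -
      have "0 < inverse (real (Suc n))" by simp
      then show ?thesis using n not_le by blast
    qed
    then obtain r where r: "\<And>n. 0 < r n" "\<And>n. r n < inverse (real (Suc n))" "\<And>n. C (r n) < C 0 / 2" by metis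
    have "r \<longlonglongrightarrow> 0"
      by (rule tendsto_sandwich[OF _ _ tendsto_const LIMSEQ_inverse_real_of_nat])
        (use r(1,2) in \<open>auto intro!: always_eventually less_imp_le\<close>)
    then have "(\<lambda>n. (r n, 0::real)) \<longlonglongrightarrow> (0, 0)" by (intro tendsto_Pair tendsto_const)
    then have "(\<lambda>n. C (r n)) \<longlonglongrightarrow> C 0"
      unfolding C_def using translation_tendsto_L2[OF sq(2,4), of "\<lambda>n. (r n, 0)"] by (simp flip: zero_prod_def)
    then have "C 0 \<le> C 0 / 2"
      by (rule LIMSEQ_le_const2) (use r(3) less_imp_le in blast)
    then show False using C0 by simp
  qed
  then obtain \<delta> where \<delta>: "0 < \<delta>" "\<And>r. 0 < r \<Longrightarrow> r < \<delta> \<Longrightarrow> C r \<ge> C 0 / 2" by blast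
  note pc = primitive_shift_correlation[OF sq(2,4) \<delta>(1) zero(4) sq(1) wK hz, folded C_def]
  have "\<delta> * (C 0 / 2) = (\<integral>r. (C 0 / 2) * indicat_real {0<..<\<delta>} r \<partial>lborel)"
    using \<delta>(1) by simp
  also have "\<dots> \<le> (\<integral>r. indicat_real {0<..<\<delta>} r * C r \<partial>lborel)"
  proof (intro integral_mono)
    show "integrable lborel (\<lambda>r. (C 0 / 2) * indicat_real {0<..<\<delta>} r)"
      using \<delta>(1) by simp
    show "(C 0 / 2) * indicat_real {0<..<\<delta>} r \<le> indicat_real {0<..<\<delta>} r * C r" for r
      using \<delta>(2)[of r] by (auto simp: indicator_def)
  qed (rule pc(2))
  also have "\<dots> \<le> 0" using D_le[of \<delta>] pc(1) by simp
  finally show False using \<delta>(1) C0 by (simp add: zero_less_mult_iff mult_le_0_iff)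
qed

text \<open>
  Uniqueness for uniformly parabolic equations with measurable coefficients, in the form needed for
  differences of solutions.
\<close>

lemma parabolic_zero:
  assumes T: "0 < T" and w: "sq_int (lebesgue_on (Q T)) w" and D: "is_Dtau T w g"
    and px: "is_Dx T w p" and hx: "is_Dx T p h"
    and w0: "AE \<tau> in lebesgue_on {0<..<T}. (\<lambda>x. w (\<tau>, x)) \<in> W12_0 0 pi"
    and zi: "zero_initial T w" and L: "0 \<le> L"
    and le: "AE z in lebesgue_on (Q T). (g z)\<^sup>2 \<le> L * (g z * h z)"
  shows "AE z in lebesgue_on (Q T). w z = 0"
proof -
  have sg: "sq_int (lebesgue_on (Q T)) g" by (rule is_DtauD(1)[OF D])
  have i: "integrable (lebesgue_on (Q T)) (\<lambda>z. g z * h z)"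
    by (rule sq_int_mult[OF sg is_DxD(1)[OF hx]])
  have "(\<integral>z. (g z)\<^sup>2 \<partial>lebesgue_on (Q T)) \<le> (\<integral>z. L * (g z * h z) \<partial>lebesgue_on (Q T))"
    using sq_intD(2)[OF sg] i le by (intro integral_mono_AE) auto
  also have "\<dots> \<le> 0"
    using energy_inequality[OF T w D px hx w0 zi] L by (simp add: mult_nonneg_nonpos)
  finally have "(\<integral>z. (g z)\<^sup>2 \<partial>lebesgue_on (Q T)) = 0"
    by (intro antisym) simp_all
  then have "AE z in lebesgue_on (Q T). (g z)\<^sup>2 = 0"
    by (subst (asm) integral_nonneg_eq_0_iff_AE) (use sq_intD(2)[OF sg] in auto)
  then have "borel_rep (Q T) g (\<lambda>_. 0)" by (simp add: borel_rep_def)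
  from zero_initial_time_primitive[OF T w D zi this] show ?thesis
    by (simp add: primitive_def)
qed

section \<open>Separated functions\<close>

text \<open>The function \<open>e(\<tau>) f(x)\<close>.\<close>

definition sep :: "(real \<Rightarrow> real) \<Rightarrow> (real \<Rightarrow> real) \<Rightarrow> real \<times> real \<Rightarrow> real" where
  "sep e f z = e (fst z) * f (snd z)"

lemma borel_rep_continuous:
  assumes "continuous_on {a..b} (e :: real \<Rightarrow> real)"
  shows "borel_rep {a<..<b} e (\<lambda>t. indicator {a<..<b} t * e t)"
proof -
  have "continuous_on {a<..<b} e" by (rule continuous_on_subset[OF assms]) auto
  then have "(\<lambda>t. indicator {a<..<b} t *\<^sub>R e t) \<in> borel_measurable borel"
    by (intro borel_measurable_continuous_on_indicator) auto
  then show ?thesis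
    by (auto simp: borel_rep_def AE_lebesgue_on_iff indicator_def)
qed

lemma sep_borel_rep:
  assumes "borel_rep {0<..<T} e e'" "borel_rep {0<..<pi} f f'"
  shows "borel_rep (Q T) (sep e f) (sep e' f')"
proof -
  have [measurable]: "e' \<in> borel_measurable borel" "f' \<in> borel_measurable borel"
    using assms by (auto simp: borel_rep_def)
  have m: "sep e' f' \<in> borel_measurable borel"
    unfolding borel_prod[symmetric] sep_def[abs_def] by measurable
  have z: "sep e' f' z = 0" if "z \<notin> Q T" for z
    using that borel_repD(2)[OF assms(1), of "fst z"] borel_repD(2)[OF assms(2), of "snd z"]
    by (cases z) (auto simp: Q_def sep_def)
  have "AE t in lborel. t \<in> {0<..<T} \<longrightarrow> e t = e' t" "AE x in lborel. x \<in> {0<..<pi} \<longrightarrow> f x = f' x"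
    using assms by (simp_all only: borel_rep_def AE_lebesgue_on_iff[OF borel_open[OF open_greaterThanLessThan]])
  then obtain N L where N: "N \<in> null_sets lborel" "{t. \<not> (t \<in> {0<..<T} \<longrightarrow> e t = e' t)} \<subseteq> N"
    and L: "L \<in> null_sets lborel" "{x. \<not> (x \<in> {0<..<pi} \<longrightarrow> f x = f' x)} \<subseteq> L"
    by (auto simp: eventually_ae_filter)
  have eN: "e t = e' t" if "t \<notin> N" "0 < t" "t < T" for t using N(2) that by auto
  have fL: "f x = f' x" if "x \<notin> L" "0 < x" "x < pi" for x using L(2) that by auto
  have [measurable]: "N \<in> sets borel" "L \<in> sets borel" using N(1) L(1) by (auto simp: null_sets_def)
  have "AE t in lborel. AE x in lborel. fst (t, x) \<notin> N \<and> snd (t, x) \<notin> L"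
    using AE_not_in[OF N(1)] AE_not_in[OF L(1)] by (auto elim: eventually_mono)
  then have "AE z in lborel \<Otimes>\<^sub>M lborel. fst z \<notin> N \<and> snd z \<notin> L"
    by (rule lborel_pair.AE_pair_measure[rotated]) measurable
  then have "AE z in lborel. z \<in> Q T \<longrightarrow> sep e f z = sep e' f' z"
    unfolding lborel_prod by eventually_elim (use eN fL in \<open>auto simp: sep_def Q_def\<close>)
  then show ?thesis
    using m z by (simp only: borel_rep_def AE_lebesgue_on_iff[OF Q_borel]) blast
qed

lemma sep_L2:
  assumes e: "continuous_on {0..T} e" and f: "continuous_on {0..pi} f"
  shows "sq_int (lebesgue_on (Q T)) (sep e f)"
    "L2_norm (Q T) (sep e f) = L2_norm {0<..<T} e * L2_norm {0<..<pi} f"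
proof -
  define e' where "e' t = indicator {0<..<T} t * e t" for t
  define f' where "f' t = indicator {0<..<pi} t * f t" for t
  have r: "borel_rep {0<..<T} e e'" "borel_rep {0<..<pi} f f'"
    unfolding e'_def f'_def by (rule borel_rep_continuous[OF e], rule borel_rep_continuous[OF f])
  note rs = sep_borel_rep[OF r]
  have S: "{0<..<T} \<in> sets borel" "{0<..<pi} \<in> sets borel" by auto
  have s: "sq_int lborel e'" "sq_int lborel f'"
    using borel_rep_sq_int[OF S(1) r(1)] borel_rep_sq_int[OF S(2) r(2)] continuous_sq_int_Ioo[OF e] continuous_sq_int_Ioo[OF f] by auto
  have i: "integrable lborel (\<lambda>z. (sep e' f' z)\<^sup>2)"
  proof -
    have "(\<lambda>(s, t). (e' s)\<^sup>2 * (f' t)\<^sup>2) = (\<lambda>z. (sep e' f' z)\<^sup>2)"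
      by (auto simp: sep_def power_mult_distrib)
    then show ?thesis
      using integrable_product_lborel[OF sq_intD(2)[OF s(1)] sq_intD(2)[OF s(2)]] unfolding lborel_prod by simp
  qed
  then have "sq_int lborel (sep e' f')" using borel_repD(1)[OF rs] by (simp add: sq_int_def)
  then show "sq_int (lebesgue_on (Q T)) (sep e f)" using borel_rep_sq_int[OF Q_borel rs] by simp
  have "(\<integral>z. (sep e f z)\<^sup>2 \<partial>lebesgue_on (Q T)) = (\<integral>t. (\<integral>x. (e' t)\<^sup>2 * (f' x)\<^sup>2 \<partial>lborel) \<partial>lborel)"
    using borel_rep_integral(2)[OF Q_borel borel_rep_power2[OF rs]] lborel_integral_iterated(1)[OF i]
    by (simp add: sep_def power_mult_distrib)
  also have "\<dots> = (\<integral>t. (e' t)\<^sup>2 \<partial>lborel) * (\<integral>x. (f' x)\<^sup>2 \<partial>lborel)" by simp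
  finally show "L2_norm (Q T) (sep e f) = L2_norm {0<..<T} e * L2_norm {0<..<pi} f"
    using borel_rep_integral(2)[OF S(1) borel_rep_power2[OF r(1)]] borel_rep_integral(2)[OF S(2) borel_rep_power2[OF r(2)]]
    by (simp add: L2_norm_def real_sqrt_mult)
qed

lemma sep_is_Dx:
  assumes e: "continuous_on {0..T} e" and f: "\<And>x. (f has_real_derivative f' x) (at x)" and f': "continuous_on {0..pi} f'"
  shows "is_Dx T (sep e f) (sep e f')"
proof -
  have "weak_deriv 0 pi (\<lambda>x. sep e f (t, x)) (\<lambda>x. sep e f' (t, x))" for t
    unfolding sep_def using f f'
    by (intro weak_deriv_C1) (auto intro!: continuous_intros DERIV_cmult simp: has_field_derivative_at_within)
  then show ?thesis
    using sep_L2(1)[OF e f'] by (simp add: is_Dx_def L2_on_iff)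
qed

lemma sep_is_Dtau:
  assumes T: "0 < T" and e: "\<And>t. t \<in> {0..T} \<Longrightarrow> (e has_real_derivative e' t) (at t within {0..T})"
    and e': "continuous_on {0..T} e'" and f: "continuous_on {0..pi} f"
  shows "is_Dtau T (sep e f) (sep e' f)"
proof -
  have "(\<integral>\<tau>. sep e f (\<tau>, x) * deriv \<phi> \<tau> \<partial>lebesgue_on {0<..<T}) = - (\<integral>\<tau>. sep e' f (\<tau>, x) * \<phi> \<tau> \<partial>lebesgue_on {0<..<T})"
    if \<phi>: "\<phi> \<in> test_fun 0 T" for \<phi> x
  proof -
    have "((\<lambda>t. e t * f x) has_real_derivative e' t * f x) (at t within {0..T})" if "t \<in> {0..T}" for t
      using DERIV_cmult_right[OF e[OF that]] .
    then show ?thesis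
      unfolding sep_def fst_conv snd_conv
      by (intro integral_by_parts_test_fun[OF T \<phi>]) (auto intro!: continuous_intros e')
  qed
  then show ?thesis
    using sep_L2(1)[OF e' f] by (simp add: is_Dtau_def L2_on_iff)
qed

text \<open>
  The test functions are primitives of \<open>cos\<close> times a symmetric cut-off: the product is odd about
  \<open>\<pi>/2\<close>, so that its primitive has compact support again.
\<close>

lemma sin_W12_0: "sin \<in> W12_0 0 pi"
proof -
  define \<psi> where "\<psi> n x = cos x * bump n (inverse (real (Suc n))) (pi - inverse (real (Suc n))) x" for n x
  have t\<psi>: "\<psi> n \<in> test_fun 0 pi" for n
    unfolding \<psi>_def
    by (rule test_funI[of _ _ "inverse (real (Suc n))" "pi - inverse (real (Suc n))"])
      (auto intro!: smooth_mult smooth_cos smooth_bump bump_zero)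
  have [measurable]: "\<psi> n \<in> borel_measurable borel" for n by (rule test_fun_borel[OF t\<psi>])
  have mean: "(\<integral>x. \<psi> n x \<partial>lebesgue_on {0<..<pi}) = 0" for n
  proof -
    have "\<psi> n (pi + (-1) * x) = - \<psi> n x" for x
    proof -
      have "pi + - 1 * x - inverse (real (Suc n)) = pi - inverse (real (Suc n)) - x"
        "pi - inverse (real (Suc n)) - (pi + - 1 * x) = x - inverse (real (Suc n))" by simp_all
      then show ?thesis unfolding \<psi>_def bump_def by (simp only:) simp
    qed
    then have "(\<integral>x. \<psi> n x \<partial>lborel) = - (\<integral>x. \<psi> n x \<partial>lborel)"
      using lborel_integral_real_affine[of "-1" "\<psi> n" pi] by simp
    then show ?thesis using test_fun_lborel(2)[OF t\<psi>] by simp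
  qed
  define \<phi> where "\<phi> n x = integral {0..x} (\<psi> n)" for n x
  have \<phi>: "\<phi> n \<in> test_fun 0 pi" "deriv (\<phi> n) = \<psi> n" for n
    using test_fun_antideriv[OF pi_gt_zero t\<psi> mean, of n] by (simp_all add: \<phi>_def[abs_def])
  let ?M = "lebesgue_on {0<..<pi}"
  have sd: "sq_int ?M (\<lambda>x. \<psi> n x - cos x)" for n
    by (intro continuous_sq_int_Ioo continuous_intros test_fun_continuous[OF t\<psi>])
  have sp: "sq_int ?M (\<lambda>x. \<phi> n x - sin x)" for n
    by (intro continuous_sq_int_Ioo continuous_intros test_fun_continuous[OF \<phi>(1)])
  interpret M: finite_measure ?M by (rule finite_lebesgue_on_Ioo)
  have lim2: "(\<lambda>n. \<integral>x. (\<psi> n x - cos x)\<^sup>2 \<partial>?M) \<longlonglongrightarrow> (\<integral>x. 0 \<partial>?M)"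
  proof (rule integral_dominated_convergence[where w = "\<lambda>_. 1"])
    show "AE x in ?M. (\<lambda>n. (\<psi> n x - cos x)\<^sup>2) \<longlonglongrightarrow> 0"
    proof (rule AE_I2)
      fix x assume "x \<in> space ?M"
      then have x: "0 < x" "x < pi" by auto
      have il: "(\<lambda>n. inverse (real (Suc n))) \<longlonglongrightarrow> 0" by (rule LIMSEQ_inverse_real_of_nat)
      have l: "(\<lambda>n. bump n (inverse (real (Suc n))) (pi - inverse (real (Suc n))) x) \<longlonglongrightarrow> 1"
      proof (rule tendsto_cong[THEN iffD1])
        let ?b = "\<lambda>n. exp (- inverse (real (Suc n)) / (x - inverse (real (Suc n)))) * exp (- inverse (real (Suc n)) / (pi - inverse (real (Suc n)) - x))"
        have "?b \<longlonglongrightarrow> exp (- 0 / (x - 0)) * exp (- 0 / (pi - 0 - x))"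
          by (intro tendsto_intros il) (use x in auto)
        then show "?b \<longlonglongrightarrow> 1" by simp
        have "\<forall>\<^sub>F n in sequentially. inverse (real (Suc n)) < x \<and> inverse (real (Suc n)) < pi - x"
          using order_tendstoD(2)[OF il, of x] order_tendstoD(2)[OF il, of "pi - x"] x by (auto intro: eventually_conj)
        then show "\<forall>\<^sub>F n in sequentially. ?b n = bump n (inverse (real (Suc n))) (pi - inverse (real (Suc n))) x"
          by eventually_elim (simp add: bump_def flat_def inverse_eq_divide)
      qed
      have "(\<lambda>n. (\<psi> n x - cos x)\<^sup>2) \<longlonglongrightarrow> (cos x * 1 - cos x)\<^sup>2"
        unfolding \<psi>_def by (intro tendsto_intros l)
      then show "(\<lambda>n. (\<psi> n x - cos x)\<^sup>2) \<longlonglongrightarrow> 0" by simp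
    qed
    show "AE x in ?M. norm ((\<psi> n x - cos x)\<^sup>2) \<le> 1" for n
    proof (rule AE_I2)
      fix x
      let ?b = "bump n (inverse (real (Suc n))) (pi - inverse (real (Suc n))) x"
      have "\<bar>\<psi> n x - cos x\<bar> = \<bar>cos x\<bar> * \<bar>?b - 1\<bar>"
        unfolding abs_mult[symmetric] \<psi>_def by (simp add: algebra_simps)
      also have "\<dots> \<le> 1 * 1"
        using bump_bounds[of n "inverse (real (Suc n))" "pi - inverse (real (Suc n))" x]
        by (intro mult_mono) auto
      finally have "\<bar>\<psi> n x - cos x\<bar> \<le> 1" by simp
      then have "(\<psi> n x - cos x)\<^sup>2 \<le> 1" by (simp add: abs_square_le_1)
      then show "norm ((\<psi> n x - cos x)\<^sup>2) \<le> 1" by simp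
    qed
    show "(\<lambda>x. (\<psi> n x - cos x)\<^sup>2) \<in> borel_measurable ?M" for n
      using sq_intD(2)[OF sd] by auto
  qed simp_all
  then have lim: "(\<lambda>n. L2_norm {0<..<pi} (\<lambda>x. \<psi> n x - cos x)) \<longlonglongrightarrow> 0"
    unfolding L2_norm_def using tendsto_real_sqrt by fastforce
  have bnd: "L2_norm {0<..<pi} (\<lambda>x. \<phi> n x - sin x) \<le> pi * L2_norm {0<..<pi} (\<lambda>x. \<psi> n x - cos x)" for n
  proof -
    let ?N = "L2_norm {0<..<pi} (\<lambda>x. \<psi> n x - cos x)"
    have pt: "(\<phi> n x - sin x)\<^sup>2 \<le> pi * ?N\<^sup>2" if x: "x \<in> {0<..<pi}" for x
    proof -
      have "((\<lambda>y. \<psi> n y - cos y) has_integral (\<phi> n x - sin x) - (\<phi> n 0 - sin 0)) {0..x}"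
      proof (rule fundamental_theorem_of_calculus)
        fix y
        have "((\<lambda>y. \<phi> n y - sin y) has_real_derivative \<psi> n y - cos y) (at y within {0..x})"
          using test_fun_has_deriv[OF \<phi>(1), of n y] \<phi>(2)[of n]
          by (intro DERIV_diff has_field_derivative_at_within[OF DERIV_sin]) (auto intro: has_field_derivative_at_within)
        then show "((\<lambda>y. \<phi> n y - sin y) has_vector_derivative \<psi> n y - cos y) (at y within {0..x})"
          by (simp add: has_real_derivative_iff_has_vector_derivative)
      qed (use x in auto)
      then have "\<phi> n x - sin x = integral {0..x} (\<lambda>y. \<psi> n y - cos y)"
        using test_fun_zero[OF \<phi>(1), of 0] by (simp add: integral_unique)
      also have "\<dots> = (\<integral>y. \<psi> n y - cos y \<partial>lebesgue_on {0<..<x})"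
        by (intro continuous_integral_Ioo(2)[symmetric] continuous_intros test_fun_continuous[OF t\<psi>])
      finally have eq: "\<phi> n x - sin x = (\<integral>y. \<psi> n y - cos y \<partial>lebesgue_on {0<..<x})" .
      have s1: "sq_int (lebesgue_on {0<..<x}) (\<lambda>y. \<psi> n y - cos y)" "sq_int (lebesgue_on {0<..<x}) (\<lambda>y. 1)"
        by (intro continuous_sq_int_Ioo continuous_intros test_fun_continuous[OF t\<psi>])+
      have "(\<phi> n x - sin x)\<^sup>2 \<le> (\<integral>y. (\<psi> n y - cos y)\<^sup>2 \<partial>lebesgue_on {0<..<x}) * (\<integral>y. 1 \<partial>lebesgue_on {0<..<x})"
        unfolding eq using Cauchy_Schwarz_integral[OF s1] by simp
      also have "\<dots> \<le> (\<integral>y. (\<psi> n y - cos y)\<^sup>2 \<partial>?M) * pi"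
      proof (intro mult_mono)
        have c: "continuous_on S (\<lambda>y. (\<psi> n y - cos y)\<^sup>2)" for S
          by (intro continuous_intros test_fun_continuous[OF t\<psi>])
        show "(\<integral>y. (\<psi> n y - cos y)\<^sup>2 \<partial>lebesgue_on {0<..<x}) \<le> (\<integral>y. (\<psi> n y - cos y)\<^sup>2 \<partial>?M)"
          unfolding continuous_integral_Ioo(2)[OF c] using x
          by (intro integral_subset_le integrable_continuous_interval c) auto
        show "(\<integral>y. 1 \<partial>lebesgue_on {0<..<x}) \<le> pi"
          using continuous_integral_Ioo(2)[of 0 x "\<lambda>_. 1"] x by simp
      qed simp_all
      also have "\<dots> = pi * ?N\<^sup>2" by (simp add: L2_norm_def)
      finally show ?thesis .
    qed
    have "(\<integral>x. (\<phi> n x - sin x)\<^sup>2 \<partial>?M) \<le> (\<integral>x. pi * ?N\<^sup>2 \<partial>?M)"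
      using sq_intD(2)[OF sp] pt by (intro integral_mono) auto
    also have "\<dots> = pi * (pi * ?N\<^sup>2)"
      using continuous_integral_Ioo(2)[of 0 pi "\<lambda>_. pi * ?N\<^sup>2"] by simp
    also have "\<dots> = (pi * ?N)\<^sup>2" by (simp add: power2_eq_square)
    finally show ?thesis
      unfolding L2_norm_def[of _ "\<lambda>x. \<phi> n x - sin x"] by (intro real_le_lsqrt) (auto simp: L2_norm_nonneg)
  qed
  have "\<exists>\<phi>\<in>test_fun 0 pi. L2_norm {0<..<pi} (\<lambda>x. \<phi> x - sin x) < \<epsilon> \<and> L2_norm {0<..<pi} (\<lambda>x. deriv \<phi> x - cos x) < \<epsilon>"
    if e: "0 < \<epsilon>" for \<epsilon>
  proof -
    have "\<forall>\<^sub>F n in sequentially. L2_norm {0<..<pi} (\<lambda>x. \<psi> n x - cos x) < min \<epsilon> (\<epsilon> / pi)"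
      using e by (intro order_tendstoD(2)[OF lim]) auto
    then obtain n where "L2_norm {0<..<pi} (\<lambda>x. \<psi> n x - cos x) < min \<epsilon> (\<epsilon> / pi)"
      using eventually_happens sequentially_bot by blast
    then have n: "L2_norm {0<..<pi} (\<lambda>x. \<psi> n x - cos x) < \<epsilon>" "pi * L2_norm {0<..<pi} (\<lambda>x. \<psi> n x - cos x) < \<epsilon>"
      by (auto simp: field_simps)
    show ?thesis
      by (rule bexI[OF _ \<phi>(1)[of n]]) (use n bnd[of n] in \<open>auto simp: \<phi>(2)\<close>)
  qed
  moreover have "weak_deriv 0 pi sin cos"
    by (rule weak_deriv_C1) (auto intro!: continuous_intros has_field_derivative_at_within[OF DERIV_sin])
  ultimately show ?thesis unfolding W12_0_def by blast
qed

lemma W12_0_cmult: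
  assumes f: "f \<in> W12_0 a b" and ab: "a < b"
  shows "(\<lambda>x. k * f x) \<in> W12_0 a b"
proof -
  obtain g where g: "weak_deriv a b f g" using W12_0_weak_deriv[OF f] by blast
  have "weak_deriv a b (\<lambda>x. k * f x) (\<lambda>x. k * g x)"
    using weak_derivD[OF g] by (simp add: weak_deriv_def L2_on_iff sq_int_cmult mult.assoc)
  moreover have "\<exists>\<phi>\<in>test_fun a b. L2_norm {a<..<b} (\<lambda>x. \<phi> x - k * f x) < \<epsilon> \<and>
      L2_norm {a<..<b} (\<lambda>x. deriv \<phi> x - k * g x) < \<epsilon>" if e: "0 < \<epsilon>" for \<epsilon>
  proof -
    have e': "0 < \<epsilon> / (\<bar>k\<bar> + 1)" using e by simp
    obtain \<phi> where \<phi>: "\<phi> \<in> test_fun a b" "L2_norm {a<..<b} (\<lambda>x. \<phi> x - f x) < \<epsilon> / (\<bar>k\<bar> + 1)"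
        "L2_norm {a<..<b} (\<lambda>x. deriv \<phi> x - g x) < \<epsilon> / (\<bar>k\<bar> + 1)"
      using W12_0E[OF f g ab e'] by blast
    have d: "deriv (\<lambda>x. k * \<phi> x) x = k * deriv \<phi> x" for x
      by (intro DERIV_imp_deriv DERIV_cmult test_fun_has_deriv[OF \<phi>(1)])
    have sc: "\<bar>k\<bar> * N < \<epsilon>" if "0 \<le> N" "N < \<epsilon> / (\<bar>k\<bar> + 1)" for N
    proof -
      have "\<bar>k\<bar> * N \<le> (\<bar>k\<bar> + 1) * N" using that(1) by (simp add: mult_right_mono)
      also have "\<dots> < \<epsilon>" using that(2) by (simp add: pos_less_divide_eq mult.commute add_pos_nonneg)
      finally show ?thesis .
    qed
    have "L2_norm {a<..<b} (\<lambda>x. k * (\<phi> x - f x)) < \<epsilon>" "L2_norm {a<..<b} (\<lambda>x. k * (deriv \<phi> x - g x)) < \<epsilon>"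
      unfolding L2_norm_cmult using sc[OF L2_norm_nonneg \<phi>(2)] sc[OF L2_norm_nonneg \<phi>(3)] by auto
    then show ?thesis
      by (intro bexI[OF _ test_fun_cmult[OF \<phi>(1), of k]]) (simp add: d right_diff_distrib)
  qed
  ultimately show ?thesis unfolding W12_0_def by blast
qed

lemma L2_norm_sin_cos: "L2_norm {0<..<pi} sin = sqrt (pi / 2)" "L2_norm {0<..<pi} cos = sqrt (pi / 2)"
proof -
  have c: "continuous_on {0..pi} (\<lambda>x. (sin x)\<^sup>2)" "continuous_on {0..pi} (\<lambda>x. (cos x)\<^sup>2)"
    by (intro continuous_intros)+
  have "((\<lambda>x. (sin x)\<^sup>2) has_integral (pi - sin pi * cos pi) / 2 - (0 - sin 0 * cos 0) / 2) {0..pi}"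
  proof (rule fundamental_theorem_of_calculus)
    fix x
    have "((\<lambda>x. (x - sin x * cos x) / 2) has_real_derivative (1 - (cos x * cos x - sin x * sin x)) / 2) (at x within {0..pi})"
      by (auto intro!: derivative_eq_intros)
    moreover have "(1 - (cos x * cos x - sin x * sin x)) / 2 = (sin x)\<^sup>2"
      using sin_cos_squared_add[of x] by (simp add: power2_eq_square)
    ultimately show "((\<lambda>x. (x - sin x * cos x) / 2) has_vector_derivative (sin x)\<^sup>2) (at x within {0..pi})"
      by (simp add: has_real_derivative_iff_has_vector_derivative)
  qed simp
  then show "L2_norm {0<..<pi} sin = sqrt (pi / 2)"
    unfolding L2_norm_def continuous_integral_Ioo(2)[OF c(1)] by (simp add: integral_unique)
  have "((\<lambda>x. (cos x)\<^sup>2) has_integral (pi + sin pi * cos pi) / 2 - (0 + sin 0 * cos 0) / 2) {0..pi}"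
  proof (rule fundamental_theorem_of_calculus)
    fix x
    have "((\<lambda>x. (x + sin x * cos x) / 2) has_real_derivative (1 + (cos x * cos x - sin x * sin x)) / 2) (at x within {0..pi})"
      by (auto intro!: derivative_eq_intros)
    moreover have "(1 + (cos x * cos x - sin x * sin x)) / 2 = (cos x)\<^sup>2"
      using sin_cos_squared_add[of x] by (simp add: power2_eq_square)
    ultimately show "((\<lambda>x. (x + sin x * cos x) / 2) has_vector_derivative (cos x)\<^sup>2) (at x within {0..pi})"
      by (simp add: has_real_derivative_iff_has_vector_derivative)
  qed simp
  then show "L2_norm {0<..<pi} cos = sqrt (pi / 2)"
    unfolding L2_norm_def continuous_integral_Ioo(2)[OF c(2)] by (simp add: integral_unique)
qed

text \<open>A \<open>C\<^sup>1\<close> function on \<open>[0,T]\<close> together with its derivative, which is one-sided at the end points.\<close>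

definition C1_on :: "real \<Rightarrow> (real \<Rightarrow> real) \<Rightarrow> (real \<Rightarrow> real) \<Rightarrow> bool" where
  "C1_on T e e' \<longleftrightarrow> (\<forall>t\<in>{0..T}. (e has_real_derivative e' t) (at t within {0..T})) \<and> continuous_on {0..T} e'"

lemma C1_onD:
  assumes "C1_on T e e'"
  shows "t \<in> {0..T} \<Longrightarrow> (e has_real_derivative e' t) (at t within {0..T})" "continuous_on {0..T} e'" "continuous_on {0..T} e"
  using assms DERIV_continuous_on[of "{0..T}" e e'] by (auto simp: C1_on_def)

lemma sep_sin_derivs:
  assumes T: "0 < T" and e: "C1_on T e e'" and w: "AE z in lebesgue_on (Q T). w z = sep e sin z"
  shows "AE z in lebesgue_on (Q T). Dx T w z = sep e cos z"
    "AE z in lebesgue_on (Q T). Dxx T w z = sep e (\<lambda>x. - sin x) z"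
    "AE z in lebesgue_on (Q T). Dtau T w z = sep e' sin z"
    "is_Dx T (sep e sin) (sep e cos)" "is_Dx T (sep e cos) (sep e (\<lambda>x. - sin x))" "is_Dtau T (sep e sin) (sep e' sin)"
proof -
  note c = C1_onD[OF e]
  show 1: "is_Dx T (sep e sin) (sep e cos)"
    by (rule sep_is_Dx[OF c(3)]) (auto intro!: continuous_intros)
  show 2: "is_Dx T (sep e cos) (sep e (\<lambda>x. - sin x))"
    by (rule sep_is_Dx[OF c(3)]) (auto intro!: continuous_intros derivative_eq_intros)
  show 3: "is_Dtau T (sep e sin) (sep e' sin)"
    by (rule sep_is_Dtau[OF T c(1,2)]) (auto intro!: continuous_intros)
  have sq: "sq_int (lebesgue_on (Q T)) (sep e sin)" by (rule sep_L2(1)[OF c(3)]) (auto intro!: continuous_intros)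
  note w' = AE_sym[OF w]
  have d: "is_Dx T w (sep e cos)" by (rule is_Dx_AE_cong[OF w' 1])
  show "AE z in lebesgue_on (Q T). Dx T w z = sep e cos z" by (rule Dx_AE_eq[OF d])
  show "AE z in lebesgue_on (Q T). Dxx T w z = sep e (\<lambda>x. - sin x) z" by (rule Dxx_AE_eq[OF d 2])
  show "AE z in lebesgue_on (Q T). Dtau T w z = sep e' sin z"
    by (rule Dtau_AE_eq[OF T is_Dtau_AE_cong[OF T sq_intD(1)[OF sq] w' 3]])
qed

lemma L2_norm_AE_cong:
  assumes "S \<in> sets borel" "AE z in lebesgue_on S. f z = g z" "sq_int (lebesgue_on S) g"
  shows "L2_norm S f = L2_norm S g"
proof -
  have "f \<in> borel_measurable (lebesgue_on S)"
    by (rule borel_measurable_lebesgue_on_AE[OF assms(1) sq_intD(1)[OF assms(3)] AE_sym[OF assms(2)]])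
  then show ?thesis
    unfolding L2_norm_def using assms sq_intD[OF assms(3)]
    by (intro arg_cong[where f = sqrt] integral_cong_AE) (auto elim: eventually_mono)
qed

lemma X2_norm_sep_sin:
  assumes T: "0 < T" and e: "C1_on T e e'" and w: "AE z in lebesgue_on (Q T). w z = sep e sin z"
  shows "X2_norm T w = sqrt (pi / 2) * (3 * L2_norm {0<..<T} e + L2_norm {0<..<T} e')"
proof -
  note c = C1_onD[OF e]
  have k: "continuous_on {0..pi} sin" "continuous_on {0..pi} cos" "continuous_on {0..pi} (\<lambda>x. - sin x :: real)"
    by (intro continuous_intros)+
  have ms: "L2_norm {0<..<pi} (\<lambda>x. - sin x) = sqrt (pi / 2)"
    using L2_norm_cmult[of "{0<..<pi}" "-1" sin] by (simp add: L2_norm_sin_cos)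
  note d = sep_sin_derivs[OF assms]
  show ?thesis
    unfolding X2_norm_def
      L2_norm_AE_cong[OF Q_borel w sep_L2(1)[OF c(3) k(1)]] L2_norm_AE_cong[OF Q_borel d(1) sep_L2(1)[OF c(3) k(2)]]
      L2_norm_AE_cong[OF Q_borel d(2) sep_L2(1)[OF c(3) k(3)]] L2_norm_AE_cong[OF Q_borel d(3) sep_L2(1)[OF c(2) k(1)]]
      sep_L2(2)[OF c(3) k(1)] sep_L2(2)[OF c(3) k(2)] sep_L2(2)[OF c(3) k(3)] sep_L2(2)[OF c(2) k(1)] L2_norm_sin_cos ms
    by (simp add: algebra_simps)
qed

lemma sep_sin_X2_0:
  assumes T: "0 < T" and e: "C1_on T e e'" and e0: "e 0 = 0"
  shows "sep e sin \<in> X2_0 T"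
proof -
  note c = C1_onD[OF e]
  have w: "AE z in lebesgue_on (Q T). sep e sin z = sep e sin z" by simp
  note d = sep_sin_derivs[OF T e w]
  have k: "continuous_on {0..pi} sin" by (intro continuous_intros)
  have "sep e sin \<in> X2 T"
    using d(4-6) sep_L2(1)[OF c(3) k] by (auto simp: X2_def L2_on_iff)
  moreover have "(\<lambda>x. sep e sin (\<tau>, x)) \<in> W12_0 0 pi" for \<tau>
    using W12_0_cmult[OF sin_W12_0 pi_gt_zero, of "e \<tau>"] by (simp add: sep_def)
  moreover have "zero_initial T (sep e sin)"
    unfolding zero_initial_def
  proof (intro exI[of _ "\<lambda>t x. e t * sin x"] conjI ballI)
    fix t assume t: "t \<in> {0..T}"
    show "(\<lambda>x. e t * sin x) \<in> L2_on {0<..<pi}"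
      unfolding L2_on_iff by (intro continuous_sq_int_Ioo continuous_intros)
    have "((\<lambda>s. \<bar>e s - e t\<bar> * sqrt (pi / 2)) \<longlongrightarrow> \<bar>e t - e t\<bar> * sqrt (pi / 2)) (at t within {0..T})"
      using c(3) t by (intro tendsto_intros) (simp add: continuous_on)
    moreover have "L2_norm {0<..<pi} (\<lambda>x. e s * sin x - e t * sin x) = \<bar>e s - e t\<bar> * sqrt (pi / 2)" for s
      using L2_norm_cmult[of "{0<..<pi}" "e s - e t" sin] by (simp add: L2_norm_sin_cos left_diff_distrib)
    ultimately show "((\<lambda>s. L2_norm {0<..<pi} (\<lambda>x. e s * sin x - e t * sin x)) \<longlongrightarrow> 0) (at t within {0..T})"
      by simp
  qed (simp_all add: sep_def e0)
  ultimately show ?thesis by (simp add: X2_0_def)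
qed

section \<open>Scalar linear differential equations\<close>

lemma linear_ode_exists:
  assumes T: "0 < T" and A: "continuous_on {0..T} A" and b: "continuous_on {0..T} b"
  shows "\<exists>y. y 0 = 0 \<and> C1_on T y (\<lambda>t. b t - A t * y t)"
proof -
  define I where "I t = integral {0..t} A" for t
  have dI: "(I has_real_derivative A t) (at t within {0..T})" if "t \<in> {0..T}" for t
    unfolding I_def by (rule integral_has_real_derivative[OF A that])
  have cI: "continuous_on {0..T} I" by (rule DERIV_continuous_on[OF dI])
  define J where "J t = integral {0..t} (\<lambda>s. exp (I s) * b s)" for t
  have dJ: "(J has_real_derivative exp (I t) * b t) (at t within {0..T})" if "t \<in> {0..T}" for t
    unfolding J_def by (intro integral_has_real_derivative[OF _ that] continuous_intros cI b)
  define y where "y t = exp (- I t) * J t" for t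
  have dy: "(y has_real_derivative b t - A t * y t) (at t within {0..T})" if t: "t \<in> {0..T}" for t
  proof -
    have "(y has_real_derivative exp (- I t) * (exp (I t) * b t) + exp (- I t) * (- A t) * J t) (at t within {0..T})"
      unfolding y_def by (auto intro!: derivative_eq_intros dI[OF t] dJ[OF t])
    moreover have "exp (- I t) * (exp (I t) * b t) + exp (- I t) * (- A t) * J t = b t - A t * y t"
      by (simp add: y_def exp_minus algebra_simps)
    ultimately show ?thesis by simp
  qed
  have "continuous_on {0..T} y" by (rule DERIV_continuous_on[OF dy])
  then have "continuous_on {0..T} (\<lambda>t. b t - A t * y t)" by (intro continuous_intros A b)
  moreover have "y 0 = 0" by (simp add: y_def J_def)
  ultimately show ?thesis using dy by (auto simp: C1_on_def)
qed

text \<open>Comparison principle: multiplied by the integrating factor, \<open>y\<close> is nondecreasing.\<close>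

lemma linear_ode_nonneg:
  assumes y: "C1_on T y y'" and y0: "y 0 = 0" and A: "continuous_on {0..T} A"
    and f: "\<And>t. t \<in> {0..T} \<Longrightarrow> 0 \<le> y' t + A t * y t" and t: "t \<in> {0..T}"
  shows "0 \<le> y t"
proof -
  define I where "I s = integral {0..s} A" for s
  have dI: "(I has_real_derivative A s) (at s within {0..T})" if "s \<in> {0..T}" for s
    unfolding I_def by (rule integral_has_real_derivative[OF A that])
  have "((\<lambda>s. exp (I s) * (y' s + A s * y s)) has_integral exp (I t) * y t - exp (I 0) * y 0) {0..t}"
  proof (rule fundamental_theorem_of_calculus)
    fix s assume "s \<in> {0..t}"
    then have s: "s \<in> {0..T}" using t by auto
    have "((\<lambda>s. exp (I s) * y s) has_real_derivative exp (I s) * (y' s + A s * y s)) (at s within {0..T})"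
      by (auto intro!: derivative_eq_intros dI[OF s] C1_onD(1)[OF y s] simp: algebra_simps)
    then have "((\<lambda>s. exp (I s) * y s) has_real_derivative exp (I s) * (y' s + A s * y s)) (at s within {0..t})"
      by (rule has_field_derivative_subset) (use t in auto)
    then show "((\<lambda>s. exp (I s) * y s) has_vector_derivative exp (I s) * (y' s + A s * y s)) (at s within {0..t})"
      by (simp add: has_real_derivative_iff_has_vector_derivative)
  qed (use t in simp)
  then have "0 \<le> exp (I t) * y t - exp (I 0) * y 0"
    by (rule has_integral_nonneg) (use f t in auto)
  then show ?thesis using y0 by (simp add: zero_le_mult_iff)
qed

lemma C1_on_diff: "C1_on T e e' \<Longrightarrow> C1_on T f f' \<Longrightarrow> C1_on T (\<lambda>t. e t - f t) (\<lambda>t. e' t - f' t)"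
  by (auto simp: C1_on_def intro!: DERIV_diff continuous_intros)

lemma C1_on_zero: "C1_on T (\<lambda>_. 0) (\<lambda>_. 0)"
  by (auto simp: C1_on_def)

lemma L2_norm_mono:
  assumes f: "continuous_on {0..T} f" and g: "continuous_on {0..T} g"
    and "\<And>t. t \<in> {0<..<T} \<Longrightarrow> \<bar>f t\<bar> \<le> \<bar>g t\<bar>"
  shows "L2_norm {0<..<T::real} f \<le> L2_norm {0<..<T} g"
  unfolding L2_norm_def real_sqrt_le_iff
  using sq_intD(2)[OF continuous_sq_int_Ioo[OF f]] sq_intD(2)[OF continuous_sq_int_Ioo[OF g]] assms(3)
  by (intro integral_mono) (auto simp: abs_le_square_iff)

lemma L2_norm_const: "0 < T \<Longrightarrow> L2_norm {0<..<T::real} (\<lambda>_. c) = sqrt T * \<bar>c\<bar>"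
  using continuous_integral_Ioo(2)[of 0 T "\<lambda>_. c\<^sup>2"] by (simp add: L2_norm_def real_sqrt_mult)

text \<open>
  Multiplying \<open>e' + A e = f\<close> by \<open>e\<close> and integrating bounds \<open>e\<close>, since the integral of \<open>e e'\<close> is
  \<open>e(T)\<^sup>2 / 2 \<ge> 0\<close>; the equation itself then bounds \<open>e'\<close>.
\<close>

lemma linear_ode_L2:
  assumes T: "0 < T" and e: "C1_on T e e'" and e0: "e 0 = 0" and A: "continuous_on {0..T} A"
    and d: "0 < d" and Ab: "\<And>t. t \<in> {0<..<T} \<Longrightarrow> d \<le> A t" "\<And>t. t \<in> {0<..<T} \<Longrightarrow> A t \<le> a"
  defines "F \<equiv> L2_norm {0<..<T} (\<lambda>t. e' t + A t * e t)"
  shows "L2_norm {0<..<T} e \<le> F / d" "L2_norm {0<..<T} e' \<le> F + a * (F / d)"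
proof -
  note c = C1_onD[OF e]
  let ?M = "lebesgue_on {0<..<T}" and ?N = "L2_norm {0<..<T}"
  let ?f = "\<lambda>t. e' t + A t * e t"
  have cf: "continuous_on {0..T} ?f" by (intro continuous_intros c A)
  have "((\<lambda>t. e t * e' t) has_integral (e T)\<^sup>2 / 2 - (e 0)\<^sup>2 / 2) {0..T}"
  proof (rule fundamental_theorem_of_calculus)
    fix t assume t: "t \<in> {0..T}"
    have "((\<lambda>t. (e t)\<^sup>2 / 2) has_real_derivative e t * e' t) (at t within {0..T})"
      by (auto intro!: derivative_eq_intros c(1)[OF t])
    then show "((\<lambda>t. (e t)\<^sup>2 / 2) has_vector_derivative e t * e' t) (at t within {0..T})"
      by (simp add: has_real_derivative_iff_has_vector_derivative)
  qed (use T in simp)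
  then have en: "0 \<le> (\<integral>t. e t * e' t \<partial>?M)"
    by (subst continuous_integral_Ioo(2)) (auto intro!: continuous_intros c simp: integral_unique e0)
  have "d * (?N e)\<^sup>2 = (\<integral>t. d * (e t)\<^sup>2 \<partial>?M)" by (simp add: L2_norm_def)
  also have "\<dots> \<le> (\<integral>t. ?f t * e t - e t * e' t \<partial>?M)"
  proof (rule integral_mono)
    show "integrable ?M (\<lambda>t. d * (e t)\<^sup>2)" "integrable ?M (\<lambda>t. ?f t * e t - e t * e' t)"
      by (intro continuous_integral_Ioo(1) continuous_intros c A)+
    fix t assume "t \<in> space ?M"
    then have "d * (e t)\<^sup>2 \<le> A t * (e t)\<^sup>2" using Ab(1)[of t] by (intro mult_right_mono) auto
    then show "d * (e t)\<^sup>2 \<le> ?f t * e t - e t * e' t" by (simp add: algebra_simps power2_eq_square)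
  qed
  also have "\<dots> = (\<integral>t. ?f t * e t \<partial>?M) - (\<integral>t. e t * e' t \<partial>?M)"
    by (intro Bochner_Integration.integral_diff continuous_integral_Ioo(1) continuous_intros c A)
  also have "\<dots> \<le> (\<integral>t. ?f t * e t \<partial>?M)" using en by simp
  also have "\<dots> \<le> F * ?N e"
    using Cauchy_Schwarz_sqrt[OF continuous_sq_int_Ioo[OF cf] continuous_sq_int_Ioo[OF c(3)]]
    by (simp add: F_def L2_norm_def)
  finally have "d * ?N e * ?N e \<le> F * ?N e" by (simp add: power2_eq_square mult.assoc)
  moreover have F0: "0 \<le> F" by (simp add: F_def L2_norm_nonneg)
  ultimately have "d * ?N e \<le> F"
    using L2_norm_nonneg[of "{0<..<T}" e] by (cases "?N e = 0") auto
  then show 1: "?N e \<le> F / d" using d by (simp add: field_simps)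
  have a: "0 < a" using Ab[of "T / 2"] T d by auto
  have "?N e' = ?N (\<lambda>t. ?f t - A t * e t)" by simp
  also have "\<dots> \<le> F + ?N (\<lambda>t. A t * e t)"
    unfolding F_def by (intro L2_norm_diff_le continuous_sq_int_Ioo cf continuous_intros A c)
  also have "?N (\<lambda>t. A t * e t) \<le> ?N (\<lambda>t. a * e t)"
  proof (rule L2_norm_mono)
    fix t assume "t \<in> {0<..<T}"
    then show "\<bar>A t * e t\<bar> \<le> \<bar>a * e t\<bar>"
      unfolding abs_mult using Ab[of t] d by (intro mult_right_mono) auto
  qed (intro continuous_intros A c)+
  also have "\<dots> = a * ?N e" using a by (simp add: L2_norm_cmult)
  also have "a * ?N e \<le> a * (F / d)" using 1 a by (intro mult_left_mono) auto
  finally show "?N e' \<le> F + a * (F / d)" by simp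
qed

text \<open>The one-dimensional Sobolev inequality for functions vanishing at the left end point.\<close>

lemma Sobolev_left:
  assumes e: "C1_on T e e'" and e0: "e 0 = 0" and t: "t \<in> {0..T}"
  shows "\<bar>e t\<bar> \<le> sqrt T * L2_norm {0<..<T} e'"
proof -
  note c = C1_onD[OF e]
  have "(e' has_integral e t - e 0) {0..t}"
  proof (rule fundamental_theorem_of_calculus)
    fix s assume "s \<in> {0..t}"
    then have "(e has_real_derivative e' s) (at s within {0..t})"
      using t by (intro has_field_derivative_subset[OF c(1)]) auto
    then show "(e has_vector_derivative e' s) (at s within {0..t})"
      by (simp add: has_real_derivative_iff_has_vector_derivative)
  qed (use t in simp)
  then have "e t = integral {0..t} e'" using e0 by (simp add: integral_unique)
  have c': "continuous_on {0..t} e'" using t by (intro continuous_on_subset[OF c(2)]) auto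
  have "\<bar>e t\<bar> = \<bar>\<integral>s. e' s * 1 \<partial>lebesgue_on {0<..<t}\<bar>"
    using \<open>e t = _\<close> continuous_integral_Ioo(2)[OF c'] by simp
  also have "\<dots> \<le> sqrt (\<integral>s. (e' s)\<^sup>2 \<partial>lebesgue_on {0<..<t}) * sqrt (\<integral>s. 1\<^sup>2 \<partial>lebesgue_on {0<..<t})"
    by (rule Cauchy_Schwarz_sqrt[OF continuous_sq_int_Ioo[OF c'] continuous_sq_int_Ioo]) simp
  also have "\<dots> \<le> L2_norm {0<..<T} e' * sqrt T"
  proof (rule mult_mono)
    show "sqrt (\<integral>s. (e' s)\<^sup>2 \<partial>lebesgue_on {0<..<t}) \<le> L2_norm {0<..<T} e'"
    proof -
      have "continuous_on {0..t} (\<lambda>s. (e' s)\<^sup>2)" "continuous_on {0..T} (\<lambda>s. (e' s)\<^sup>2)"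
        by (intro continuous_intros c c')+
      then show ?thesis
        unfolding L2_norm_def real_sqrt_le_iff using t
        by (subst (1 2) continuous_integral_Ioo(2)) (auto intro!: integral_subset_le integrable_continuous_interval)
    qed
    show "sqrt (\<integral>s. 1\<^sup>2 \<partial>lebesgue_on {0<..<t}) \<le> sqrt T"
      using continuous_integral_Ioo(2)[of 0 t "\<lambda>_. 1"] t by simp
  qed (simp_all add: L2_norm_nonneg)
  finally show ?thesis by (simp add: mult.commute)
qed

section \<open>The Riccati equation and its Newton iteration\<close>

text \<open>
  The equation \<open>q' = \<eta> - a q + (\<kappa>/2) q\<^sup>2\<close> on \<open>[0,T]\<close>; \<open>P\<close> is the smaller of the two positive roots of the
  right-hand side.
\<close>

locale riccati =
  fixes a \<kappa> \<eta> \<delta> P T :: real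
  assumes a: "0 < a" and \<kappa>: "0 < \<kappa>" and \<eta>: "0 < \<eta>" and \<delta>: "0 < \<delta>" and \<delta>2: "\<delta>\<^sup>2 = a\<^sup>2 - 2 * \<kappa> * \<eta>"
    and P: "P = (a - \<delta>) / \<kappa>" and T: "0 < T"
begin

lemma \<kappa>P: "\<kappa> * P = a - \<delta>" using \<kappa> P by simp

lemma \<delta>_less: "\<delta> < a"
proof -
  have "\<delta>\<^sup>2 < a\<^sup>2" using \<delta>2 \<kappa> \<eta> by simp
  then show ?thesis using a by (simp add: power2_less_imp_less)
qed

lemma P_pos: "0 < P" using \<delta>_less \<kappa> P by simp

lemma P_root: "\<eta> - a * P + \<kappa> / 2 * P\<^sup>2 = 0"
proof -
  have "2 * \<kappa> * (\<eta> - a * P + \<kappa> / 2 * P\<^sup>2) = 2 * \<kappa> * \<eta> - 2 * a * (\<kappa> * P) + (\<kappa> * P)\<^sup>2"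
    by (simp add: algebra_simps power2_eq_square)
  also have "\<dots> = 0" unfolding \<kappa>P using \<delta>2 by (simp add: algebra_simps power2_eq_square)
  finally show ?thesis using \<kappa> by simp
qed

text \<open>\<open>R\<close> is the larger root of the right-hand side \<open>\<eta> - a q + (\<kappa>/2) q\<^sup>2\<close>.\<close>

definition "R = (a + \<delta>) / \<kappa>"

lemma PR: "P < R" "R - P = 2 * \<delta> / \<kappa>" "P + R = 2 * a / \<kappa>" "P * R = 2 * \<eta> / \<kappa>"
proof -
  show "R - P = 2 * \<delta> / \<kappa>" "P + R = 2 * a / \<kappa>"
    by (simp_all add: R_def P add_divide_distrib diff_divide_distrib)
  show "P < R" using \<delta> \<kappa> by (simp add: R_def P divide_strict_right_mono)
  have "P * R = (a\<^sup>2 - \<delta>\<^sup>2) / \<kappa>\<^sup>2"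
    by (simp add: R_def P power2_eq_square algebra_simps)
  then show "P * R = 2 * \<eta> / \<kappa>" using \<kappa> \<delta>2 by (simp add: power2_eq_square)
qed

lemma rhs_factor: "\<eta> - a * y + \<kappa> / 2 * y\<^sup>2 = \<kappa> / 2 * ((y - P) * (y - R))"
proof -
  have "\<kappa> / 2 * ((y - P) * (y - R)) = \<kappa> / 2 * y\<^sup>2 - \<kappa> / 2 * (P + R) * y + \<kappa> / 2 * (P * R)"
    by (simp add: algebra_simps power2_eq_square add_divide_distrib)
  also have "\<dots> = \<kappa> / 2 * y\<^sup>2 - a * y + \<eta>" unfolding PR(3,4) using \<kappa> by simp
  finally show ?thesis by simp
qed

text \<open>The solution that starts in \<open>0\<close>; the explicit formula is used for \<open>t \<ge> 0\<close>, where the denominator is positive.\<close>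

definition q :: "real \<Rightarrow> real" where
  "q t = P * R * (1 - exp (- \<delta> * t)) / (R - P * exp (- \<delta> * t))"

text \<open>The right-hand side along \<open>q\<close>; it is the derivative of \<open>q\<close> at nonnegative times.\<close>

definition q' :: "real \<Rightarrow> real" where
  "q' t = \<eta> - a * q t + \<kappa> / 2 * (q t)\<^sup>2"

lemma q_0: "q 0 = 0" by (simp add: q_def)

lemma denom_pos: "0 \<le> t \<Longrightarrow> 0 < R - P * exp (- \<delta> * t)"
proof -
  assume "0 \<le> t"
  then have "exp (- \<delta> * t) \<le> 1" using \<delta> by simp
  then have "P * exp (- \<delta> * t) \<le> P * 1" using P_pos by (intro mult_left_mono) auto
  then show ?thesis using PR(1) by simp
qed

lemma q_bounds:
  assumes "0 \<le> t"
  shows "0 \<le> q t" "q t \<le> P"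
proof -
  have E: "exp (- \<delta> * t) \<le> 1" using \<delta> assms by simp
  note d = denom_pos[OF assms]
  show "0 \<le> q t" unfolding q_def using d E P_pos PR(1) by (intro divide_nonneg_pos mult_nonneg_nonneg) auto
  have "P * R * (1 - exp (- \<delta> * t)) \<le> P * (R - P * exp (- \<delta> * t))"
  proof -
    have "P * (P * exp (- \<delta> * t)) \<le> P * (R * exp (- \<delta> * t))"
      using PR(1) P_pos by (intro mult_left_mono mult_right_mono) auto
    then show ?thesis by (simp add: algebra_simps)
  qed
  then show "q t \<le> P" unfolding q_def using d by (simp add: pos_divide_le_eq)
qed

lemma q_derivative:
  assumes t: "0 \<le> t"
  shows "(q has_real_derivative q' t) (at t within S)"
proof -
  define E where "E = exp (- \<delta> * t)"
  define D where "D = R - P * E"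
  have D: "0 < D" using denom_pos[OF t] by (simp add: D_def E_def)
  have "(q has_real_derivative (P * R * (\<delta> * E) * D - P * R * (1 - E) * (P * (\<delta> * E))) / (D * D)) (at t within S)"
    unfolding q_def using D by (auto intro!: derivative_eq_intros simp: D_def E_def algebra_simps)
  moreover have "(P * R * (\<delta> * E) * D - P * R * (1 - E) * (P * (\<delta> * E))) = P * R * \<delta> * E * (R - P)"
    by (simp add: D_def algebra_simps)
  moreover have "q' t = P * R * \<delta> * E * (R - P) / (D * D)"
  proof -
    have q: "q t = P * R * (1 - E) / D" by (simp add: q_def D_def E_def)
    have 1: "q t - P = - (P * E * (R - P)) / D" unfolding q using D by (simp add: D_def field_simps)
    have 2: "q t - R = - (R * (R - P)) / D" unfolding q using D by (simp add: D_def field_simps)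
    have "q' t = \<kappa> / 2 * (R - P) * (P * R * E * (R - P)) / (D * D)"
      unfolding q'_def rhs_factor 1 2 by simp
    also have "\<kappa> / 2 * (R - P) = \<delta>" unfolding PR(2) using \<kappa> by simp
    finally show ?thesis by (simp add: mult_ac)
  qed
  ultimately show ?thesis by simp
qed

lemma C1_q: "C1_on T q q'"
proof -
  have d: "(q has_real_derivative q' t) (at t within {0..T})" if "t \<in> {0..T}" for t
    using q_derivative that by auto
  then have "continuous_on {0..T} q" by (rule DERIV_continuous_on)
  then show ?thesis using d unfolding C1_on_def q'_def by (auto intro!: continuous_intros)
qed

text \<open>The right-hand side of the linear equation that defines the successor of \<open>p\<close>.\<close>

definition rhs :: "(real \<Rightarrow> real) \<Rightarrow> (real \<Rightarrow> real) \<Rightarrow> real \<Rightarrow> real" where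
  "rhs p y t = (\<eta> - \<kappa> / 2 * (p t)\<^sup>2) - (a - \<kappa> * p t) * y t"

lemma newton_sequence_exists:
  "\<exists>p. p 0 = (\<lambda>_. 0) \<and> (\<forall>n. p (Suc n) 0 = 0 \<and> C1_on T (p (Suc n)) (rhs (p n) (p (Suc n))))"
proof -
  have "\<exists>p. \<forall>n. ((n = 0 \<longrightarrow> p n = (\<lambda>_. 0)) \<and> continuous_on {0..T} (p n)) \<and>
      (p (Suc n) 0 = 0 \<and> C1_on T (p (Suc n)) (rhs (p n) (p (Suc n))))"
  proof (rule dependent_nat_choice)
    show "\<exists>x. (0 = (0::nat) \<longrightarrow> x = (\<lambda>_. 0)) \<and> continuous_on {0..T} (x :: real \<Rightarrow> real)"
      by (intro exI[of _ "\<lambda>_. 0"]) auto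
    fix p :: "real \<Rightarrow> real" and n :: nat
    assume "(n = 0 \<longrightarrow> p = (\<lambda>_. 0)) \<and> continuous_on {0..T} p"
    then have c: "continuous_on {0..T} p" by simp
    have "\<exists>y. y 0 = 0 \<and> C1_on T y (\<lambda>t. (\<eta> - \<kappa> / 2 * (p t)\<^sup>2) - (a - \<kappa> * p t) * y t)"
      by (rule linear_ode_exists[OF T]) (intro continuous_intros c)+
    then show "\<exists>y. ((Suc n = 0 \<longrightarrow> y = (\<lambda>_. 0)) \<and> continuous_on {0..T} y) \<and> (y 0 = 0 \<and> C1_on T y (rhs p y))"
      using C1_onD(3) by (auto simp: rhs_def[abs_def])
  qed
  then show ?thesis by blast
qed

text \<open>The Newton iterates with \<open>p\<^sub>0 = 0\<close>.\<close>

definition newton :: "nat \<Rightarrow> real \<Rightarrow> real" where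
  "newton = (SOME p. p 0 = (\<lambda>_. 0) \<and> (\<forall>n. p (Suc n) 0 = 0 \<and> C1_on T (p (Suc n)) (rhs (p n) (p (Suc n)))))"

lemma newton_0: "newton 0 = (\<lambda>_. 0)"
  and newton_Suc_0: "newton (Suc n) 0 = 0"
  and newton_Suc: "C1_on T (newton (Suc n)) (rhs (newton n) (newton (Suc n)))"
  using someI_ex[OF newton_sequence_exists] unfolding newton_def[symmetric] by blast+

lemma newton_initial: "newton n 0 = 0"
  by (cases n) (simp_all add: newton_0 newton_Suc_0)

text \<open>The derivatives of the iterates.\<close>

definition newton' :: "nat \<Rightarrow> real \<Rightarrow> real" where
  "newton' n = (case n of 0 \<Rightarrow> (\<lambda>_. 0) | Suc m \<Rightarrow> rhs (newton m) (newton n))"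

lemma C1_newton: "C1_on T (newton n) (newton' n)"
  by (cases n) (simp_all add: newton_0 newton'_def C1_on_zero newton_Suc)

lemma newton_continuous: "continuous_on {0..T} (newton n)"
  using C1_onD(3)[OF C1_newton] .

text \<open>The error of the \<open>n\<close>-th iterate and its derivative.\<close>

definition err :: "nat \<Rightarrow> real \<Rightarrow> real" where "err n t = q t - newton n t"
definition err' :: "nat \<Rightarrow> real \<Rightarrow> real" where "err' n t = q' t - newton' n t"

lemma C1_err: "C1_on T (err n) (err' n)"
  using C1_on_diff[OF C1_q C1_newton] by (simp add: err_def[abs_def] err'_def[abs_def])

lemma err_initial: "err n 0 = 0"
  by (simp add: err_def q_0 newton_initial)

text \<open>The source term is quadratic in the previous error, as always for Newton steps.\<close>

lemma err_equation: "err' (Suc n) t + (a - \<kappa> * newton n t) * err (Suc n) t = \<kappa> / 2 * (err n t)\<^sup>2"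
  by (simp add: err'_def newton'_def rhs_def err_def q'_def algebra_simps power2_eq_square add_divide_distrib)

lemma coeff_continuous: "continuous_on {0..T} (\<lambda>t. a - \<kappa> * newton n t)"
  by (intro continuous_intros newton_continuous)

text \<open>
  Comparison twice: the source term \<open>\<eta> - (\<kappa>/2) p\<^sup>2\<close> is nonnegative for \<open>0 \<le> p \<le> P\<close>, and so is the source term of the
  error equation.
\<close>

lemma newton_bounds: "t \<in> {0..T} \<Longrightarrow> 0 \<le> newton n t \<and> newton n t \<le> q t"
proof (induction n arbitrary: t)
  case 0
  then show ?case using q_bounds by (simp add: newton_0)
next
  case (Suc n)
  have "0 \<le> newton (Suc n) t"
  proof (rule linear_ode_nonneg[OF newton_Suc newton_Suc_0 coeff_continuous _ Suc.prems])
    fix s assume s: "s \<in> {0..T}"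
    have "0 \<le> newton n s" "newton n s \<le> P" using Suc.IH[OF s] q_bounds[of s] s by auto
    then have "(newton n s)\<^sup>2 \<le> P\<^sup>2" by (intro power_mono)
    then have "\<kappa> / 2 * (newton n s)\<^sup>2 \<le> \<kappa> / 2 * P\<^sup>2" using \<kappa> by simp
    also have "\<dots> = a * P - \<eta>" using P_root by simp
    also have "\<dots> \<le> \<eta>"
    proof -
      have "2 * (a * P - \<eta>) = (\<kappa> * P) * P"
        using P_root by (simp add: power2_eq_square)
      also have "\<dots> \<le> a * P" unfolding \<kappa>P using \<delta> P_pos by simp
      finally have "2 * (a * P - \<eta>) \<le> a * P" .
      then show ?thesis by argo
    qed
    finally show "0 \<le> rhs (newton n) (newton (Suc n)) s + (a - \<kappa> * newton n s) * newton (Suc n) s"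
      by (simp add: rhs_def)
  qed
  moreover have "0 \<le> err (Suc n) t"
    by (rule linear_ode_nonneg[OF C1_err err_initial coeff_continuous[of n] _ Suc.prems]) (use \<kappa> in \<open>simp add: err_equation\<close>)
  ultimately show ?case by (simp add: err_def)
qed

lemma err_bounds: "t \<in> {0..T} \<Longrightarrow> 0 \<le> err n t \<and> err n t \<le> P"
  using newton_bounds[of t n] q_bounds[of t] by (auto simp: err_def)

lemma coeff_bounds: "t \<in> {0..T} \<Longrightarrow> \<delta> \<le> a - \<kappa> * newton n t \<and> a - \<kappa> * newton n t \<le> a"
proof -
  assume t: "t \<in> {0..T}"
  have "newton n t \<le> P" "0 \<le> newton n t" using newton_bounds[OF t, of n] q_bounds[of t] t by auto
  then have "\<kappa> * newton n t \<le> \<kappa> * P" "0 \<le> \<kappa> * newton n t" using \<kappa> by auto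
  then show ?thesis unfolding \<kappa>P by simp
qed

text \<open>
  The error equation gives \<open>e\<^sub>n\<^sub>+\<^sub>1' \<le> (\<kappa>/2) e\<^sub>n\<^sup>2 \<le> (\<kappa> P/2) e\<^sub>n\<close>, which is iterated. This bound is not quadratic, but
  it yields convergence for every \<open>T\<close>.
\<close>

lemma err_pointwise: "t \<in> {0..T} \<Longrightarrow> err n t \<le> P * ((\<kappa> * P / 2 * t) ^ n / fact n)"
proof (induction n arbitrary: t)
  case 0
  then show ?case using err_bounds[of t 0] by simp
next
  case (Suc n)
  let ?c = "\<kappa> * P / 2"
  let ?y = "\<lambda>t. P * ((?c * t) ^ Suc n / fact (Suc n)) - err (Suc n) t"
  let ?y' = "\<lambda>t. P * ?c * ((?c * t) ^ n / fact n) - err' (Suc n) t"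
  have d: "((\<lambda>t. P * ((?c * t) ^ Suc n / fact (Suc n))) has_real_derivative P * ?c * ((?c * s) ^ n / fact n)) (at s within {0..T})" for s
  proof -
    have "((\<lambda>t. ?c * t) has_real_derivative ?c) (at s within {0..T})"
      by (auto intro!: derivative_eq_intros)
    from DERIV_cmult[OF DERIV_cdivide[OF DERIV_power_Suc[OF this, of n], of "fact (Suc n)"], of P]
    have "((\<lambda>t. P * ((?c * t) ^ Suc n / fact (Suc n))) has_real_derivative
        P * ((1 + real n) * (?c * (?c * s) ^ n) / fact (Suc n))) (at s within {0..T})" .
    moreover have "P * ((1 + real n) * (?c * (?c * s) ^ n) / fact (Suc n)) = P * ?c * ((?c * s) ^ n / fact n)"
    proof -
      have f: "(fact (Suc n) :: real) = (1 + real n) * fact n" by simp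
      have "1 + real n \<noteq> 0" by linarith
      then have "(1 + real n) * (?c * (?c * s) ^ n) / fact (Suc n) = (?c * (?c * s) ^ n) / fact n"
        unfolding f by (rule mult_divide_mult_cancel_left)
      then have "P * ((1 + real n) * (?c * (?c * s) ^ n) / fact (Suc n)) = P * (?c * (?c * s) ^ n / fact n)"
        by (simp only:)
      also have "\<dots> = P * ?c * ((?c * s) ^ n / fact n)" by simp
      finally show ?thesis .
    qed
    ultimately show ?thesis by (simp only:)
  qed
  have "C1_on T (\<lambda>t. P * ((?c * t) ^ Suc n / fact (Suc n))) (\<lambda>t. P * ?c * ((?c * t) ^ n / fact n))"
    unfolding C1_on_def by (intro conjI ballI d continuous_intros) simp
  from C1_on_diff[OF this C1_err] have "0 \<le> ?y t"
  proof (rule linear_ode_nonneg[where A = "\<lambda>_. 0"])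
    fix s assume s: "s \<in> {0..T}"
    have b: "0 \<le> err n s" "err n s \<le> P" using err_bounds[OF s] by auto
    have "\<kappa> / 2 * (err n s)\<^sup>2 = \<kappa> / 2 * err n s * err n s" by (simp add: power2_eq_square)
    also have "\<dots> \<le> \<kappa> / 2 * P * (P * ((?c * s) ^ n / fact n))"
      using b Suc.IH[OF s] \<kappa> P_pos by (intro mult_mono) auto
    also have "\<dots> = P * ?c * ((?c * s) ^ n / fact n)" by simp
    finally have "err' (Suc n) s + (a - \<kappa> * newton n s) * err (Suc n) s \<le> P * ?c * ((?c * s) ^ n / fact n)"
      by (simp add: err_equation)
    moreover have "0 \<le> (a - \<kappa> * newton n s) * err (Suc n) s"
      using coeff_bounds[OF s, of n] \<delta> err_bounds[OF s, of "Suc n"] by (intro mult_nonneg_nonneg) auto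
    ultimately show "0 \<le> ?y' s + 0 * ?y s" by simp
  qed (use Suc.prems in \<open>auto simp: err_initial\<close>)
  then show ?case by simp
qed

text \<open>The norm of \<open>L\<^sup>2(0,T)\<close>.\<close>

abbreviation N :: "(real \<Rightarrow> real) \<Rightarrow> real" where "N \<equiv> L2_norm {0<..<T}"

lemma err_L2_step:
  "N (err (Suc n)) \<le> (\<kappa> / 2 * N (\<lambda>t. (err n t)\<^sup>2)) / \<delta>"
  "N (err' (Suc n)) \<le> \<kappa> / 2 * N (\<lambda>t. (err n t)\<^sup>2) + a * ((\<kappa> / 2 * N (\<lambda>t. (err n t)\<^sup>2)) / \<delta>)"
proof -
  have F: "N (\<lambda>t. err' (Suc n) t + (a - \<kappa> * newton n t) * err (Suc n) t) = \<kappa> / 2 * N (\<lambda>t. (err n t)\<^sup>2)"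
    unfolding err_equation using \<kappa> L2_norm_cmult[of "{0<..<T}" "\<kappa> / 2" "\<lambda>t. (err n t)\<^sup>2"] by simp
  have b: "\<delta> \<le> a - \<kappa> * newton n t" "a - \<kappa> * newton n t \<le> a" if "t \<in> {0<..<T}" for t
    using coeff_bounds[of t n] that by auto
  show "N (err (Suc n)) \<le> (\<kappa> / 2 * N (\<lambda>t. (err n t)\<^sup>2)) / \<delta>"
    unfolding F[symmetric]
    by (rule linear_ode_L2(1)[OF T C1_err err_initial coeff_continuous \<delta>, where a = a]) (rule b, assumption)+
  show "N (err' (Suc n)) \<le> \<kappa> / 2 * N (\<lambda>t. (err n t)\<^sup>2) + a * ((\<kappa> / 2 * N (\<lambda>t. (err n t)\<^sup>2)) / \<delta>)"
    unfolding F[symmetric]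
    by (rule linear_ode_L2(2)[OF T C1_err err_initial coeff_continuous \<delta>]) (rule b, assumption)+
qed

lemma err_square_L2: "N (\<lambda>t. (err n t)\<^sup>2) \<le> T powr (3 / 2) * (N (err' n))\<^sup>2"
proof -
  note c = C1_onD(3)[OF C1_err, of n]
  have "N (\<lambda>t. (err n t)\<^sup>2) \<le> N (\<lambda>t. T * (N (err' n))\<^sup>2)"
  proof (rule L2_norm_mono)
    fix t assume "t \<in> {0<..<T}"
    then have "\<bar>err n t\<bar> \<le> sqrt T * N (err' n)"
      by (intro Sobolev_left[OF C1_err err_initial]) auto
    then have "\<bar>err n t\<bar>\<^sup>2 \<le> (sqrt T * N (err' n))\<^sup>2" by (intro power_mono) auto
    then show "\<bar>(err n t)\<^sup>2\<bar> \<le> \<bar>T * (N (err' n))\<^sup>2\<bar>" using T by (simp add: power_mult_distrib)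
  qed (intro continuous_intros c)+
  also have "\<dots> = sqrt T * T * (N (err' n))\<^sup>2" using T by (simp add: L2_norm_const abs_mult)
  also have "sqrt T * T = T powr (3 / 2)"
  proof -
    have "T powr (3 / 2) = T powr (1 / 2) * T powr 1" unfolding powr_add[symmetric] by simp
    then show ?thesis using T by (simp add: powr_half_sqrt)
  qed
  finally show ?thesis .
qed

lemma err_tendsto_0:
  "(\<lambda>n. N (err n)) \<longlonglongrightarrow> 0" "(\<lambda>n. N (err' n)) \<longlonglongrightarrow> 0"
proof -
  let ?b = "\<lambda>n. P * ((\<kappa> * P / 2 * T) ^ n / fact n)"
  have pf: "(\<lambda>n. x ^ n / fact n) \<longlonglongrightarrow> 0" for x :: real
  proof -
    have "inverse (fact n) * x ^ n = x ^ n / fact n" for n by (simp add: field_simps)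
    then show ?thesis using summable_LIMSEQ_zero[OF summable_exp[of x]] by simp
  qed
  have b: "(\<lambda>n. sqrt T * \<bar>?b n\<bar>) \<longlonglongrightarrow> 0"
    by (intro tendsto_mult_right_zero tendsto_rabs_zero pf)
  have le: "N (err n) \<le> sqrt T * \<bar>?b n\<bar>" for n
    unfolding L2_norm_const[OF T, symmetric]
  proof (rule L2_norm_mono)
    fix t assume t: "t \<in> {0<..<T}"
    have "err n t \<le> P * ((\<kappa> * P / 2 * t) ^ n / fact n)" using t by (intro err_pointwise) auto
    also have "\<dots> \<le> ?b n"
      using t \<kappa> P_pos by (intro mult_left_mono divide_right_mono power_mono) auto
    also have "\<dots> \<le> \<bar>?b n\<bar>" by (rule abs_ge_self)
    finally have "err n t \<le> \<bar>?b n\<bar>" .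
    moreover have "\<bar>err n t\<bar> = err n t" using err_bounds[of t n] t by simp
    ultimately show "\<bar>err n t\<bar> \<le> \<bar>?b n\<bar>" by (simp only:)
  qed (auto intro!: C1_onD(3)[OF C1_err])
  show 1: "(\<lambda>n. N (err n)) \<longlonglongrightarrow> 0"
    by (rule tendsto_sandwich[OF _ _ tendsto_const b]) (use le in \<open>auto simp: L2_norm_nonneg\<close>)
  have sq: "N (\<lambda>t. (err n t)\<^sup>2) \<le> P * N (err n)" for n
  proof -
    have c: "continuous_on {0..T} (err n)" by (rule C1_onD(3)[OF C1_err])
    have "N (\<lambda>t. (err n t)\<^sup>2) \<le> N (\<lambda>t. P * err n t)"
    proof (rule L2_norm_mono)
      fix t assume "t \<in> {0<..<T}"
      then have "0 \<le> err n t" "err n t \<le> P" using err_bounds[of t n] by auto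
      then show "\<bar>(err n t)\<^sup>2\<bar> \<le> \<bar>P * err n t\<bar>" by (simp add: power2_eq_square abs_mult mult_right_mono)
    qed (intro continuous_intros c)+
    also have "\<dots> = P * N (err n)" using P_pos by (simp add: L2_norm_cmult)
    finally show ?thesis .
  qed
  let ?k = "\<kappa> / 2 * P * (1 + a / \<delta>)"
  have le': "N (err' (Suc n)) \<le> ?k * N (err n)" for n
  proof -
    have "N (err' (Suc n)) \<le> (\<kappa> / 2 * (1 + a / \<delta>)) * N (\<lambda>t. (err n t)\<^sup>2)"
      using err_L2_step(2)[of n] by (simp add: algebra_simps)
    also have "\<dots> \<le> (\<kappa> / 2 * (1 + a / \<delta>)) * (P * N (err n))"
      using sq \<kappa> a \<delta> by (intro mult_left_mono) auto
    finally show ?thesis by (simp add: mult_ac)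
  qed
  have "(\<lambda>n. N (err' (Suc n))) \<longlonglongrightarrow> 0"
    by (rule tendsto_sandwich[OF _ _ tendsto_const tendsto_mult_right_zero[OF 1, of ?k]])
      (use le' in \<open>auto simp: L2_norm_nonneg\<close>)
  then show "(\<lambda>n. N (err' n)) \<longlonglongrightarrow> 0" by (rule LIMSEQ_imp_Suc)
qed

text \<open>The norm of \<open>e\<^sub>n(\<tau>) sin x\<close> in \<open>X\<^sub>2\<close>, see \<open>X2_norm_sep_sin\<close>.\<close>

definition X :: "nat \<Rightarrow> real" where "X n = sqrt (pi / 2) * (3 * N (err n) + N (err' n))"

lemma X_tendsto_0: "X \<longlonglongrightarrow> 0"
proof -
  have "(\<lambda>n. sqrt (pi / 2) * (3 * N (err n) + N (err' n))) \<longlonglongrightarrow> sqrt (pi / 2) * (3 * 0 + 0)"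
    by (intro tendsto_intros err_tendsto_0)
  then show ?thesis by (simp add: X_def[abs_def])
qed

lemma X_quadratic: "X (Suc n) \<le> \<kappa> * T powr (3 / 2) / sqrt (2 * pi) * ((a + 3) / \<delta> + 1) * (X n)\<^sup>2"
proof -
  define K where "K = (a + 3) / \<delta> + 1"
  have K: "0 \<le> K" using a \<delta> by (simp add: K_def)
  define F where "F = \<kappa> / 2 * N (\<lambda>t. (err n t)\<^sup>2)"
  have "3 * N (err (Suc n)) + N (err' (Suc n)) \<le> 3 * (F / \<delta>) + (F + a * (F / \<delta>))"
    using err_L2_step[of n] unfolding F_def by linarith
  also have "\<dots> = K * F" by (simp add: K_def algebra_simps add_divide_distrib)
  finally have "X (Suc n) \<le> sqrt (pi / 2) * (K * F)" unfolding X_def by (intro mult_left_mono) auto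
  also have "\<dots> \<le> sqrt (pi / 2) * (K * (\<kappa> / 2 * (T powr (3 / 2) * (2 / pi * (X n)\<^sup>2))))"
  proof -
    have "(N (err' n))\<^sup>2 \<le> (3 * N (err n) + N (err' n))\<^sup>2"
      by (intro power_mono) (simp_all add: L2_norm_nonneg)
    also have "\<dots> = 2 / pi * (X n)\<^sup>2" by (simp add: X_def power_mult_distrib)
    finally have "T powr (3 / 2) * (N (err' n))\<^sup>2 \<le> T powr (3 / 2) * (2 / pi * (X n)\<^sup>2)"
      by (intro mult_left_mono) auto
    then have "N (\<lambda>t. (err n t)\<^sup>2) \<le> T powr (3 / 2) * (2 / pi * (X n)\<^sup>2)"
      using err_square_L2[of n] by linarith
    then show ?thesis unfolding F_def using \<kappa> K by (intro mult_left_mono) auto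
  qed
  also have "\<dots> = \<kappa> * T powr (3 / 2) * (sqrt (pi / 2) / pi) * K * (X n)\<^sup>2" by simp
  also have "sqrt (pi / 2) / pi = 1 / sqrt (2 * pi)"
  proof -
    have "sqrt (pi / 2) * sqrt (2 * pi) = sqrt (pi\<^sup>2)"
      unfolding real_sqrt_mult[symmetric] by (simp add: power2_eq_square)
    then have "sqrt (pi / 2) * sqrt (2 * pi) = pi" by simp
    then show ?thesis by (simp add: frac_eq_eq)
  qed
  finally show ?thesis by (simp add: K_def)
qed

end

section \<open>The Hamiltonian\<close>

lemma hamiltonian_complete_square:
  assumes "r \<noteq> 0"
  shows "hamiltonian a \<nu> r \<eta> (- y * sin x) x \<alpha>
      = (\<eta> - a * y + (\<nu>\<^sup>2 / r) / 2 * y\<^sup>2) * sin x - r / 2 * sin x * (\<alpha> + \<nu> * y / r)\<^sup>2"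
  using assms by (simp add: hamiltonian_def field_simps power2_eq_square)

text \<open>The maximizer is unique, which makes all sequences produced by Howard iteration agree almost everywhere.\<close>

lemma hamiltonian_argmax_iff:
  assumes r: "0 < r" and s: "0 < sin x" and y: "\<bar>\<nu> * y / r\<bar> \<le> M"
  shows "is_arg_max (hamiltonian a \<nu> r \<eta> (- y * sin x) x) (\<lambda>\<beta>. \<bar>\<beta>\<bar> \<le> M) \<alpha> \<longleftrightarrow> \<alpha> = - (\<nu> * y / r)"
proof -
  let ?H = "hamiltonian a \<nu> r \<eta> (- y * sin x) x" and ?o = "- (\<nu> * y / r)"
  have r0: "r \<noteq> 0" using r by simp
  have rs: "0 < r / 2 * sin x" using r s by simp
  have H: "?H \<beta> = ?H ?o - r / 2 * sin x * (\<beta> + \<nu> * y / r)\<^sup>2" for \<beta>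
    unfolding hamiltonian_complete_square[OF r0] by simp
  have le: "?H \<beta> \<le> ?H ?o" for \<beta>
    using H[of \<beta>] rs by simp
  have eq: "\<beta> = ?o" if "?H ?o \<le> ?H \<beta>" for \<beta>
  proof -
    have "r / 2 * sin x * (\<beta> + \<nu> * y / r)\<^sup>2 \<le> 0" using that H[of \<beta>] by linarith
    then have "\<not> 0 < (\<beta> + \<nu> * y / r)\<^sup>2" using mult_pos_pos[OF rs] by (meson not_less)
    then have "\<beta> + \<nu> * y / r = 0" by simp
    then show ?thesis by linarith
  qed
  have o: "\<bar>?o\<bar> \<le> M" using y by (simp only: abs_minus_cancel)
  show ?thesis
  proof
    assume "is_arg_max ?H (\<lambda>\<beta>. \<bar>\<beta>\<bar> \<le> M) \<alpha>"
    then have "\<not> ?H \<alpha> < ?H ?o" using o unfolding is_arg_max_def by blast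
    then show "\<alpha> = ?o" by (intro eq) simp
  next
    assume "\<alpha> = ?o"
    then show "is_arg_max ?H (\<lambda>\<beta>. \<bar>\<beta>\<bar> \<le> M) \<alpha>"
      using o le unfolding is_arg_max_def by (simp only: not_less[symmetric]) (metis not_less)
  qed
qed

lemma hamiltonian_Sup_eq:
  assumes r: "0 < r" and s: "0 < sin x" and y: "\<bar>\<nu> * y / r\<bar> \<le> M"
  shows "(SUP \<beta>\<in>{-M..M}. hamiltonian a \<nu> r \<eta> (- y * sin x) x \<beta>) = (\<eta> - a * y + (\<nu>\<^sup>2 / r) / 2 * y\<^sup>2) * sin x"
proof (rule cSup_eq_maximum)
  have r0: "r \<noteq> 0" using r by simp
  have "hamiltonian a \<nu> r \<eta> (- y * sin x) x (- (\<nu> * y / r)) = (\<eta> - a * y + (\<nu>\<^sup>2 / r) / 2 * y\<^sup>2) * sin x"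
    unfolding hamiltonian_complete_square[OF r0] by simp
  moreover have "- (\<nu> * y / r) \<in> {-M..M}" using y unfolding abs_le_iff atLeastAtMost_iff by linarith
  ultimately show "(\<eta> - a * y + (\<nu>\<^sup>2 / r) / 2 * y\<^sup>2) * sin x \<in> hamiltonian a \<nu> r \<eta> (- y * sin x) x ` {-M..M}"
    by (metis imageI)
  fix h assume "h \<in> hamiltonian a \<nu> r \<eta> (- y * sin x) x ` {-M..M}"
  then obtain \<beta> where "h = hamiltonian a \<nu> r \<eta> (- y * sin x) x \<beta>" by blast
  then show "h \<le> (\<eta> - a * y + (\<nu>\<^sup>2 / r) / 2 * y\<^sup>2) * sin x"
    unfolding hamiltonian_complete_square[OF r0] using r s by simp
qed

text \<open>
  As a maximum of affine functions of \<open>p\<close> with slopes in \<open>[0,L]\<close>, \<open>L = a + \<bar>\<nu>\<bar> M\<close>, the right-hand side of the equation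
  is nondecreasing and Lipschitz in \<open>p\<close>. The inequality combines both properties.
\<close>

lemma hamiltonian_Sup_monotone:
  fixes a \<nu> r \<eta> M x p1 p2 :: real
  assumes M: "0 \<le> M" and a: "\<bar>\<nu>\<bar> * M < a"
  defines "S \<equiv> \<lambda>p. SUP \<beta>\<in>{-M..M}. hamiltonian a \<nu> r \<eta> p x \<beta>"
  shows "(S p1 - S p2)\<^sup>2 \<le> (a + \<bar>\<nu>\<bar> * M) * ((S p1 - S p2) * (p1 - p2))"
proof -
  let ?L = "a + \<bar>\<nu>\<bar> * M"
  have step: "0 \<le> S p1 - S p2 \<and> S p1 - S p2 \<le> ?L * (p1 - p2)" if "p2 \<le> p1" for p1 p2
  proof -
    obtain \<alpha>1 where 1: "\<alpha>1 \<in> {-M..M}" "hamiltonian a \<nu> r \<eta> p1 x \<alpha>1 = S p1"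
      "\<forall>\<beta>\<in>{-M..M}. hamiltonian a \<nu> r \<eta> p1 x \<beta> \<le> hamiltonian a \<nu> r \<eta> p1 x \<alpha>1"
      using hamiltonian_Sup_attained[OF M, of a \<nu> r \<eta> p1 x] unfolding S_def by blast
    obtain \<alpha>2 where 2: "\<alpha>2 \<in> {-M..M}" "hamiltonian a \<nu> r \<eta> p2 x \<alpha>2 = S p2"
      "\<forall>\<beta>\<in>{-M..M}. hamiltonian a \<nu> r \<eta> p2 x \<beta> \<le> hamiltonian a \<nu> r \<eta> p2 x \<alpha>2"
      using hamiltonian_Sup_attained[OF M, of a \<nu> r \<eta> p2 x] unfolding S_def by blast
    have d: "hamiltonian a \<nu> r \<eta> p1 x \<beta> - hamiltonian a \<nu> r \<eta> p2 x \<beta> = (a + \<nu> * \<beta>) * (p1 - p2)" for \<beta>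
      by (simp add: hamiltonian_def algebra_simps)
    have sl: "0 \<le> a + \<nu> * \<beta>" "a + \<nu> * \<beta> \<le> ?L" if "\<beta> \<in> {-M..M}" for \<beta>
    proof -
      have "\<bar>\<nu> * \<beta>\<bar> \<le> \<bar>\<nu>\<bar> * M" unfolding abs_mult using that by (intro mult_left_mono) auto
      then show "0 \<le> a + \<nu> * \<beta>" "a + \<nu> * \<beta> \<le> ?L" using a by linarith+
    qed
    have "0 \<le> (a + \<nu> * \<alpha>2) * (p1 - p2)" using sl(1)[OF 2(1)] that by simp
    moreover have "(a + \<nu> * \<alpha>1) * (p1 - p2) \<le> ?L * (p1 - p2)" using sl(2)[OF 1(1)] that by (intro mult_right_mono) auto
    moreover have "hamiltonian a \<nu> r \<eta> p1 x \<alpha>2 \<le> S p1" "hamiltonian a \<nu> r \<eta> p2 x \<alpha>1 \<le> S p2"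
      using 1 2 by auto
    ultimately show ?thesis using d[of \<alpha>1] d[of \<alpha>2] 1(2) 2(2) by linarith
  qed
  have sq: "z\<^sup>2 \<le> l * (z * h)" if "0 \<le> z" "z \<le> l * h" for z l h :: real
    using mult_left_mono[OF that(2,1)] by (simp add: power2_eq_square mult_ac)
  show ?thesis
  proof (cases "p2 \<le> p1")
    case True
    then show ?thesis using step[OF True] by (intro sq) auto
  next
    case False
    then have "(S p2 - S p1)\<^sup>2 \<le> ?L * ((S p2 - S p1) * (p2 - p1))" using step[of p1 p2] by (intro sq) auto
    moreover have "(S p2 - S p1) * (p2 - p1) = (S p1 - S p2) * (p1 - p2)" by (simp add: algebra_simps)
    ultimately show ?thesis by (simp only: power2_commute[of "S p2"])
  qed
qed

section \<open>Howard iteration\<close>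

lemma X2_0_eqI:
  assumes T: "0 < T" and u: "u \<in> X2_0 T" and v: "v \<in> X2_0 T" and L: "0 \<le> L"
    and le: "AE z in lebesgue_on (Q T). (Dtau T v z - Dtau T u z)\<^sup>2 \<le> L * ((Dtau T v z - Dtau T u z) * (Dxx T v z - Dxx T u z))"
  shows "AE z in lebesgue_on (Q T). v z = u z"
proof -
  have X: "u \<in> X2 T" "v \<in> X2 T" and zi: "zero_initial T u" "zero_initial T v"
    and W: "AE \<tau> in lebesgue_on {0<..<T}. (\<lambda>x. u (\<tau>, x)) \<in> W12_0 0 pi"
      "AE \<tau> in lebesgue_on {0<..<T}. (\<lambda>x. v (\<tau>, x)) \<in> W12_0 0 pi"
    using u v by (auto simp: X2_0_def)
  note du = X2D[OF X(1)] and dv = X2D[OF X(2)]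
  have "AE \<tau> in lebesgue_on {0<..<T}. (\<lambda>x. v (\<tau>, x) - u (\<tau>, x)) \<in> W12_0 0 pi"
    using W(2,1) by eventually_elim (rule W12_0_diff, auto)
  from parabolic_zero[OF T sq_int_diff[OF dv(1) du(1)] is_Dtau_diff[OF T dv(1) du(1) dv(2) du(2)]
      is_Dx_diff[OF dv(3) du(3)] is_Dx_diff[OF dv(4) du(4)] this zero_initial_diff[OF zi(2,1)] L le]
  show ?thesis by eventually_elim simp
qed

lemma AE_Q_positive: "AE z in lebesgue_on (Q T). fst z \<in> {0<..<T} \<and> 0 < sin (snd z)"
  by (rule AE_I2) (auto simp: Q_def sin_gt_zero)

text \<open>
  The parameters of the control problem. By \<open>unconstrained\<close> the constraint \<open>\<bar>\<alpha>\<bar> \<le> M\<close> is not active at the maximizers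
  that occur.
\<close>

locale howard = riccati a \<kappa> \<eta> \<delta> P T for a \<kappa> \<eta> \<delta> P T +
  fixes \<nu> r M :: real
  assumes r: "0 < r" and M: "0 < M" and parabolic: "\<bar>\<nu>\<bar> * M < a" and \<kappa>_eq: "\<kappa> = \<nu>\<^sup>2 / r"
    and unconstrained: "\<bar>\<nu>\<bar> * P / r < M"
begin

lemma control_bound:
  assumes "0 \<le> y" "y \<le> P"
  shows "\<bar>\<nu> * y / r\<bar> \<le> M"
proof -
  have "\<bar>\<nu> * y / r\<bar> = \<bar>\<nu>\<bar> * y / r" using assms r by (simp add: abs_mult)
  also have "\<dots> \<le> \<bar>\<nu>\<bar> * P / r" using assms r by (intro divide_right_mono mult_left_mono) auto
  finally show ?thesis using unconstrained by linarith
qed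

text \<open>The strong solution.\<close>

definition sol :: "real \<times> real \<Rightarrow> real" where "sol = sep q sin"

lemma AE_refl_sep: "AE z in lebesgue_on (Q T). sep e f z = sep e f z" by simp

lemma sol_strong_solution: "strong_solution a \<nu> r \<eta> M T sol"
proof -
  note d = sep_sin_derivs[OF T C1_q AE_refl_sep]
  have "AE z in lebesgue_on (Q T). Dtau T sol z = (SUP \<alpha>\<in>{-M..M}. hamiltonian a \<nu> r \<eta> (Dxx T sol z) (snd z) \<alpha>)"
    using d(2,3) AE_Q_positive unfolding sol_def
  proof eventually_elim
    case (elim z)
    have b: "\<bar>\<nu> * q (fst z) / r\<bar> \<le> M" using elim(3) q_bounds by (intro control_bound) auto
    have "Dxx T (sep q sin) z = - q (fst z) * sin (snd z)" unfolding elim(1) by (simp add: sep_def)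
    then have s: "(SUP \<alpha>\<in>{-M..M}. hamiltonian a \<nu> r \<eta> (Dxx T (sep q sin) z) (snd z) \<alpha>) = q' (fst z) * sin (snd z)"
      using hamiltonian_Sup_eq[OF r _ b, of "snd z" a \<eta>] elim(3) by (simp only: q'_def flip: \<kappa>_eq)
    have "Dtau T (sep q sin) z = q' (fst z) * sin (snd z)" unfolding elim(2) by (simp add: sep_def)
    then show ?case by (simp only: s)
  qed
  then show ?thesis
    using sep_sin_X2_0[OF T C1_q q_0] by (simp add: strong_solution_def sol_def)
qed

lemma strong_solution_unique:
  assumes u: "strong_solution a \<nu> r \<eta> M T u" and v: "strong_solution a \<nu> r \<eta> M T v"
  shows "AE z in lebesgue_on (Q T). v z = u z"
proof (rule X2_0_eqI[OF T])
  show "u \<in> X2_0 T" "v \<in> X2_0 T" using u v by (simp_all add: strong_solution_def)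
  show "0 \<le> a + \<bar>\<nu>\<bar> * M" using a M by simp
  have "AE z in lebesgue_on (Q T). Dtau T u z = (SUP \<alpha>\<in>{-M..M}. hamiltonian a \<nu> r \<eta> (Dxx T u z) (snd z) \<alpha>)"
    "AE z in lebesgue_on (Q T). Dtau T v z = (SUP \<alpha>\<in>{-M..M}. hamiltonian a \<nu> r \<eta> (Dxx T v z) (snd z) \<alpha>)"
    using u v by (simp_all add: strong_solution_def)
  then show "AE z in lebesgue_on (Q T). (Dtau T v z - Dtau T u z)\<^sup>2
      \<le> (a + \<bar>\<nu>\<bar> * M) * ((Dtau T v z - Dtau T u z) * (Dxx T v z - Dxx T u z))"
  proof eventually_elim
    case (elim z)
    show ?case unfolding elim using M parabolic by (intro hamiltonian_Sup_monotone) auto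
  qed
qed

text \<open>The maximizer that belongs to the \<open>n\<close>-th iterate.\<close>

definition control :: "nat \<Rightarrow> real \<times> real \<Rightarrow> real" where
  "control n z = - (\<nu> * newton n (fst z) / r)"

lemma newton_le_P: "t \<in> {0..T} \<Longrightarrow> newton n t \<le> P"
  using newton_bounds[of t n] q_bounds(2)[of t] by auto

lemma \<kappa>_mult: "\<kappa> * y = \<nu> * (\<nu> * y / r)"
  by (subst \<kappa>_eq) (simp add: power2_eq_square)

lemma control_cost: "r / 2 * (- (\<nu> * y / r))\<^sup>2 = \<kappa> / 2 * y\<^sup>2"
  by (subst \<kappa>_eq) (use r in \<open>simp add: power2_eq_square mult_ac\<close>)

lemma control_drift: "a + \<nu> * control n z = a - \<kappa> * newton n (fst z)"
  unfolding control_def \<kappa>_mult by simp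

lemma maximizer_iff:
  assumes u: "AE z in lebesgue_on (Q T). u z = sep (newton n) sin z"
  shows "measurable_maximizer a \<nu> r \<eta> M T u \<alpha> \<longleftrightarrow>
    \<alpha> \<in> borel_measurable (lebesgue_on (Q T)) \<and> (AE z in lebesgue_on (Q T). \<alpha> z = control n z)"
proof -
  have e: "AE z in lebesgue_on (Q T).
      is_arg_max (hamiltonian a \<nu> r \<eta> (Dxx T u z) (snd z)) (\<lambda>\<beta>. \<bar>\<beta>\<bar> \<le> M) (\<alpha> z) \<longleftrightarrow> \<alpha> z = control n z"
    using sep_sin_derivs(2)[OF T C1_newton u] AE_Q_positive
  proof eventually_elim
    case (elim z)
    have t: "fst z \<in> {0..T}" using elim(2) by auto
    have b: "\<bar>\<nu> * newton n (fst z) / r\<bar> \<le> M"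
      using newton_bounds[OF t, of n] newton_le_P[OF t] by (intro control_bound) auto
    have "Dxx T u z = - newton n (fst z) * sin (snd z)" using elim(1) by (simp add: sep_def)
    then show ?case using hamiltonian_argmax_iff[OF r _ b] elim(2) by (simp only: control_def)
  qed
  have "(AE z in lebesgue_on (Q T). is_arg_max (hamiltonian a \<nu> r \<eta> (Dxx T u z) (snd z)) (\<lambda>\<beta>. \<bar>\<beta>\<bar> \<le> M) (\<alpha> z)) \<longleftrightarrow>
      (AE z in lebesgue_on (Q T). \<alpha> z = control n z)"
  proof
    assume "AE z in lebesgue_on (Q T). is_arg_max (hamiltonian a \<nu> r \<eta> (Dxx T u z) (snd z)) (\<lambda>\<beta>. \<bar>\<beta>\<bar> \<le> M) (\<alpha> z)"
    with e show "AE z in lebesgue_on (Q T). \<alpha> z = control n z" by eventually_elim blast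
  next
    assume "AE z in lebesgue_on (Q T). \<alpha> z = control n z"
    with e show "AE z in lebesgue_on (Q T). is_arg_max (hamiltonian a \<nu> r \<eta> (Dxx T u z) (snd z)) (\<lambda>\<beta>. \<bar>\<beta>\<bar> \<le> M) (\<alpha> z)"
      by eventually_elim blast
  qed
  then show ?thesis by (simp only: measurable_maximizer_def)
qed

lemma newton_linear_solution:
  assumes \<alpha>: "AE z in lebesgue_on (Q T). \<alpha> z = control n z"
  shows "linear_solution a \<nu> r \<eta> T \<alpha> (sep (newton (Suc n)) sin)"
proof -
  note d = sep_sin_derivs[OF T C1_newton AE_refl_sep, of "Suc n"]
  have "AE z in lebesgue_on (Q T). Dtau T (sep (newton (Suc n)) sin) z
      = hamiltonian a \<nu> r \<eta> (Dxx T (sep (newton (Suc n)) sin) z) (snd z) (\<alpha> z)"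
    using d(2,3) \<alpha>
  proof eventually_elim
    case (elim z)
    let ?p = "newton n (fst z)" and ?y = "newton (Suc n) (fst z)"
    have "r / 2 * (control n z)\<^sup>2 = \<kappa> / 2 * ?p\<^sup>2"
      unfolding control_def by (rule control_cost)
    then have "hamiltonian a \<nu> r \<eta> (- ?y * sin (snd z)) (snd z) (control n z)
        = (a - \<kappa> * ?p) * (- ?y * sin (snd z)) + (\<eta> - \<kappa> / 2 * ?p\<^sup>2) * sin (snd z)"
      unfolding hamiltonian_def control_drift by simp
    also have "\<dots> = rhs (newton n) (newton (Suc n)) (fst z) * sin (snd z)"
      by (simp add: rhs_def algebra_simps)
    finally have H: "hamiltonian a \<nu> r \<eta> (- ?y * sin (snd z)) (snd z) (control n z)
        = rhs (newton n) (newton (Suc n)) (fst z) * sin (snd z)" .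
    have "Dxx T (sep (newton (Suc n)) sin) z = - ?y * sin (snd z)"
      unfolding elim(1) by (simp add: sep_def)
    moreover have "Dtau T (sep (newton (Suc n)) sin) z = rhs (newton n) (newton (Suc n)) (fst z) * sin (snd z)"
      unfolding elim(2) by (simp add: sep_def newton'_def)
    ultimately show ?case by (simp only: elim(3) H)
  qed
  then show ?thesis
    using sep_sin_X2_0[OF T C1_newton newton_initial] by (simp add: linear_solution_def)
qed

lemma linear_solution_unique:
  assumes \<alpha>: "AE z in lebesgue_on (Q T). \<alpha> z = control n z"
    and u: "linear_solution a \<nu> r \<eta> T \<alpha> u" and v: "linear_solution a \<nu> r \<eta> T \<alpha> v"
  shows "AE z in lebesgue_on (Q T). v z = u z"
proof (rule X2_0_eqI[OF T])
  show "u \<in> X2_0 T" "v \<in> X2_0 T" using u v by (simp_all add: linear_solution_def)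
  show "0 \<le> a" using a by simp
  have "AE z in lebesgue_on (Q T). Dtau T u z = hamiltonian a \<nu> r \<eta> (Dxx T u z) (snd z) (\<alpha> z)"
    "AE z in lebesgue_on (Q T). Dtau T v z = hamiltonian a \<nu> r \<eta> (Dxx T v z) (snd z) (\<alpha> z)"
    using u v by (simp_all add: linear_solution_def)
  then show "AE z in lebesgue_on (Q T). (Dtau T v z - Dtau T u z)\<^sup>2
      \<le> a * ((Dtau T v z - Dtau T u z) * (Dxx T v z - Dxx T u z))"
    using \<alpha> AE_Q_positive
  proof eventually_elim
    case (elim z)
    define A where "A = a - \<kappa> * newton n (fst z)"
    define h where "h = Dxx T v z - Dxx T u z"
    have A: "0 \<le> A" "A \<le> a"
      using coeff_bounds[of "fst z" n] elim(4) \<delta> by (auto simp: A_def)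
    have g: "Dtau T v z - Dtau T u z = A * h"
      unfolding elim(1,2) elim(3) hamiltonian_def control_drift A_def h_def by (simp add: algebra_simps)
    have "(A * h)\<^sup>2 = A * (A * h\<^sup>2)" by (simp add: power2_eq_square)
    also have "\<dots> \<le> a * (A * h\<^sup>2)" using A by (intro mult_right_mono) auto
    also have "\<dots> = a * (A * h * h)" by (simp add: power2_eq_square)
    finally show ?case unfolding g h_def .
  qed
qed

lemma control_measurable: "control n \<in> borel_measurable (lebesgue_on (Q T))"
proof -
  have "sep (newton n) (\<lambda>_. - (\<nu> / r)) \<in> borel_measurable (lebesgue_on (Q T))"
    by (intro sq_intD(1) sep_L2(1) newton_continuous) simp
  then show ?thesis by (simp add: sep_def[abs_def] control_def[abs_def] mult.commute)
qed

lemma newton_howard_iteration: "howard_iteration a \<nu> r \<eta> M T control (\<lambda>n. sep (newton n) sin)"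
  unfolding howard_iteration_def
  using maximizer_iff[OF AE_refl_sep] control_measurable newton_linear_solution by auto

lemma howard_iteration_eq_newton:
  assumes u0: "u 0 = (\<lambda>_. 0)" and h: "howard_iteration a \<nu> r \<eta> M T \<alpha> u"
  shows "AE z in lebesgue_on (Q T). u n z = sep (newton n) sin z"
    and "AE z in lebesgue_on (Q T). \<alpha> n z = control n z"
proof -
  have mx: "measurable_maximizer a \<nu> r \<eta> M T (u n) (\<alpha> n)" and ln: "linear_solution a \<nu> r \<eta> T (\<alpha> n) (u (Suc n))" for n
    using h by (auto simp: howard_iteration_def)
  show eq: "AE z in lebesgue_on (Q T). u n z = sep (newton n) sin z" for n
  proof (induction n)
    case 0
    show ?case by (simp add: u0 newton_0 sep_def)
  next
    case (Suc n)
    have "AE z in lebesgue_on (Q T). \<alpha> n z = control n z"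
      using maximizer_iff[OF Suc.IH] mx by blast
    then show ?case
      using linear_solution_unique newton_linear_solution ln by blast
  qed
  show "AE z in lebesgue_on (Q T). \<alpha> n z = control n z"
    using maximizer_iff[OF eq] mx by blast
qed

lemma X2_norm_error:
  assumes "AE z in lebesgue_on (Q T). v z = sep (newton n) sin z"
  shows "X2_norm T (\<lambda>z. sol z - v z) = X n"
  unfolding X_def
proof (rule X2_norm_sep_sin[OF T C1_err])
  show "AE z in lebesgue_on (Q T). sol z - v z = sep (err n) sin z"
    using assms by eventually_elim (simp add: sol_def sep_def err_def left_diff_distrib)
qed

end

theorem proposition6p2:
  fixes a\<^sub>0 r\<^sub>0 M \<eta> \<nu> \<kappa> \<delta> P T C\<^sub>T :: real
  assumes "a\<^sub>0 > 0" and "r\<^sub>0 > 0" and "M > 0" and "\<eta> > 0" and "\<nu> \<noteq> 0"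
    and "a\<^sub>0 > \<bar>\<nu>\<bar> * M"
    and "\<kappa> = \<nu>\<^sup>2 / r\<^sub>0"
    and "\<delta> = sqrt (a\<^sub>0\<^sup>2 - 2 * \<kappa> * \<eta>)"
    and "P = (a\<^sub>0 - \<delta>) / \<kappa>"
    and "a\<^sub>0\<^sup>2 > 2 * \<kappa> * \<eta>"
    and "\<bar>\<nu>\<bar> * P / r\<^sub>0 < M"
    and "T > 0"
    and "C\<^sub>T = \<kappa> * T powr (3/2) / sqrt (2 * pi) * ((a\<^sub>0 + 3) / \<delta> + 1)"
  shows "\<exists>u\<^sub>s. strong_solution a\<^sub>0 \<nu> r\<^sub>0 \<eta> M T u\<^sub>s \<and>
    (\<forall>v. strong_solution a\<^sub>0 \<nu> r\<^sub>0 \<eta> M T v \<longrightarrow> (AE z in lebesgue_on (Q T). v z = u\<^sub>s z)) \<and>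
    (\<exists>\<alpha> u. u 0 = (\<lambda>_. 0) \<and> howard_iteration a\<^sub>0 \<nu> r\<^sub>0 \<eta> M T \<alpha> u) \<and>
    (\<forall>\<alpha> u. u 0 = (\<lambda>_. 0) \<and> howard_iteration a\<^sub>0 \<nu> r\<^sub>0 \<eta> M T \<alpha> u \<longrightarrow>
       (\<forall>n v. linear_solution a\<^sub>0 \<nu> r\<^sub>0 \<eta> T (\<alpha> n) v \<longrightarrow>
          (AE z in lebesgue_on (Q T). v z = u (Suc n) z)) \<and>
       (\<lambda>n. X2_norm T (\<lambda>z. u\<^sub>s z - u n z)) \<longlonglongrightarrow> 0 \<and>
       (\<forall>n. X2_norm T (\<lambda>z. u\<^sub>s z - u (Suc n) z) \<le> C\<^sub>T * (X2_norm T (\<lambda>z. u\<^sub>s z - u n z))\<^sup>2))"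
proof -
  have \<kappa>: "0 < \<kappa>" using assms(2,5,7) by simp
  interpret howard a\<^sub>0 \<kappa> \<eta> \<delta> P T \<nu> r\<^sub>0 M
    by unfold_locales (use assms \<kappa> in simp_all)
  show ?thesis
  proof (intro exI[of _ sol] conjI allI impI)
    show "strong_solution a\<^sub>0 \<nu> r\<^sub>0 \<eta> M T sol" by (rule sol_strong_solution)
    show "AE z in lebesgue_on (Q T). v z = sol z" if "strong_solution a\<^sub>0 \<nu> r\<^sub>0 \<eta> M T v" for v
      by (rule strong_solution_unique[OF sol_strong_solution that])
    have "sep (newton 0) sin = (\<lambda>_. 0)" by (simp add: sep_def[abs_def] newton_0)
    then show "\<exists>\<alpha> u. u 0 = (\<lambda>_. 0) \<and> howard_iteration a\<^sub>0 \<nu> r\<^sub>0 \<eta> M T \<alpha> u"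
      using newton_howard_iteration by (intro exI[of _ control] exI[of _ "\<lambda>n. sep (newton n) sin"]) simp
  next
    fix \<alpha> u assume "u 0 = (\<lambda>_. 0) \<and> howard_iteration a\<^sub>0 \<nu> r\<^sub>0 \<eta> M T \<alpha> u"
    then have u0: "u 0 = (\<lambda>_. 0)" and h: "howard_iteration a\<^sub>0 \<nu> r\<^sub>0 \<eta> M T \<alpha> u" by auto
    have X: "X2_norm T (\<lambda>z. sol z - u n z) = X n" for n
      by (rule X2_norm_error[OF howard_iteration_eq_newton(1)[OF u0 h]])
    show "AE z in lebesgue_on (Q T). v z = u (Suc n) z" if "linear_solution a\<^sub>0 \<nu> r\<^sub>0 \<eta> T (\<alpha> n) v" for n v
      using linear_solution_unique[OF howard_iteration_eq_newton(2)[OF u0 h] _ that] h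
      by (simp add: howard_iteration_def)
    show "(\<lambda>n. X2_norm T (\<lambda>z. sol z - u n z)) \<longlonglongrightarrow> 0"
      unfolding X by (rule X_tendsto_0)
    show "X2_norm T (\<lambda>z. sol z - u (Suc n) z) \<le> C\<^sub>T * (X2_norm T (\<lambda>z. sol z - u n z))\<^sup>2" for n
      unfolding X assms(13) by (rule X_quadratic)
  qed
qed

end
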